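(* Assume that there exist positive constants $c_0,\kappa_0,c_1,\kappa_1$ such that $\inf_{|\delta|\le c_0}U'(\theta+\delta)\ge\kappa_0$, $\sup_{|\delta|\le c_1}|U''(\theta+\delta)|\le\kappa_1$, and that $\sup_{t\in\mathbb{R}}|f(t)|<\infty$. Then $$\sup_{z\in\mathbb{R}}\left|\mathbb{P}\left\{\frac{\sqrt n(\hat\theta-\theta)}{\sigma_\theta}\le z\right\}-\Phi(z)\right|\le\frac{C\log n}{\sqrt n},$$ where $C<\infty$ is a positive constant independent of $n$ and $\sigma_\theta^2=\dfrac{4\,\mathrm{Var}\{F(-\xi_1)\}}{\{U'(\theta)\}^2}$.
   Context: For $n\ge2$, $[n]=\{1,\dots,n\}$. Let $X_i=\theta+\xi_i$, $i\in[n]$, be real random variables, where $\theta\in\mathbb{R}$ is an unknown location parameter and $\xi_1,\dots,\xi_n$ are i.i.d. with cumulative distribution function $F(t)=\mathbb{P}(\xi_1\le t)$ and density $f=F'$ (a distribution not depending on $n$). The distribution of $\xi_1$ has pseudomedian zero, i.e. the median of $(\xi_1+\xi_2)/2$ is $0$. Put $U(t)=\mathbb{P}\{(X_1+X_2)/2\le t\}$, so that $\theta=\inf\{t\in\mathbb{R}:U(t)\ge1/2\}$. Let $U_n(t)=\{n(n-1)\}^{-1}\sum_{i\ne j\in[n]}\mathbb{I}\{(X_i+X_j)/2\le t\}$. The Hodges–Lehmann estimator is $\hat\theta=\inf\{t\in\mathbb{R}:U_n(t)\ge1/2\}$. $\Phi$ is the standard normal distribution function. *)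

theory Defs
  imports "HOL-Probability.Probability"
begin

text \<open>The observations \<open>X\<^sub>i = \<theta> + \<xi>\<^sub>i\<close>; samples of size \<open>n\<close> use the indices \<open>i \<in> {1..n}\<close>.\<close>
definition observation :: "real \<Rightarrow> (nat \<Rightarrow> 'a \<Rightarrow> real) \<Rightarrow> nat \<Rightarrow> 'a \<Rightarrow> real" where
  "observation \<theta> \<xi> i \<omega> = \<theta> + \<xi> i \<omega>"

definition is_median :: "'a measure \<Rightarrow> ('a \<Rightarrow> real) \<Rightarrow> real \<Rightarrow> bool" where
  "is_median M Y m \<longleftrightarrow>
     measure M {\<omega> \<in> space M. Y \<omega> \<le> m} \<ge> 1 / 2 \<and>
     measure M {\<omega> \<in> space M. Y \<omega> \<ge> m} \<ge> 1 / 2"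

definition is_pseudomedian :: "'a measure \<Rightarrow> (nat \<Rightarrow> 'a \<Rightarrow> real) \<Rightarrow> real \<Rightarrow> bool" where
  "is_pseudomedian M Y m \<longleftrightarrow> is_median M (\<lambda>\<omega>. (Y 1 \<omega> + Y 2 \<omega>) / 2) m"

text \<open>The function \<open>U\<close>.\<close>
definition walsh_cdf :: "'a measure \<Rightarrow> (nat \<Rightarrow> 'a \<Rightarrow> real) \<Rightarrow> real \<Rightarrow> real" where
  "walsh_cdf M X t = measure M {\<omega> \<in> space M. (X 1 \<omega> + X 2 \<omega>) / 2 \<le> t}"

text \<open>The function \<open>U\<^sub>n\<close>, evaluated at the data \<open>x\<^sub>1, \<dots>, x\<^sub>n\<close>.\<close>
definition empirical_walsh_cdf :: "nat \<Rightarrow> (nat \<Rightarrow> real) \<Rightarrow> real \<Rightarrow> real" where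
  "empirical_walsh_cdf n x t =
     (\<Sum>(i, j) \<in> {(i, j). i \<in> {1..n} \<and> j \<in> {1..n} \<and> i \<noteq> j}. of_bool ((x i + x j) / 2 \<le> t))
       / (real n * (real n - 1))"

text \<open>For \<open>n \<ge> 2\<close> the set below is nonempty and bounded below, so \<open>Inf\<close> is the actual infimum.\<close>
definition hodges_lehmann :: "nat \<Rightarrow> (nat \<Rightarrow> real) \<Rightarrow> real" where
  "hodges_lehmann n x = Inf {t. empirical_walsh_cdf n x t \<ge> 1 / 2}"

definition hodges_lehmann_sd :: "'a measure \<Rightarrow> real \<Rightarrow> (nat \<Rightarrow> 'a \<Rightarrow> real) \<Rightarrow> real" where
  "hodges_lehmann_sd M \<theta> \<xi> =
     sqrt (4 * prob_space.variance M (\<lambda>\<omega>. cdf (distr M borel (\<xi> 1)) (- \<xi> 1 \<omega>))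
       / (deriv (walsh_cdf M (observation \<theta> \<xi>)) \<theta>)\<^sup>2)"

text \<open>
  \<open>deriv\<close> is a total operator, so the existence of the derivatives is spelled out:
  the two predicates express \<open>inf\<^bsub>|\<delta>| \<le> c\<^esub> g'(\<theta> + \<delta>) \<ge> \<kappa>\<close> and
  \<open>sup\<^bsub>|\<delta>| \<le> c\<^esub> |g''(\<theta> + \<delta>)| \<le> \<kappa>\<close>. A second derivative at a point presupposes
  a first derivative on a neighbourhood of it.
\<close>
definition deriv_ge_near :: "(real \<Rightarrow> real) \<Rightarrow> real \<Rightarrow> real \<Rightarrow> real \<Rightarrow> bool" where
  "deriv_ge_near g \<theta> c \<kappa> \<longleftrightarrow>
     (\<forall>\<delta>. \<bar>\<delta>\<bar> \<le> c \<longrightarrow> g differentiable (at (\<theta> + \<delta>)) \<and> deriv g (\<theta> + \<delta>) \<ge> \<kappa>)"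

definition abs_deriv2_le_near :: "(real \<Rightarrow> real) \<Rightarrow> real \<Rightarrow> real \<Rightarrow> real \<Rightarrow> bool" where
  "abs_deriv2_le_near g \<theta> c \<kappa> \<longleftrightarrow>
     (\<forall>\<delta>. \<bar>\<delta>\<bar> \<le> c \<longrightarrow>
        (\<forall>\<^sub>F t in nhds (\<theta> + \<delta>). g differentiable (at t)) \<and>
        deriv g differentiable (at (\<theta> + \<delta>)) \<and>
        \<bar>deriv (deriv g) (\<theta> + \<delta>)\<bar> \<le> \<kappa>)"

end

theory Submission
  imports Defs
begin

text \<open>
The event \<open>\<surd>n (\<theta>' - \<theta>) / \<sigma> \<le> z\<close> for the Hodges--Lehmann estimator \<open>\<theta>'\<close> is the event
\<open>U\<^sub>n(\<theta> + \<delta>) \<ge> 1/2\<close> with \<open>\<delta> = z \<sigma> / \<surd>n\<close>, because \<open>U\<^sub>n\<close> is a right-continuous step function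
(\<open>hodges_lehmann_le_iff\<close>). So the claim is a Berry--Esseen bound for a U-statistic of order two
whose kernel \<open>of_bool (x + y \<le> 2 \<delta>)\<close> moves with \<open>z\<close>.

With the Hoeffding decomposition of the kernel into its mean \<open>H(\<delta>)\<close>, its projection
\<open>g\<^sub>\<delta>(x) = F(2\<delta> - x) - H(\<delta>)\<close> and a degenerate remainder \<open>q\<^sub>\<delta>\<close>, the event reads \<open>W + \<Delta> \<le> z\<close>. Here
\<open>W\<close> is the normalized sum of the \<open>- g\<^sub>0(\<xi>\<^sub>i)\<close>, with a summand that is free of \<open>z\<close>, and \<open>\<Delta>\<close> collects
three errors: the Taylor remainder of \<open>H\<close> at \<open>0\<close>, of order \<open>z\<^sup>2/\<surd>n\<close>; the sum of \<open>g\<^sub>\<delta> - g\<^sub>0\<close>, of order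
\<open>|\<delta>|\<close> in \<open>L\<^sup>2\<close> since \<open>F\<close> is Lipschitz; and the degenerate part, of order \<open>1/\<surd>n\<close> in \<open>L\<^sup>2\<close> since its
terms are pairwise orthogonal.

The passage from \<open>W\<close> to \<open>W + \<Delta>\<close> uses the randomized concentration inequality of Chen and Shao
(\<open>randomized_concentration\<close>), which needs only second moments of \<open>\<Delta>\<close> and of its changes
when one observation is left out; \<open>W\<close> itself is handled by Stein's method (\<open>berry_esseen\<close>), where
the same inequality controls the jump of the derivative of the Stein solution. Together they give
\<open>nonlinear_berry_esseen\<close> and, for the statistic at hand, an error \<open>C (1 + z\<^sup>2) / \<surd>n\<close> at every \<open>z\<close>
(\<open>normal_approximation\<close>). For \<open>|z| \<le> \<surd>(ln n)\<close> this is the asserted rate; beyond, both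
distribution functions are monotone and the normal tail at \<open>\<surd>(ln n)\<close> is already \<open>O(1/\<surd>n)\<close>
(\<open>kolmogorov_distance_from_window\<close>).

That \<open>\<sigma> > 0\<close>, i.e. \<open>Var F(-\<xi>) > 0\<close>, is proved in \<open>variance_cdf_reflection_pos\<close>. Every constant is
a function of the density, the radii and the bounds alone, hence common to all \<open>n\<close> and all samples.
\<close>

section \<open>The standard normal distribution and the Stein equation\<close>

abbreviation (input) \<phi> :: "real \<Rightarrow> real" where "\<phi> \<equiv> std_normal_density"
abbreviation (input) \<Phi> :: "real \<Rightarrow> real" where "\<Phi> \<equiv> cdf std_normal_distribution"

interpretation std_normal: real_distribution std_normal_distribution
  by (rule real_dist_normal_dist)

lemma std_normal_density_deriv: "(\<phi> has_real_derivative - x * \<phi> x) (at x)"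
proof -
  have "((\<lambda>x. c * exp (- x\<^sup>2 / 2)) has_real_derivative - x * (c * exp (- x\<^sup>2 / 2))) (at x)" for c :: real
    by (auto intro!: derivative_eq_intros)
  from this[of "1 / sqrt (2 * pi)"] show ?thesis
    unfolding std_normal_density_def[abs_def] .
qed

lemma std_normal_cdf_deriv: "(\<Phi> has_real_derivative \<phi> x) (at x)"
proof -
  let ?a = "x - 1" and ?b = "x + 1"
  have cont: "continuous_on S \<phi>" for S
    using std_normal_density_deriv by (meson DERIV_isCont continuous_at_imp_continuous_on)
  have eq: "\<Phi> y = \<Phi> ?a + integral {?a..y} \<phi>" if "y \<in> {?a<..<?b}" for y
  proof -
    have int: "set_integrable lborel {?a..y} \<phi>"
      by (rule borel_integrable_atLeastAtMost') (rule cont)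
    have "\<Phi> y - \<Phi> ?a = measure std_normal_distribution {?a<..y}"
      using that by (intro std_normal.cdf_diff_eq) auto
    also have "\<dots> = (LINT t|std_normal_distribution. indicator {?a<..y} t)"
      by (subst Bochner_Integration.integral_indicator) auto
    also have "\<dots> = (LINT t|lborel. \<phi> t *\<^sub>R indicator {?a<..y} t)"
      by (rule integral_density) (auto simp: normal_density_nonneg)
    also have "\<dots> = (LINT t|lborel. indicator {?a..y} t *\<^sub>R \<phi> t)"
      unfolding real_scaleR_def by (rule integral_cong_AE) (use AE_lborel_singleton[of ?a] in \<open>auto simp: indicator_def\<close>)
    also have "\<dots> = integral {?a..y} \<phi>"
      using set_borel_integral_eq_integral(2)[OF int] by (simp add: set_lebesgue_integral_def)
    finally show ?thesis by simp
  qed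
  have "((\<lambda>y. integral {?a..y} \<phi>) has_real_derivative \<phi> x) (at x within {?a..?b})"
    by (rule integral_has_real_derivative[OF cont]) auto
  then have "((\<lambda>y. integral {?a..y} \<phi>) has_real_derivative \<phi> x) (at x)"
    by (subst (asm) at_within_Icc_at) auto
  then have "((\<lambda>y. \<Phi> ?a + integral {?a..y} \<phi>) has_real_derivative \<phi> x) (at x)"
    by (rule DERIV_cong[OF DERIV_add[OF DERIV_const]]) simp
  then show ?thesis
    by (rule has_field_derivative_transform_within_open[where S="{?a<..<?b}"]) (auto simp only: eq greaterThanLessThan_iff, auto)
qed

lemma std_normal_cdf_minus: "\<Phi> (- x) = 1 - \<Phi> x"
proof -
  let ?h = "\<lambda>x. \<Phi> x + \<Phi> (- x)"
  have "(?h has_real_derivative 0) (at x)" for x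
  proof -
    have "((\<lambda>x. \<Phi> (- x)) has_real_derivative \<phi> (- x) * (-1)) (at x)"
      by (rule DERIV_chain2[OF std_normal_cdf_deriv]) (auto intro!: derivative_eq_intros)
    from DERIV_add[OF std_normal_cdf_deriv this] show ?thesis
      by (simp add: std_normal_density_def)
  qed
  then have const: "?h y = ?h x" for y
    using DERIV_isconst_all by blast
  have "(?h \<longlongrightarrow> 1 + 0) at_top"
    by (intro tendsto_add std_normal.cdf_lim_at_top_prob
        filterlim_compose[OF std_normal.cdf_lim_at_bot filterlim_uminus_at_bot_at_top])
  moreover have "(?h \<longlongrightarrow> ?h x) at_top"
    by (rule tendsto_eventually) (use const in auto)
  ultimately show ?thesis
    using tendsto_unique[of at_top ?h] by force
qed

lemma std_normal_density_minus: "\<phi> (- x) = \<phi> x"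
  by (simp add: std_normal_density_def)

lemma std_normal_density_antimono: "\<bar>x\<bar> \<le> \<bar>y\<bar> \<Longrightarrow> \<phi> y \<le> \<phi> x"
  unfolding std_normal_density_def by (auto intro!: divide_right_mono simp: abs_le_square_iff)

lemma std_normal_density_pos: "\<phi> x > 0"
  by (simp add: normal_density_pos)

text \<open>For \<open>x > 0\<close> the function \<open>\<phi>(y)/y - (1 - \<Phi>(y))\<close> has derivative \<open>- \<phi>(y)/y\<^sup>2 \<le> 0\<close> and tends to \<open>0\<close> at
infinity, so it is nonnegative.\<close>
lemma mills_ratio: "x * (1 - \<Phi> x) \<le> \<phi> x"
proof (cases "x > 0")
  case False
  then have "x * (1 - \<Phi> x) \<le> 0"
    using std_normal.cdf_bounded_prob[of x] by (simp add: mult_le_0_iff)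
  then show ?thesis using std_normal_density_pos[of x] by linarith
next
  case True
  let ?h = "\<lambda>y. \<phi> y / y - (1 - \<Phi> y)"
  have der: "(?h has_real_derivative - \<phi> y / y\<^sup>2) (at y)" if "y \<ge> x" for y
    using that True
    by (auto intro!: derivative_eq_intros std_normal_density_deriv std_normal_cdf_deriv
        simp: field_simps power2_eq_square)
  have mono: "?h y \<le> ?h x" if "y \<ge> x" for y
  proof (rule DERIV_nonpos_imp_nonincreasing[OF that])
    fix u assume "x \<le> u" "u \<le> y"
    then show "\<exists>d. (?h has_real_derivative d) (at u) \<and> d \<le> 0"
      using der[of u] std_normal_density_pos[of u]
      by (intro exI[of _ "- \<phi> u / u\<^sup>2"]) (auto simp: divide_le_0_iff)
  qed
  have "((\<lambda>y::real. 1 / y) \<longlongrightarrow> 0) at_top"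
    unfolding inverse_eq_divide[symmetric] by (rule tendsto_inverse_0_at_top[OF filterlim_ident])
  moreover have "\<forall>\<^sub>F y in at_top. norm (\<phi> y / y) \<le> 1 / y"
  proof (rule eventually_mono[OF eventually_gt_at_top[of 0]])
    fix y :: real assume "y > 0"
    have "\<phi> y \<le> \<phi> 0" by (rule std_normal_density_antimono) simp
    also have "\<phi> 0 \<le> 1" using pi_gt3 by (simp add: std_normal_density_def field_simps)
    finally show "norm (\<phi> y / y) \<le> 1 / y"
      using \<open>y > 0\<close> std_normal_density_pos[of y] by (simp add: divide_right_mono)
  qed
  ultimately have "((\<lambda>y. \<phi> y / y) \<longlongrightarrow> 0) at_top"
    by (rule Lim_null_comparison[rotated])
  then have "(?h \<longlongrightarrow> 0 - (1 - 1)) at_top"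
    by (intro tendsto_diff tendsto_const std_normal.cdf_lim_at_top_prob)
  then have "(?h \<longlongrightarrow> 0) at_top" by simp
  moreover have "\<forall>\<^sub>F y in at_top. ?h y \<le> ?h x"
    using eventually_ge_at_top[of x] by eventually_elim (rule mono)
  ultimately have "0 \<le> ?h x"
    by (rule tendsto_upperbound) simp
  then show ?thesis using True by (simp add: field_simps)
qed

lemma std_normal_density_one: "1 \<le> 5 * \<phi> 1"
proof -
  have "exp (1/2) * sqrt (2 * pi) \<le> 5"
  proof (rule power2_le_imp_le)
    have "(exp (1/2) * sqrt (2 * pi))\<^sup>2 = exp 1 * (2 * pi)"
      by (simp add: power_mult_distrib flip: exp_of_nat_mult)
    also have "\<dots> \<le> 3 * (2 * 4)"
      using exp_le pi_less_4 by (intro mult_mono) auto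
    finally show "(exp (1/2) * sqrt (2 * pi))\<^sup>2 \<le> 5\<^sup>2" by simp
  qed simp
  then have "1 \<le> 5 / (exp (1/2) * sqrt (2 * pi))"
    by (simp add: field_simps)
  then show ?thesis by (simp add: std_normal_density_def exp_minus field_simps)
qed

text \<open>For \<open>x \<ge> 1\<close> this is the Mills ratio bound; on \<open>[0, 1]\<close> the density is at least \<open>\<phi>(1) \<ge> 1/5\<close>.\<close>
lemma std_normal_tail_le_density:
  assumes "x \<ge> 0"
  shows "1 - \<Phi> x \<le> 5 * \<phi> x"
proof (cases "x \<ge> 1")
  case True
  have "1 - \<Phi> x \<le> x * (1 - \<Phi> x)"
    using True std_normal.cdf_bounded_prob[of x] by (simp add: mult_le_cancel_right1)
  also have "\<dots> \<le> \<phi> x" by (rule mills_ratio)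
  finally show ?thesis using std_normal_density_pos[of x] by linarith
next
  case False
  then have "\<phi> 1 \<le> \<phi> x" using assms by (intro std_normal_density_antimono) auto
  then show ?thesis using std_normal_density_one std_normal.cdf_nonneg[of x] by linarith
qed

text \<open>The bounded solution of Stein's equation \<open>f'(w) - w f(w) = of_bool (w \<le> z) - \<Phi>(z)\<close>, in closed form.
It is not differentiable at \<open>w = z\<close>.\<close>
definition stein :: "real \<Rightarrow> real \<Rightarrow> real" where
  "stein z w = (if w \<le> z then (1 - \<Phi> z) * \<Phi> w else \<Phi> z * (1 - \<Phi> w)) / \<phi> w"

text \<open>The derivative of the solution off \<open>z\<close>, with the value at \<open>z\<close> prescribed by Stein's equation: the
equation then holds everywhere.\<close>
definition stein_deriv :: "real \<Rightarrow> real \<Rightarrow> real" where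
  "stein_deriv z w = w * stein z w + of_bool (w \<le> z) - \<Phi> z"

lemma std_normal_cdf_le_density: "x \<le> 0 \<Longrightarrow> \<Phi> x \<le> 5 * \<phi> x"
  using std_normal_tail_le_density[of "- x"]
  by (simp add: std_normal_cdf_minus std_normal_density_minus)

lemma stein_nonneg: "stein z w \<ge> 0"
  unfolding stein_def
  by (auto intro!: divide_nonneg_pos mult_nonneg_nonneg std_normal_density_pos
      std_normal.cdf_nonneg simp: std_normal.cdf_bounded_prob)

text \<open>By monotonicity of \<open>\<Phi>\<close> the numerator is at most \<open>\<Phi>(w) (1 - \<Phi>(w))\<close>. Which of the two bounds is the
useful one depends on the sign of \<open>w\<close>.\<close>
lemma stein_le_cdf: "stein z w \<le> \<Phi> w / \<phi> w"
  and stein_le_tail: "stein z w \<le> (1 - \<Phi> w) / \<phi> w"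
proof -
  note [simp] = std_normal.cdf_nonneg std_normal.cdf_bounded_prob
  have "(if w \<le> z then (1 - \<Phi> z) * \<Phi> w else \<Phi> z * (1 - \<Phi> w)) \<le> \<Phi> w"
  proof (cases "w \<le> z")
    case True then show ?thesis by (simp add: mult_left_le_one_le)
  next
    case False
    then have "\<Phi> z * (1 - \<Phi> w) \<le> \<Phi> w * 1"
      by (intro mult_mono std_normal.cdf_nondecreasing) auto
    then show ?thesis using False by simp
  qed
  then show "stein z w \<le> \<Phi> w / \<phi> w"
    unfolding stein_def by (intro divide_right_mono) auto
  have "(if w \<le> z then (1 - \<Phi> z) * \<Phi> w else \<Phi> z * (1 - \<Phi> w)) \<le> 1 - \<Phi> w"
  proof (cases "w \<le> z")
    case True
    then have "(1 - \<Phi> z) * \<Phi> w \<le> (1 - \<Phi> w) * 1"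
      using std_normal.cdf_nondecreasing[of w z] by (intro mult_mono) auto
    then show ?thesis using True by simp
  next
    case False then show ?thesis by (simp add: mult_left_le_one_le)
  qed
  then show "stein z w \<le> (1 - \<Phi> w) / \<phi> w"
    unfolding stein_def by (intro divide_right_mono) auto
qed

lemma stein_bound: "\<bar>stein z w\<bar> \<le> 5"
proof -
  have "stein z w \<le> 5"
  proof (cases "w \<le> 0")
    case True
    then have "\<Phi> w / \<phi> w \<le> 5"
      using std_normal_cdf_le_density[of w] std_normal_density_pos[of w] by (simp add: pos_divide_le_eq)
    then show ?thesis using stein_le_cdf[of z w] by linarith
  next
    case False
    then have "(1 - \<Phi> w) / \<phi> w \<le> 5"
      using std_normal_tail_le_density[of w] std_normal_density_pos[of w] by (simp add: pos_divide_le_eq)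
    then show ?thesis using stein_le_tail[of z w] by linarith
  qed
  then show ?thesis using stein_nonneg[of z w] by simp
qed

lemma id_times_stein_bound: "\<bar>w * stein z w\<bar> \<le> 1"
proof -
  have *: "\<bar>w\<bar> * stein z w \<le> 1"
  proof (cases "w \<le> 0")
    case True
    have "- w * stein z w \<le> - w * (\<Phi> w / \<phi> w)"
      using True stein_le_cdf[of z w] by (intro mult_left_mono) auto
    also have "\<dots> \<le> 1"
      using mills_ratio[of "- w"] std_normal_density_pos[of w]
      by (simp add: std_normal_cdf_minus std_normal_density_minus field_simps)
    finally show ?thesis using True by simp
  next
    case False
    have "w * stein z w \<le> w * ((1 - \<Phi> w) / \<phi> w)"
      using False stein_le_tail[of z w] by (intro mult_left_mono) auto
    also have "\<dots> \<le> 1"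
      using mills_ratio[of w] std_normal_density_pos[of w] by (simp add: field_simps)
    finally show ?thesis using False by simp
  qed
  then show ?thesis using stein_nonneg[of z w] by (simp add: abs_mult)
qed

lemma stein_deriv_bound: "\<bar>stein_deriv z w\<bar> \<le> 2"
  using id_times_stein_bound[of w z] std_normal.cdf_bounded_prob[of z] std_normal.cdf_nonneg[of z]
  unfolding stein_deriv_def by (auto simp: of_bool_def)

lemma stein_left_deriv:
  "((\<lambda>w. (1 - \<Phi> z) * \<Phi> w / \<phi> w) has_real_derivative
     w * ((1 - \<Phi> z) * \<Phi> w / \<phi> w) + (1 - \<Phi> z)) (at w)"
  using std_normal_density_pos[of w]
  by (auto intro!: derivative_eq_intros std_normal_density_deriv std_normal_cdf_deriv
      simp: field_simps power2_eq_square)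

lemma stein_right_deriv:
  "((\<lambda>w. \<Phi> z * (1 - \<Phi> w) / \<phi> w) has_real_derivative
     w * (\<Phi> z * (1 - \<Phi> w) / \<phi> w) - \<Phi> z) (at w)"
  using std_normal_density_pos[of w]
  by (auto intro!: derivative_eq_intros std_normal_density_deriv std_normal_cdf_deriv
      simp: field_simps power2_eq_square)

lemma stein_has_deriv:
  assumes "w \<noteq> z"
  shows "(stein z has_real_derivative stein_deriv z w) (at w)"
proof (cases "w < z")
  case True
  have "(stein z has_real_derivative w * ((1 - \<Phi> z) * \<Phi> w / \<phi> w) + (1 - \<Phi> z)) (at w)"
    by (rule has_field_derivative_transform_within_open[OF stein_left_deriv, where S="{..<z}"])
      (use True in \<open>auto simp: stein_def\<close>)
  then show ?thesis using True by (simp add: stein_deriv_def stein_def algebra_simps)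
next
  case False
  have "(stein z has_real_derivative w * (\<Phi> z * (1 - \<Phi> w) / \<phi> w) - \<Phi> z) (at w)"
    by (rule has_field_derivative_transform_within_open[OF stein_right_deriv, where S="{z<..}"])
      (use False assms in \<open>auto simp: stein_def\<close>)
  then show ?thesis using False assms by (simp add: stein_deriv_def stein_def)
qed

lemma stein_at_top_piece: "z \<le> w \<Longrightarrow> stein z w = \<Phi> z * (1 - \<Phi> w) / \<phi> w"
  by (cases "w = z") (auto simp: stein_def)

lemma stein_isCont: "isCont (stein z) w"
proof (cases "w = z")
  case False
  then show ?thesis using stein_has_deriv DERIV_isCont by blast
next
  case True
  have "continuous (at z within {..z}) (stein z)"
    by (rule continuous_transform_within[OF
        continuous_at_imp_continuous_within[OF DERIV_isCont[OF stein_left_deriv[of z]]]])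
      (auto simp: stein_def intro: zero_less_one)
  moreover have "continuous (at z within {z..}) (stein z)"
    by (rule continuous_transform_within[OF
        continuous_at_imp_continuous_within[OF DERIV_isCont[OF stein_right_deriv[of z]]]])
      (auto simp: stein_at_top_piece intro: zero_less_one)
  moreover have sub: "{..<z} \<subseteq> {..z}" "{z<..} \<subseteq> {z..}"
    by (auto intro: less_imp_le)
  ultimately show ?thesis
    unfolding True continuous_at_split
    by (meson continuous_within_subset sub)
qed

text \<open>The mean value theorem applies on both sides of \<open>z\<close>, and continuity at \<open>z\<close> joins them.\<close>
lemma stein_lipschitz: "\<bar>stein z a - stein z b\<bar> \<le> 2 * \<bar>a - b\<bar>"
proof -
  have seg: "\<bar>stein z b - stein z a\<bar> \<le> 2 * (b - a)" if "a < b" "z \<notin> {a<..<b}" for a b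
  proof -
    obtain \<zeta> where \<zeta>: "a < \<zeta>" "\<zeta> < b" "stein z b - stein z a = (b - a) * stein_deriv z \<zeta>"
    proof -
      have "\<exists>l \<zeta>. a < \<zeta> \<and> \<zeta> < b \<and> (stein z has_real_derivative l) (at \<zeta>)
              \<and> stein z b - stein z a = (b - a) * l"
      proof (rule MVT[OF \<open>a < b\<close>])
        show "continuous_on {a..b} (stein z)"
          using stein_isCont by (simp add: continuous_at_imp_continuous_on)
        fix x assume "a < x" "x < b"
        then have "x \<noteq> z" using \<open>z \<notin> {a<..<b}\<close> by auto
        then show "stein z differentiable (at x)"
          using stein_has_deriv real_differentiable_def by blast
      qed
      then obtain l \<zeta> where *: "a < \<zeta>" "\<zeta> < b" "(stein z has_real_derivative l) (at \<zeta>)"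
        "stein z b - stein z a = (b - a) * l" by blast
      moreover have "\<zeta> \<noteq> z" using * \<open>z \<notin> {a<..<b}\<close> by auto
      ultimately have "l = stein_deriv z \<zeta>" using stein_has_deriv DERIV_unique by blast
      with * that show ?thesis by blast
    qed
    then have "\<bar>stein z b - stein z a\<bar> = (b - a) * \<bar>stein_deriv z \<zeta>\<bar>"
      using that by (simp add: abs_mult)
    then show ?thesis
      using mult_right_mono[OF stein_deriv_bound[of z \<zeta>], of "b - a"] \<open>a < b\<close>
      by (simp add: mult.commute)
  qed
  have le: "\<bar>stein z b - stein z a\<bar> \<le> 2 * (b - a)" if "a < b" for a b
  proof (cases "z \<in> {a<..<b}")
    case True
    then show ?thesis using seg[of a z] seg[of z b] by auto
  qed (use seg that in auto)
  show ?thesis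
    using le[of a b] le[of b a] by (cases a b rule: linorder_cases) auto
qed

lemma id_times_stein_increment:
  "\<bar>(w + s) * stein z (w + s) - w * stein z w\<bar> \<le> \<bar>s\<bar> * (2 * \<bar>w\<bar> + 5)"
proof -
  have "(w + s) * stein z (w + s) - w * stein z w =
      w * (stein z (w + s) - stein z w) + s * stein z (w + s)"
    by (simp add: algebra_simps)
  also have "\<bar>\<dots>\<bar> \<le> \<bar>w\<bar> * \<bar>stein z (w + s) - stein z w\<bar> + \<bar>s\<bar> * \<bar>stein z (w + s)\<bar>"
    by (metis abs_mult abs_triangle_ineq)
  also have "\<dots> \<le> \<bar>w\<bar> * (2 * \<bar>s\<bar>) + \<bar>s\<bar> * 5"
    using stein_lipschitz[of z "w + s" w] stein_bound[of z "w + s"]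
    by (intro add_mono mult_left_mono) auto
  finally show ?thesis by (simp add: algebra_simps)
qed

text \<open>By Stein's equation the derivative changes as \<open>w f(w)\<close> does, plus a jump of size one that is only
seen when \<open>w\<close> is within \<open>\<beta>\<close> of \<open>z\<close>.\<close>
lemma stein_deriv_increment:
  assumes "\<bar>t\<bar> \<le> \<beta>"
  shows "\<bar>stein_deriv z (w + t) - stein_deriv z w\<bar>
    \<le> \<beta> * (2 * \<bar>w\<bar> + 5) + of_bool (\<bar>w - z\<bar> \<le> \<beta>)"
proof -
  have "\<bar>t\<bar> * (2 * \<bar>w\<bar> + 5) \<le> \<beta> * (2 * \<bar>w\<bar> + 5)"
    using assms by (intro mult_right_mono) auto
  moreover have "\<bar>of_bool (w + t \<le> z) - of_bool (w \<le> z) :: real\<bar> \<le> of_bool (\<bar>w - z\<bar> \<le> \<beta>)"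
    using assms by (auto simp: of_bool_def)
  ultimately show ?thesis
    using id_times_stein_increment[of w t z] unfolding stein_deriv_def by linarith
qed

text \<open>First-order Taylor expansion of the solution. Away from \<open>z\<close> the mean value theorem reduces it to the
increment of the derivative; near \<open>z\<close> the crude bound by the Lipschitz constant \<open>2\<close> is paid.\<close>
lemma stein_remainder:
  assumes t: "\<bar>t\<bar> \<le> \<beta>"
  shows "\<bar>stein z (w + t) - stein z w - t * stein_deriv z w\<bar>
    \<le> \<bar>t\<bar> * (\<beta> * (2 * \<bar>w\<bar> + 5) + 4 * of_bool (\<bar>w - z\<bar> \<le> \<beta>))"
proof (cases "\<bar>w - z\<bar> \<le> \<beta>")
  case True
  have "\<bar>stein z (w + t) - stein z w - t * stein_deriv z w\<bar>
      \<le> \<bar>stein z (w + t) - stein z w\<bar> + \<bar>t\<bar> * \<bar>stein_deriv z w\<bar>"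
    by (metis abs_mult abs_triangle_ineq4)
  also have "\<dots> \<le> 2 * \<bar>t\<bar> + \<bar>t\<bar> * 2"
    using stein_lipschitz[of z "w + t" w] stein_deriv_bound[of z w]
    by (intro add_mono mult_left_mono) auto
  also have "\<dots> = \<bar>t\<bar> * 4" by simp
  also have "\<dots> \<le> \<bar>t\<bar> * (\<beta> * (2 * \<bar>w\<bar> + 5) + 4 * of_bool (\<bar>w - z\<bar> \<le> \<beta>))"
    using True t by (intro mult_left_mono) auto
  finally show ?thesis .
next
  case False
  show ?thesis
  proof (cases "t = 0")
    case True then show ?thesis by simp
  next
    case nz: False
    have off: "w + s \<noteq> z" if "\<bar>s\<bar> \<le> \<bar>t\<bar>" for s using that t False by auto
    obtain s where s: "\<bar>s\<bar> \<le> \<bar>t\<bar>" "stein z (w + t) - stein z w = t * stein_deriv z (w + s)"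
    proof (cases "t > 0")
      case True
      then have "\<exists>u. w < u \<and> u < w + t \<and>
          stein z (w + t) - stein z w = ((w + t) - w) * stein_deriv z u"
        using off[of "_ - w"] by (intro MVT2 stein_has_deriv) force+
      then obtain u where "w < u" "u < w + t"
        "stein z (w + t) - stein z w = t * stein_deriv z u" by auto
      with that[of "u - w"] True show ?thesis by simp
    next
      case F: False
      then have "\<exists>u. w + t < u \<and> u < w \<and>
          stein z w - stein z (w + t) = (w - (w + t)) * stein_deriv z u"
        using off[of "_ - w"] nz by (intro MVT2 stein_has_deriv) force+
      then obtain u where u: "w + t < u" "u < w"
        "stein z w - stein z (w + t) = - t * stein_deriv z u" by auto
      then have "stein z (w + t) - stein z w = t * stein_deriv z (w + (u - w))" by simp
      with that[of "u - w"] F u show ?thesis by simp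
    qed
    have sb: "\<bar>s\<bar> \<le> \<beta>" using s t by linarith
    have "\<bar>stein z (w + t) - stein z w - t * stein_deriv z w\<bar>
        = \<bar>t\<bar> * \<bar>stein_deriv z (w + s) - stein_deriv z w\<bar>"
      by (simp add: s flip: abs_mult right_diff_distrib)
    also have "\<dots> \<le> \<bar>t\<bar> * (\<beta> * (2 * \<bar>w\<bar> + 5) + 4 * of_bool (\<bar>w - z\<bar> \<le> \<beta>))"
      using stein_deriv_increment[OF sb, of z w] False by (intro mult_left_mono) auto
    finally show ?thesis .
  qed
qed

lemma borel_measurable_stein [measurable]: "stein z \<in> borel_measurable borel"
  using stein_isCont by (intro borel_measurable_continuous_onI) (simp add: continuous_at_imp_continuous_on)

lemma borel_measurable_stein_deriv [measurable]: "stein_deriv z \<in> borel_measurable borel"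
  unfolding stein_deriv_def[abs_def] by measurable

section \<open>Sums of bounded independent variables: randomized concentration\<close>

context prob_space begin

lemma integrable_bounded:
  fixes X :: "'a \<Rightarrow> real"
  assumes "X \<in> borel_measurable M" "\<And>\<omega>. \<omega> \<in> space M \<Longrightarrow> \<bar>X \<omega>\<bar> \<le> B"
  shows "integrable M X"
  using assms by (intro integrable_const_bound[of _ B]) auto

lemma square_integrable_bounded:
  fixes X :: "'a \<Rightarrow> real"
  assumes [measurable]: "X \<in> borel_measurable M" and bd: "\<And>\<omega>. \<omega> \<in> space M \<Longrightarrow> \<bar>X \<omega>\<bar> \<le> b"
  shows "integrable M (\<lambda>\<omega>. (X \<omega>)\<^sup>2)"
proof (rule integrable_bounded[of _ "b\<^sup>2"])
  fix \<omega> assume "\<omega> \<in> space M"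
  then show "\<bar>(X \<omega>)\<^sup>2\<bar> \<le> b\<^sup>2"
    unfolding abs_power2 using bd[of \<omega>] by (intro power2_le_iff_abs_le[THEN iffD2]) auto
qed simp

lemma integrable_indicator_event: "A \<in> events \<Longrightarrow> integrable M (indicator A :: 'a \<Rightarrow> real)"
  by (rule integrable_real_indicator) (auto simp: less_top[symmetric])

lemma expectation_square_sum_orthogonal:
  fixes Z :: "'i \<Rightarrow> 'a \<Rightarrow> real" and c :: real
  assumes "finite A"
    and [measurable]: "\<And>a. a \<in> A \<Longrightarrow> Z a \<in> borel_measurable M"
    and bd: "\<And>a \<omega>. a \<in> A \<Longrightarrow> \<omega> \<in> space M \<Longrightarrow> \<bar>Z a \<omega>\<bar> \<le> c"
    and orth: "\<And>a b. a \<in> A \<Longrightarrow> b \<in> A \<Longrightarrow> a \<noteq> b \<Longrightarrow> expectation (\<lambda>\<omega>. Z a \<omega> * Z b \<omega>) = 0"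
  shows "expectation (\<lambda>\<omega>. (\<Sum>a\<in>A. Z a \<omega>)\<^sup>2) = (\<Sum>a\<in>A. expectation (\<lambda>\<omega>. (Z a \<omega>)\<^sup>2))"
proof -
  have int: "integrable M (\<lambda>\<omega>. Z a \<omega> * Z b \<omega>)" if "a \<in> A" "b \<in> A" for a b
  proof (rule integrable_bounded[of _ "c * c"])
    fix \<omega> assume "\<omega> \<in> space M"
    then show "\<bar>Z a \<omega> * Z b \<omega>\<bar> \<le> c * c"
      using bd that unfolding abs_mult by (intro mult_mono) (auto intro: order_trans[OF abs_ge_zero])
  qed (use that in measurable)
  have "expectation (\<lambda>\<omega>. (\<Sum>a\<in>A. Z a \<omega>)\<^sup>2) = expectation (\<lambda>\<omega>. \<Sum>a\<in>A. \<Sum>b\<in>A. Z a \<omega> * Z b \<omega>)"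
    by (simp add: power2_eq_square sum_product)
  also have "\<dots> = (\<Sum>a\<in>A. \<Sum>b\<in>A. expectation (\<lambda>\<omega>. Z a \<omega> * Z b \<omega>))"
    by (subst Bochner_Integration.integral_sum, force intro: int)
      (intro sum.cong refl Bochner_Integration.integral_sum int)
  also have "\<dots> = (\<Sum>a\<in>A. \<Sum>b\<in>A. if a = b then expectation (\<lambda>\<omega>. (Z a \<omega>)\<^sup>2) else 0)"
    using orth by (intro sum.cong refl) (auto simp: power2_eq_square)
  also have "\<dots> = (\<Sum>a\<in>A. expectation (\<lambda>\<omega>. (Z a \<omega>)\<^sup>2))"
    using \<open>finite A\<close> by (simp add: sum.delta)
  finally show ?thesis .
qed

lemma expectation_le_bound:
  fixes X :: "'a \<Rightarrow> real"
  assumes "X \<in> borel_measurable M" "\<And>\<omega>. \<omega> \<in> space M \<Longrightarrow> 0 \<le> X \<omega>" "\<And>\<omega>. \<omega> \<in> space M \<Longrightarrow> X \<omega> \<le> B"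
  shows "expectation X \<le> B"
  using assms by (intro integral_le_const AE_I2 integrable_bounded[of _ B]) (auto simp: abs_of_nonneg)

lemma expectation_square_sum_orthogonal_le:
  fixes Z :: "'i \<Rightarrow> 'a \<Rightarrow> real" and c :: real
  assumes "finite A"
    and [measurable]: "\<And>a. a \<in> A \<Longrightarrow> Z a \<in> borel_measurable M"
    and bd: "\<And>a \<omega>. a \<in> A \<Longrightarrow> \<omega> \<in> space M \<Longrightarrow> \<bar>Z a \<omega>\<bar> \<le> c"
    and orth: "\<And>a b. a \<in> A \<Longrightarrow> b \<in> A \<Longrightarrow> a \<noteq> b \<Longrightarrow> expectation (\<lambda>\<omega>. Z a \<omega> * Z b \<omega>) = 0"
  shows "expectation (\<lambda>\<omega>. (\<Sum>a\<in>A. Z a \<omega>)\<^sup>2) \<le> card A * c\<^sup>2"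
proof -
  have "expectation (\<lambda>\<omega>. (Z a \<omega>)\<^sup>2) \<le> c\<^sup>2" if "a \<in> A" for a
    using bd[OF that] that by (intro expectation_le_bound) (auto intro: power2_le_iff_abs_le[THEN iffD2] simp: abs_le_square_iff[symmetric] order_trans[OF _ abs_ge_self])
  then show ?thesis
    using sum_bounded_above[of A "\<lambda>a. expectation (\<lambda>\<omega>. (Z a \<omega>)\<^sup>2)" "c\<^sup>2"]
      expectation_square_sum_orthogonal[of A Z c] assms by simp
qed

lemma indep_var_rest:
  assumes "indep_vars N Y I" "i \<in> I" "g \<in> measurable (PiM (I - {i}) N) L"
  shows "indep_var (N i) (Y i) L (\<lambda>\<omega>. g (restrict (\<lambda>j. Y j \<omega>) (I - {i})))"
proof -
  have "indep_var (PiM {i} N) (\<lambda>\<omega>. restrict (\<lambda>j. Y j \<omega>) {i})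
      (PiM (I - {i}) N) (\<lambda>\<omega>. restrict (\<lambda>j. Y j \<omega>) (I - {i}))"
    using assms by (intro indep_var_restrict) auto
  from indep_var_compose[OF this, of "\<lambda>y. y i" "N i" g L] show ?thesis
    using assms(3) by (auto simp: comp_def)
qed

lemma expectation_mult_indep:
  fixes f :: "'b \<Rightarrow> real" and g :: "'b \<Rightarrow> real"
  assumes ind: "indep_var S X T Y" and [measurable]: "f \<in> borel_measurable S" "g \<in> borel_measurable T"
    and "integrable M (\<lambda>\<omega>. f (X \<omega>))" "integrable M (\<lambda>\<omega>. g (Y \<omega>))"
  shows "expectation (\<lambda>\<omega>. f (X \<omega>) * g (Y \<omega>)) = expectation (\<lambda>\<omega>. f (X \<omega>)) * expectation (\<lambda>\<omega>. g (Y \<omega>))"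
  using indep_var_compose[OF ind, of f borel g borel] assms
  by (intro indep_var_lebesgue_integral) (auto simp: comp_def)

text \<open>The Cauchy--Schwarz inequality for prescribed bounds on the second moments, from the weighted
inequality \<open>2 |x y| \<le> (b/a) x\<^sup>2 + (a/b) y\<^sup>2\<close>.\<close>
lemma expectation_abs_mult_le:
  fixes X Y :: "'a \<Rightarrow> real"
  assumes [measurable]: "X \<in> borel_measurable M" "Y \<in> borel_measurable M"
    and "integrable M (\<lambda>\<omega>. (X \<omega>)\<^sup>2)" "integrable M (\<lambda>\<omega>. (Y \<omega>)\<^sup>2)"
    and X: "expectation (\<lambda>\<omega>. (X \<omega>)\<^sup>2) \<le> a\<^sup>2" and Y: "expectation (\<lambda>\<omega>. (Y \<omega>)\<^sup>2) \<le> b\<^sup>2"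
    and pos: "a > 0" "b > 0"
  shows "expectation (\<lambda>\<omega>. \<bar>X \<omega> * Y \<omega>\<bar>) \<le> a * b"
proof -
  have pw: "\<bar>X \<omega> * Y \<omega>\<bar> \<le> (b / a * (X \<omega>)\<^sup>2 + a / b * (Y \<omega>)\<^sup>2) / 2" for \<omega>
  proof -
    have "0 \<le> (b * \<bar>X \<omega>\<bar> - a * \<bar>Y \<omega>\<bar>)\<^sup>2 / (a * b)" using pos by simp
    also have "\<dots> = b / a * (X \<omega>)\<^sup>2 + a / b * (Y \<omega>)\<^sup>2 - 2 * \<bar>X \<omega> * Y \<omega>\<bar>"
      using pos by (simp add: power2_diff abs_mult field_simps power2_eq_square)
    finally show ?thesis by simp
  qed
  have int: "integrable M (\<lambda>\<omega>. (b / a * (X \<omega>)\<^sup>2 + a / b * (Y \<omega>)\<^sup>2) / 2)"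
    using assms by auto
  have "expectation (\<lambda>\<omega>. \<bar>X \<omega> * Y \<omega>\<bar>) \<le> expectation (\<lambda>\<omega>. (b / a * (X \<omega>)\<^sup>2 + a / b * (Y \<omega>)\<^sup>2) / 2)"
  proof (rule integral_mono[OF _ int pw])
    show "integrable M (\<lambda>\<omega>. \<bar>X \<omega> * Y \<omega>\<bar>)"
      by (rule Bochner_Integration.integrable_bound[OF int], simp)
        (simp only: real_norm_def abs_idempotent order_trans[OF pw abs_ge_self] AE_I2)
  qed
  also have "\<dots> = (b / a * expectation (\<lambda>\<omega>. (X \<omega>)\<^sup>2) + a / b * expectation (\<lambda>\<omega>. (Y \<omega>)\<^sup>2)) / 2"
    using assms by simp
  also have "\<dots> \<le> (b / a * a\<^sup>2 + a / b * b\<^sup>2) / 2"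
    using X Y pos by (intro divide_right_mono add_mono mult_left_mono) auto
  also have "\<dots> = a * b" using pos by (simp add: power2_eq_square)
  finally show ?thesis .
qed

end

text \<open>Independent centred summands bounded by \<open>\<beta>\<close> whose sum has variance one; \<open>\<beta>\<close> is the scale of all
error terms, of order \<open>1/\<surd>n\<close> in the application.\<close>
locale bounded_summands = prob_space M for M :: "'a measure" +
  fixes I :: "'i set" and \<eta> :: "'i \<Rightarrow> 'a \<Rightarrow> real" and \<beta> :: real
  assumes finite_I: "finite I"
    and indep: "indep_vars (\<lambda>_. borel) \<eta> I"
    and bounded: "\<And>i \<omega>. i \<in> I \<Longrightarrow> \<omega> \<in> space M \<Longrightarrow> \<bar>\<eta> i \<omega>\<bar> \<le> \<beta>"
    and mean: "\<And>i. i \<in> I \<Longrightarrow> expectation (\<eta> i) = 0"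
    and variances: "(\<Sum>i\<in>I. expectation (\<lambda>\<omega>. (\<eta> i \<omega>)\<^sup>2)) = 1"
begin

definition W :: "'a \<Rightarrow> real" where "W \<omega> = (\<Sum>i\<in>I. \<eta> i \<omega>)"

lemma rv_\<eta> [measurable]: "i \<in> I \<Longrightarrow> \<eta> i \<in> borel_measurable M"
  using indep by (auto simp: indep_vars_def)

lemma rv_W [measurable]: "W \<in> borel_measurable M"
  unfolding W_def[abs_def] by measurable

lemma \<beta>_nonneg: "\<beta> \<ge> 0"
proof -
  have "I \<noteq> {}" using variances by auto
  then show ?thesis using not_empty bounded abs_ge_zero order_trans by (metis all_not_in_conv)
qed

lemma W_bounded: "\<omega> \<in> space M \<Longrightarrow> \<bar>W \<omega>\<bar> \<le> card I * \<beta>"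
  unfolding W_def using bounded
  by (intro order_trans[OF sum_abs] sum_bounded_above[THEN order_trans]) auto

lemma integrable_\<eta>: "i \<in> I \<Longrightarrow> integrable M (\<eta> i)"
  by (rule integrable_bounded[of _ \<beta>]) (auto simp: bounded)

lemma \<eta>_square_le: "i \<in> I \<Longrightarrow> \<omega> \<in> space M \<Longrightarrow> (\<eta> i \<omega>)\<^sup>2 \<le> \<beta>\<^sup>2"
  using bounded[of i \<omega>] \<beta>_nonneg by (simp add: abs_le_square_iff[symmetric])

lemma integrable_\<eta>_square: "i \<in> I \<Longrightarrow> integrable M (\<lambda>\<omega>. (\<eta> i \<omega>)\<^sup>2)"
  by (rule integrable_bounded[of _ "\<beta>\<^sup>2"]) (auto simp: \<eta>_square_le)

lemma indep_pair: "i \<in> I \<Longrightarrow> j \<in> I \<Longrightarrow> i \<noteq> j \<Longrightarrow> indep_var borel (\<eta> i) borel (\<eta> j)"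
  using indep_var_rest[OF indep, of i "\<lambda>y. y j" borel] by auto

lemma indep_leave_one_out:
  assumes "i \<in> I" shows "indep_var borel (\<eta> i) borel (\<lambda>\<omega>. W \<omega> - \<eta> i \<omega>)"
proof -
  have "W \<omega> - \<eta> i \<omega> = (\<Sum>j\<in>I-{i}. restrict (\<lambda>j. \<eta> j \<omega>) (I - {i}) j)" for \<omega>
    using assms finite_I by (simp add: W_def sum_diff1)
  then show ?thesis
    using indep_var_rest[OF indep assms, of "\<lambda>y. \<Sum>j\<in>I-{i}. y j" borel] by simp
qed

lemma expectation_W_square: "expectation (\<lambda>\<omega>. (W \<omega>)\<^sup>2) = 1"
proof -
  have "expectation (\<lambda>\<omega>. (W \<omega>)\<^sup>2) = (\<Sum>i\<in>I. expectation (\<lambda>\<omega>. (\<eta> i \<omega>)\<^sup>2))"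
    unfolding W_def
  proof (rule expectation_square_sum_orthogonal[OF finite_I, of _ \<beta>])
    fix i j assume "i \<in> I" "j \<in> I" "i \<noteq> j"
    then show "expectation (\<lambda>\<omega>. \<eta> i \<omega> * \<eta> j \<omega>) = 0"
      using expectation_mult_indep[OF indep_pair, of i j "\<lambda>x. x" "\<lambda>x. x"]
      by (simp add: integrable_\<eta> mean)
  qed (auto simp: bounded)
  then show ?thesis using variances by simp
qed

lemma integrable_W_square: "integrable M (\<lambda>\<omega>. (W \<omega>)\<^sup>2)"
  by (rule square_integrable_bounded[OF rv_W W_bounded])

lemma integrable_W: "integrable M W"
  by (rule integrable_bounded[of _ "card I * \<beta>"]) (auto simp: W_bounded)

lemma expectation_abs_W: "expectation (\<lambda>\<omega>. \<bar>W \<omega>\<bar>) \<le> 1"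
proof -
  have "expectation (\<lambda>\<omega>. \<bar>W \<omega>\<bar>) \<le> expectation (\<lambda>\<omega>. (1 + (W \<omega>)\<^sup>2) / 2)"
  proof (intro integral_mono)
    fix \<omega>
    have "0 \<le> (\<bar>W \<omega>\<bar> - 1)\<^sup>2" by simp
    then show "\<bar>W \<omega>\<bar> \<le> (1 + (W \<omega>)\<^sup>2) / 2" by (simp add: power2_diff)
  qed (use integrable_W integrable_W_square in auto)
  also have "\<dots> = 1"
    using integrable_W_square expectation_W_square by (simp add: prob_space)
  finally show ?thesis .
qed

text \<open>Replaces \<open>\<Sum> \<eta>\<^sub>i\<^sup>2\<close> by its mean: the centred squares are orthogonal, and the variance of each is at most
\<open>E \<eta>\<^sub>i\<^sup>4 \<le> \<beta>\<^sup>2 E \<eta>\<^sub>i\<^sup>2\<close>.\<close>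
lemma square_sum_concentration:
  "expectation (\<lambda>\<omega>. ((\<Sum>i\<in>I. (\<eta> i \<omega>)\<^sup>2) - 1)\<^sup>2) \<le> \<beta>\<^sup>2"
proof -
  let ?v = "\<lambda>i. expectation (\<lambda>\<omega>. (\<eta> i \<omega>)\<^sup>2)"
  let ?Z = "\<lambda>i \<omega>. (\<eta> i \<omega>)\<^sup>2 - ?v i"
  have v: "0 \<le> ?v i" "?v i \<le> \<beta>\<^sup>2" if "i \<in> I" for i
    using that by (auto intro!: expectation_le_bound simp: \<eta>_square_le)
  have "expectation (\<lambda>\<omega>. (\<Sum>i\<in>I. ?Z i \<omega>)\<^sup>2) = (\<Sum>i\<in>I. expectation (\<lambda>\<omega>. (?Z i \<omega>)\<^sup>2))"
  proof (rule expectation_square_sum_orthogonal[OF finite_I, of _ "\<beta>\<^sup>2"])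
    fix i j assume ij: "i \<in> I" "j \<in> I" "i \<noteq> j"
    then have "expectation (\<lambda>\<omega>. ?Z i \<omega> * ?Z j \<omega>) = expectation (?Z i) * expectation (?Z j)"
      using expectation_mult_indep[OF indep_pair[OF ij], of "\<lambda>x. x\<^sup>2 - ?v i" "\<lambda>x. x\<^sup>2 - ?v j"]
        integrable_\<eta>_square by simp
    also have "\<dots> = 0" using ij integrable_\<eta>_square by (simp add: prob_space)
    finally show "expectation (\<lambda>\<omega>. ?Z i \<omega> * ?Z j \<omega>) = 0" .
  next
    fix i \<omega> assume "i \<in> I" "\<omega> \<in> space M"
    then show "\<bar>?Z i \<omega>\<bar> \<le> \<beta>\<^sup>2"
      using v[of i] \<eta>_square_le[of i \<omega>] zero_le_power2[of "\<eta> i \<omega>"] by linarith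
  qed simp
  also have "\<dots> \<le> (\<Sum>i\<in>I. \<beta>\<^sup>2 * ?v i)"
  proof (rule sum_mono)
    fix i assume i: "i \<in> I"
    have int4: "integrable M (\<lambda>\<omega>. ((\<eta> i \<omega>)\<^sup>2)\<^sup>2)"
      by (rule integrable_bounded[of _ "(\<beta>\<^sup>2)\<^sup>2"])
        (use i in \<open>simp_all only: abs_power2 power_mono[OF \<eta>_square_le zero_le_power2], measurable\<close>)
    have "expectation (\<lambda>\<omega>. (?Z i \<omega>)\<^sup>2) = expectation (\<lambda>\<omega>. ((\<eta> i \<omega>)\<^sup>2)\<^sup>2) - (?v i)\<^sup>2"
      by (rule variance_eq[of "\<lambda>\<omega>. (\<eta> i \<omega>)\<^sup>2"]) (use i int4 integrable_\<eta>_square in auto)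
    also have "\<dots> \<le> expectation (\<lambda>\<omega>. ((\<eta> i \<omega>)\<^sup>2)\<^sup>2)" by simp
    also have "\<dots> \<le> expectation (\<lambda>\<omega>. \<beta>\<^sup>2 * (\<eta> i \<omega>)\<^sup>2)"
    proof (rule integral_mono[OF int4])
      fix \<omega> assume "\<omega> \<in> space M"
      then show "((\<eta> i \<omega>)\<^sup>2)\<^sup>2 \<le> \<beta>\<^sup>2 * (\<eta> i \<omega>)\<^sup>2"
        using mult_right_mono[OF \<eta>_square_le[OF i], of \<omega> "(\<eta> i \<omega>)\<^sup>2"] by (simp add: power2_eq_square)
    qed (use i integrable_\<eta>_square in simp)
    finally show "expectation (\<lambda>\<omega>. (?Z i \<omega>)\<^sup>2) \<le> \<beta>\<^sup>2 * ?v i" by simp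
  qed
  also have "\<dots> = \<beta>\<^sup>2" by (simp add: variances flip: sum_distrib_left)
  finally show ?thesis by (simp add: sum_subtractf variances)
qed

end

text \<open>The test function of the concentration inequality: it has slope one on the window
\<open>[z - a, z]\<close> enlarged by \<open>\<beta>\<close> on both sides, is constant elsewhere, and is centred so that its absolute value stays
below \<open>a / 2 + \<beta>\<close>.\<close>
definition ramp :: "real \<Rightarrow> real \<Rightarrow> real \<Rightarrow> real \<Rightarrow> real" where
  "ramp \<beta> z a w = max (- (a / 2 + \<beta>)) (min (a / 2 + \<beta>) (w - z + a / 2))"

lemma borel_measurable_ramp [measurable (raw)]:
  assumes [measurable]: "f \<in> borel_measurable N" "g \<in> borel_measurable N"
  shows "(\<lambda>x. ramp \<beta> z (f x) (g x)) \<in> borel_measurable N"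
  unfolding ramp_def by measurable

lemma ramp_bound: "0 \<le> a \<Longrightarrow> 0 \<le> \<beta> \<Longrightarrow> \<bar>ramp \<beta> z a w\<bar> \<le> a / 2 + \<beta>"
  by (auto simp: ramp_def)

lemma ramp_lipschitz_width: "\<bar>ramp \<beta> z a w - ramp \<beta> z b w\<bar> \<le> \<bar>a - b\<bar> / 2"
proof -
  have max: "\<bar>max x y - max x' y'\<bar> \<le> e" and min: "\<bar>min x y - min x' y'\<bar> \<le> e"
    if "\<bar>x - x'\<bar> \<le> e" "\<bar>y - y'\<bar> \<le> e" for x y x' y' e :: real
    using that by (auto simp: max_def min_def)
  show ?thesis unfolding ramp_def by (intro max min) (auto simp: abs_if field_simps)
qed

text \<open>For \<open>w\<close> in the window both \<open>w\<close> and \<open>w - t\<close> lie where the slope is one; for other \<open>w\<close> monotonicity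
still gives a nonnegative right-hand side.\<close>
lemma ramp_increment:
  assumes "\<bar>t\<bar> \<le> \<beta>"
  shows "of_bool (z - a \<le> w \<and> w \<le> z) * t\<^sup>2 \<le> t * (ramp \<beta> z a w - ramp \<beta> z a (w - t))"
proof (cases "z - a \<le> w \<and> w \<le> z")
  case True
  then have "ramp \<beta> z a w - ramp \<beta> z a (w - t) = t"
    using assms by (auto simp: ramp_def max_def min_def field_simps)
  then show ?thesis by (simp add: power2_eq_square)
next
  case False
  have mono: "ramp \<beta> z a x \<le> ramp \<beta> z a y" if "x \<le> y" for x y
    using that unfolding ramp_def by (intro max.mono min.mono) auto
  have "0 \<le> t * (ramp \<beta> z a w - ramp \<beta> z a (w - t))"
    using mono[of w "w - t"] mono[of "w - t" w] by (cases "t \<ge> 0") (auto simp: zero_le_mult_iff)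
  moreover have "of_bool (z - a \<le> w \<and> w \<le> z) = (0 :: real)" using False by (simp only: of_bool_eq)
  ultimately show ?thesis by (simp only: mult_zero_left)
qed

context bounded_summands begin

text \<open>The probability that \<open>W\<close> falls into the random window \<open>[z - |\<Delta>|, z]\<close>. Take the ramp \<open>r\<close> for the width
\<open>|\<Delta>|\<close>. On the one hand \<open>E (W r(W))\<close> is at most \<open>E |W \<Delta>| / 2 + \<beta>\<close>. On the other hand it is the sum of
the \<open>E (\<eta>\<^sub>i r(W))\<close>, and replacing \<open>W\<close> by \<open>W - \<eta>\<^sub>i\<close> and \<open>\<Delta>\<close> by \<open>\<Delta>'\<^sub>i\<close> turns each term into a mean that
vanishes by independence; the first replacement gains at least \<open>\<eta>\<^sub>i\<^sup>2\<close> on the window, the second costs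
\<open>|\<eta>\<^sub>i (\<Delta> - \<Delta>'\<^sub>i)| / 2\<close>. Hence \<open>E (\<Sum> \<eta>\<^sub>i\<^sup>2)\<close> restricted to the window is small, and the sum of squares is close
to one. Independence of \<open>\<eta>\<^sub>i\<close> from
the pair \<open>(W - \<eta>\<^sub>i, \<Delta>'\<^sub>i)\<close> is phrased through real functions \<open>h\<close> of the pair, since \<open>indep_var\<close> relates
variables of a common type.\<close>
lemma randomized_concentration:
  assumes [measurable]: "\<Delta> \<in> borel_measurable M"
    and ind: "\<And>i h. i \<in> I \<Longrightarrow> h \<in> borel_measurable (borel \<Otimes>\<^sub>M borel) \<Longrightarrow>
      indep_var borel (\<eta> i) borel (\<lambda>\<omega>. h (W \<omega> - \<eta> i \<omega>, \<Delta>' i \<omega>))"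
    and bd: "\<And>\<omega>. \<omega> \<in> space M \<Longrightarrow> \<bar>\<Delta> \<omega>\<bar> \<le> B"
    and bd': "\<And>i \<omega>. i \<in> I \<Longrightarrow> \<omega> \<in> space M \<Longrightarrow> \<bar>\<Delta>' i \<omega>\<bar> \<le> B"
  shows "prob {\<omega> \<in> space M. z - \<bar>\<Delta> \<omega>\<bar> \<le> W \<omega> \<and> W \<omega> \<le> z}
    \<le> expectation (\<lambda>\<omega>. \<bar>W \<omega> * \<Delta> \<omega>\<bar>) + (\<Sum>i\<in>I. expectation (\<lambda>\<omega>. \<bar>\<eta> i \<omega> * (\<Delta> \<omega> - \<Delta>' i \<omega>)\<bar>)) + 6 * \<beta>"
    (is "prob ?A \<le> ?e1 + ?e2 + _")
proof (cases "\<beta> \<ge> 1")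
  \<comment> \<open>For \<open>\<beta> \<ge> 1\<close> the bound exceeds one; otherwise \<open>\<beta>\<^sup>2 \<le> \<beta>\<close> absorbs the variance of the sum of squares.\<close>
  case True
  moreover have "0 \<le> ?e1" "0 \<le> ?e2" by (auto intro!: sum_nonneg)
  ultimately show ?thesis using prob_le_1[of ?A] by linarith
next
  case False
  define V where "V \<omega> = (\<Sum>i\<in>I. (\<eta> i \<omega>)\<^sup>2)" for \<omega>
  define a where "a \<omega> = \<bar>\<Delta> \<omega>\<bar>" for \<omega>
  define a' where "a' i \<omega> = \<bar>\<Delta>' i \<omega>\<bar>" for i \<omega>
  define D where "D i \<omega> = \<eta> i \<omega> * ramp \<beta> z (a' i \<omega>) (W \<omega> - \<eta> i \<omega>)" for i \<omega>
  have [measurable]: "V \<in> borel_measurable M" "a \<in> borel_measurable M"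
    unfolding V_def[abs_def] a_def[abs_def] by measurable
  have [measurable]: "\<Delta>' i \<in> borel_measurable M" if "i \<in> I" for i
    using indep_var_rv2[OF ind[OF that, of snd]] by simp
  have [measurable]: "a' i \<in> borel_measurable M" if "i \<in> I" for i
    unfolding a'_def[abs_def] using that by measurable
  have a_bd: "0 \<le> a \<omega>" "a \<omega> \<le> B" if "\<omega> \<in> space M" for \<omega>
    using bd[OF that] by (auto simp: a_def)
  have a'_bd: "0 \<le> a' i \<omega>" "a' i \<omega> \<le> B" if "i \<in> I" "\<omega> \<in> space M" for i \<omega>
    using bd'[OF that] by (auto simp: a'_def)
  have int_R: "integrable M (\<lambda>\<omega>. ramp \<beta> z (a' i \<omega>) (W \<omega> - \<eta> i \<omega>))" if "i \<in> I" for i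
    using that a'_bd[of i] ramp_bound[OF _ \<beta>_nonneg] \<beta>_nonneg
    by (intro integrable_bounded[of _ "B / 2 + \<beta>"]) (auto intro!: order_trans[OF ramp_bound[OF _ \<beta>_nonneg]])
  have D0: "expectation (D i) = 0" if i: "i \<in> I" for i
  proof -
    have "indep_var borel (\<eta> i) borel (\<lambda>\<omega>. ramp \<beta> z (a' i \<omega>) (W \<omega> - \<eta> i \<omega>))"
      using ind[OF i, of "\<lambda>(w, d). ramp \<beta> z \<bar>d\<bar> w"] by (simp add: a'_def case_prod_beta')
    then have "expectation (D i) = expectation (\<eta> i) *
        expectation (\<lambda>\<omega>. ramp \<beta> z (a' i \<omega>) (W \<omega> - \<eta> i \<omega>))"
      unfolding D_def[abs_def] by (rule indep_var_lebesgue_integral[OF _ integrable_\<eta>[OF i] int_R[OF i]])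
    then show ?thesis using mean[OF i] by simp
  qed
  have int_D: "integrable M (D i)" if "i \<in> I" for i
  proof (rule integrable_bounded[of _ "\<beta> * (B / 2 + \<beta>)"])
    fix \<omega> assume \<omega>: "\<omega> \<in> space M"
    show "\<bar>D i \<omega>\<bar> \<le> \<beta> * (B / 2 + \<beta>)"
      unfolding D_def abs_mult using that \<omega> a'_bd[OF that \<omega>] \<beta>_nonneg
      by (intro mult_mono bounded order_trans[OF ramp_bound[OF _ \<beta>_nonneg]]) auto
  qed (use that in \<open>auto simp: D_def[abs_def]\<close>)
  have int_diff: "integrable M (\<lambda>\<omega>. \<bar>\<eta> i \<omega> * (\<Delta> \<omega> - \<Delta>' i \<omega>)\<bar>)" if "i \<in> I" for i
  proof (rule integrable_bounded[of _ "\<beta> * (2 * B)"])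
    fix \<omega> assume \<omega>: "\<omega> \<in> space M"
    have "\<bar>\<Delta> \<omega> - \<Delta>' i \<omega>\<bar> \<le> 2 * B" using bd[OF \<omega>] bd'[OF that \<omega>] by linarith
    then show "\<bar>\<bar>\<eta> i \<omega> * (\<Delta> \<omega> - \<Delta>' i \<omega>)\<bar>\<bar> \<le> \<beta> * (2 * B)"
      unfolding abs_idempotent abs_mult using bounded[OF that \<omega>] \<beta>_nonneg by (intro mult_mono) auto
  qed (use that in auto)
  have pw: "\<eta> i \<omega> * ramp \<beta> z (a \<omega>) (W \<omega>) \<ge> indicator ?A \<omega> * (\<eta> i \<omega>)\<^sup>2
      - \<bar>\<eta> i \<omega> * (\<Delta> \<omega> - \<Delta>' i \<omega>)\<bar> / 2 + D i \<omega>" if i: "i \<in> I" and \<omega>: "\<omega> \<in> space M" for i \<omega>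
  proof -
    let ?w = "W \<omega> - \<eta> i \<omega>"
    have "indicator ?A \<omega> * (\<eta> i \<omega>)\<^sup>2 \<le> \<eta> i \<omega> * (ramp \<beta> z (a \<omega>) (W \<omega>) - ramp \<beta> z (a \<omega>) ?w)"
      using ramp_increment[OF bounded[OF i \<omega>], of z "a \<omega>" "W \<omega>"] \<omega>
      by (simp add: a_def indicator_def)
    moreover have "- (\<eta> i \<omega> * (ramp \<beta> z (a \<omega>) ?w - ramp \<beta> z (a' i \<omega>) ?w))
        \<le> \<bar>\<eta> i \<omega> * (\<Delta> \<omega> - \<Delta>' i \<omega>)\<bar> / 2"
    proof (rule abs_le_D2)
      have "\<bar>ramp \<beta> z (a \<omega>) ?w - ramp \<beta> z (a' i \<omega>) ?w\<bar> \<le> \<bar>\<Delta> \<omega> - \<Delta>' i \<omega>\<bar> / 2"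
        unfolding a_def a'_def
        by (rule order_trans[OF ramp_lipschitz_width divide_right_mono[OF abs_triangle_ineq3]]) simp
      from mult_left_mono[OF this abs_ge_zero[of "\<eta> i \<omega>"]]
      show "\<bar>\<eta> i \<omega> * (ramp \<beta> z (a \<omega>) ?w - ramp \<beta> z (a' i \<omega>) ?w)\<bar>
          \<le> \<bar>\<eta> i \<omega> * (\<Delta> \<omega> - \<Delta>' i \<omega>)\<bar> / 2"
        by (simp add: abs_mult)
    qed
    ultimately show ?thesis unfolding D_def right_diff_distrib by linarith
  qed
  have V_int: "integrable M V" "integrable M (\<lambda>\<omega>. (V \<omega> - 1)\<^sup>2)"
  proof -
    have V_bd: "\<bar>V \<omega>\<bar> \<le> card I * \<beta>\<^sup>2" if "\<omega> \<in> space M" for \<omega>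
      unfolding V_def using \<eta>_square_le[OF _ that]
      by (intro order_trans[OF sum_abs] sum_bounded_above[THEN order_trans]) auto
    then show "integrable M V" by (intro integrable_bounded) auto
    have "\<bar>(V \<omega> - 1)\<^sup>2\<bar> \<le> (card I * \<beta>\<^sup>2 + 1)\<^sup>2" if "\<omega> \<in> space M" for \<omega>
      unfolding abs_power2 using V_bd[OF that] by (intro power2_le_iff_abs_le[THEN iffD2]) auto
    then show "integrable M (\<lambda>\<omega>. (V \<omega> - 1)\<^sup>2)" by (intro integrable_bounded) auto
  qed
  have AV_int: "integrable M (\<lambda>\<omega>. indicator ?A \<omega> * V \<omega>)"
    using V_int(1) by (rule Bochner_Integration.integrable_bound) (auto simp: indicator_def)
  have Wr_int: "integrable M (\<lambda>\<omega>. W \<omega> * ramp \<beta> z (a \<omega>) (W \<omega>))"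
  proof (rule integrable_bounded[of _ "card I * \<beta> * (B / 2 + \<beta>)"])
    fix \<omega> assume \<omega>: "\<omega> \<in> space M"
    show "\<bar>W \<omega> * ramp \<beta> z (a \<omega>) (W \<omega>)\<bar> \<le> card I * \<beta> * (B / 2 + \<beta>)"
      unfolding abs_mult using \<omega> a_bd[OF \<omega>] \<beta>_nonneg
      by (intro mult_mono W_bounded order_trans[OF ramp_bound[OF _ \<beta>_nonneg]]) auto
  qed simp
  have WD_int: "integrable M (\<lambda>\<omega>. \<bar>W \<omega> * \<Delta> \<omega>\<bar>)"
  proof (rule integrable_bounded[of _ "card I * \<beta> * B"])
    fix \<omega> assume \<omega>: "\<omega> \<in> space M"
    show "\<bar>\<bar>W \<omega> * \<Delta> \<omega>\<bar>\<bar> \<le> card I * \<beta> * B"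
      unfolding abs_idempotent abs_mult using \<omega> bd[OF \<omega>] \<beta>_nonneg by (intro mult_mono W_bounded) auto
  qed simp
  have "expectation (\<lambda>\<omega>. indicator ?A \<omega> * V \<omega>) - ?e2 / 2
      = expectation (\<lambda>\<omega>. indicator ?A \<omega> * V \<omega> - (\<Sum>i\<in>I. \<bar>\<eta> i \<omega> * (\<Delta> \<omega> - \<Delta>' i \<omega>)\<bar>) / 2 + (\<Sum>i\<in>I. D i \<omega>))"
    using AV_int int_D int_diff by (simp add: D0)
  also have "\<dots> \<le> expectation (\<lambda>\<omega>. W \<omega> * ramp \<beta> z (a \<omega>) (W \<omega>))"
  proof (rule integral_mono[OF _ Wr_int])
    fix \<omega> assume "\<omega> \<in> space M"
    from sum_mono[of I, OF pw, OF _ this]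
    show "indicator ?A \<omega> * V \<omega> - (\<Sum>i\<in>I. \<bar>\<eta> i \<omega> * (\<Delta> \<omega> - \<Delta>' i \<omega>)\<bar>) / 2 + (\<Sum>i\<in>I. D i \<omega>)
        \<le> W \<omega> * ramp \<beta> z (a \<omega>) (W \<omega>)"
      by (simp add: V_def W_def sum.distrib sum_subtractf sum_divide_distrib sum_distrib_left sum_distrib_right)
  qed (use AV_int int_D int_diff in auto)
  also have "\<dots> \<le> expectation (\<lambda>\<omega>. \<bar>W \<omega> * \<Delta> \<omega>\<bar> / 2 + \<beta> * \<bar>W \<omega>\<bar>)"
  proof (rule integral_mono[OF Wr_int])
    fix \<omega> assume \<omega>: "\<omega> \<in> space M"
    have "W \<omega> * ramp \<beta> z (a \<omega>) (W \<omega>) \<le> \<bar>W \<omega>\<bar> * \<bar>ramp \<beta> z (a \<omega>) (W \<omega>)\<bar>"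
      by (metis abs_ge_self abs_mult)
    also have "\<dots> \<le> \<bar>W \<omega>\<bar> * (a \<omega> / 2 + \<beta>)"
      using a_bd[OF \<omega>] \<beta>_nonneg by (intro mult_left_mono ramp_bound) auto
    finally show "W \<omega> * ramp \<beta> z (a \<omega>) (W \<omega>) \<le> \<bar>W \<omega> * \<Delta> \<omega>\<bar> / 2 + \<beta> * \<bar>W \<omega>\<bar>"
      by (simp add: a_def abs_mult algebra_simps)
  qed (use WD_int integrable_W in auto)
  also have "\<dots> = ?e1 / 2 + \<beta> * expectation (\<lambda>\<omega>. \<bar>W \<omega>\<bar>)"
    using WD_int integrable_W by simp
  also have "\<dots> \<le> ?e1 / 2 + \<beta> * 1"
    using \<beta>_nonneg expectation_abs_W by (intro add_left_mono mult_left_mono) auto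
  finally have AV: "expectation (\<lambda>\<omega>. indicator ?A \<omega> * V \<omega>) \<le> ?e1 / 2 + ?e2 / 2 + \<beta>" by simp
  have "prob ?A = expectation (indicator ?A)" by simp
  also have "\<dots> \<le> expectation (\<lambda>\<omega>. 2 * (indicator ?A \<omega> * V \<omega>) + 4 * (V \<omega> - 1)\<^sup>2)"
  proof (rule integral_mono)
    fix \<omega>
    have "V \<omega> \<ge> 0" by (auto simp: V_def intro: sum_nonneg)
    \<comment> \<open>The difference of the two sides is \<open>(4 V - 3)\<^sup>2 / 4 + 3 / 4\<close>; it avoids a case split at \<open>V = 1 / 2\<close>.\<close>
    have "1 \<le> 2 * V \<omega> + 4 * (V \<omega> - 1)\<^sup>2"
      using zero_le_power2[of "4 * V \<omega> - 3"] by (simp add: power2_eq_square algebra_simps)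
    then show "indicator ?A \<omega> \<le> 2 * (indicator ?A \<omega> * V \<omega>) + 4 * (V \<omega> - 1)\<^sup>2"
      using \<open>V \<omega> \<ge> 0\<close> by (auto simp: indicator_def)
  next
    show "integrable M (indicator ?A :: 'a \<Rightarrow> real)"
      by (rule integrable_indicator_event) measurable
  qed (use AV_int V_int in auto)
  also have "\<dots> = 2 * expectation (\<lambda>\<omega>. indicator ?A \<omega> * V \<omega>) + 4 * expectation (\<lambda>\<omega>. (V \<omega> - 1)\<^sup>2)"
    using AV_int V_int by simp
  also have "\<dots> \<le> 2 * (?e1 / 2 + ?e2 / 2 + \<beta>) + 4 * \<beta>\<^sup>2"
    using AV square_sum_concentration unfolding V_def by (intro add_mono mult_left_mono) auto
  also have "\<beta>\<^sup>2 \<le> \<beta>"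
    using False \<beta>_nonneg by (simp add: power2_eq_square mult_left_le)
  finally show ?thesis by (simp add: algebra_simps)
qed

end

section \<open>Berry--Esseen bounds for linear and nonlinear statistics\<close>

context bounded_summands begin

text \<open>A deterministic window: in the concentration inequality both \<open>\<Delta>\<close> and the \<open>\<Delta>'\<^sub>i\<close> are the constant \<open>2 r\<close>.\<close>
lemma window_bound:
  assumes "r \<ge> 0"
  shows "prob {\<omega> \<in> space M. \<bar>W \<omega> - z\<bar> \<le> r} \<le> 2 * r + 6 * \<beta>"
proof -
  have ind: "indep_var borel (\<eta> i) borel (\<lambda>\<omega>. h (W \<omega> - \<eta> i \<omega>, 2 * r))"
    if "i \<in> I" and [measurable]: "h \<in> borel_measurable (borel \<Otimes>\<^sub>M borel)" for i and h :: "real \<times> real \<Rightarrow> real"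
    using indep_var_compose[OF indep_leave_one_out[OF \<open>i \<in> I\<close>], of "\<lambda>x. x" borel "\<lambda>w. h (w, 2 * r)" borel]
    by (simp add: comp_def)
  have "prob {\<omega> \<in> space M. \<bar>W \<omega> - z\<bar> \<le> r}
      = prob {\<omega> \<in> space M. (z + r) - \<bar>2 * r\<bar> \<le> W \<omega> \<and> W \<omega> \<le> z + r}"
    using assms by (intro arg_cong[where f = prob]) auto
  also have "\<dots> \<le> expectation (\<lambda>\<omega>. \<bar>W \<omega> * (2 * r)\<bar>) + 6 * \<beta>"
    using randomized_concentration[of "\<lambda>_. 2 * r" "\<lambda>_ _. 2 * r" "2 * r" "z + r"] ind assms by simp
  also have "expectation (\<lambda>\<omega>. \<bar>W \<omega> * (2 * r)\<bar>) = expectation (\<lambda>\<omega>. \<bar>W \<omega>\<bar>) * (2 * r)"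
    using assms by (simp add: abs_mult)
  also have "\<dots> \<le> 1 * (2 * r)"
    using assms expectation_abs_W by (intro mult_right_mono) auto
  finally show ?thesis by simp
qed

text \<open>Stein's method. By Stein's equation the left-hand side is \<open>E f'(W) - E (W f(W))\<close> for the solution \<open>f\<close>.
With \<open>L\<^sub>i = W - \<eta>\<^sub>i\<close>, independent of \<open>\<eta>\<^sub>i\<close>, expanding \<open>f(L\<^sub>i + \<eta>\<^sub>i)\<close> to first order gives
\<open>E (\<eta>\<^sub>i f(W)) = E \<eta>\<^sub>i\<^sup>2 E f'(L\<^sub>i)\<close> up to an error \<open>O(\<beta> E \<eta>\<^sub>i\<^sup>2)\<close>, and \<open>E f'(L\<^sub>i)\<close> differs from \<open>E f'(W)\<close> by
\<open>O(\<beta>)\<close>. Both errors contain the probability that \<open>L\<^sub>i\<close> is within \<open>\<beta>\<close> of the jump at \<open>z\<close>, which the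
window bound controls.\<close>
lemma berry_esseen: "\<bar>prob {\<omega> \<in> space M. W \<omega> \<le> z} - \<Phi> z\<bar> \<le> 68 * \<beta>"
proof (cases "\<beta> \<ge> 1")
  case True
  then show ?thesis
    using std_normal.cdf_nonneg[of z] std_normal.cdf_bounded_prob[of z]
      prob_le_1[of "{\<omega> \<in> space M. W \<omega> \<le> z}"] measure_nonneg[of M "{\<omega> \<in> space M. W \<omega> \<le> z}"] by linarith
next
  case False
  define v where "v i = expectation (\<lambda>\<omega>. (\<eta> i \<omega>)\<^sup>2)" for i
  define L where "L i \<omega> = W \<omega> - \<eta> i \<omega>" for i \<omega>
  define h where "h w = \<beta> * (2 * \<bar>w\<bar> + 5) + 4 * of_bool (\<bar>w - z\<bar> \<le> \<beta>)" for w
  have [measurable]: "h \<in> borel_measurable borel" unfolding h_def[abs_def] by measurable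
  have [measurable]: "L i \<in> borel_measurable M" if "i \<in> I" for i
    unfolding L_def[abs_def] using that by measurable
  have W_eq: "W \<omega> = L i \<omega> + \<eta> i \<omega>" for i \<omega> by (simp add: L_def)
  have L_bd: "\<bar>L i \<omega>\<bar> \<le> card I * \<beta> + \<beta>" if "i \<in> I" "\<omega> \<in> space M" for i \<omega>
    using W_bounded[OF that(2)] bounded[OF that] by (simp add: L_def)
  have int_L: "integrable M (\<lambda>\<omega>. \<bar>L i \<omega>\<bar>)" if "i \<in> I" for i
    using that L_bd by (intro integrable_bounded[of _ "card I * \<beta> + \<beta>"]) auto
  have int_of_bool: "integrable M (\<lambda>\<omega>. of_bool (\<bar>L i \<omega> - z\<bar> \<le> \<beta>) :: real)" if "i \<in> I" for i
    using that by (intro integrable_bounded[of _ 1]) auto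
  have int_h: "integrable M (\<lambda>\<omega>. h (L i \<omega>))" if "i \<in> I" for i
    using int_L[OF that] int_of_bool[OF that] unfolding h_def by auto
  have v_nonneg: "v i \<ge> 0" for i by (simp add: v_def)
  have factor: "integrable M (\<lambda>\<omega>. (\<eta> i \<omega>)\<^sup>2 * g (L i \<omega>))"
      "expectation (\<lambda>\<omega>. (\<eta> i \<omega>)\<^sup>2 * g (L i \<omega>)) = v i * expectation (\<lambda>\<omega>. g (L i \<omega>))"
    if i: "i \<in> I" and [measurable]: "g \<in> borel_measurable borel" and int: "integrable M (\<lambda>\<omega>. g (L i \<omega>))"
    for i and g :: "real \<Rightarrow> real"
  proof -
    have "indep_var borel (\<lambda>\<omega>. (\<eta> i \<omega>)\<^sup>2) borel (\<lambda>\<omega>. g (L i \<omega>))"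
      using indep_var_compose[OF indep_leave_one_out[OF i], of "\<lambda>x. x\<^sup>2" borel g borel]
      by (simp add: comp_def L_def)
    from indep_var_integrable[OF this] indep_var_lebesgue_integral[OF this]
    show "integrable M (\<lambda>\<omega>. (\<eta> i \<omega>)\<^sup>2 * g (L i \<omega>))"
      "expectation (\<lambda>\<omega>. (\<eta> i \<omega>)\<^sup>2 * g (L i \<omega>)) = v i * expectation (\<lambda>\<omega>. g (L i \<omega>))"
      using int integrable_\<eta>_square[OF i] by (auto simp: v_def)
  qed
  have int_stein_L: "integrable M (\<lambda>\<omega>. stein z (L i \<omega>))" if "i \<in> I" for i
    using that by (intro integrable_bounded[of _ 5]) (auto simp: stein_bound)
  have int_deriv_L: "integrable M (\<lambda>\<omega>. stein_deriv z (L i \<omega>))" if "i \<in> I" for i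
    using that by (intro integrable_bounded[of _ 2]) (auto simp: stein_deriv_bound)
  have int_deriv_W: "integrable M (\<lambda>\<omega>. stein_deriv z (W \<omega>))"
    by (intro integrable_bounded[of _ 2]) (auto simp: stein_deriv_bound)
  have prod0: "expectation (\<lambda>\<omega>. \<eta> i \<omega> * stein z (L i \<omega>)) = 0" 
    "integrable M (\<lambda>\<omega>. \<eta> i \<omega> * stein z (L i \<omega>))" if i: "i \<in> I" for i
  proof -
    have "indep_var borel (\<eta> i) borel (\<lambda>\<omega>. stein z (L i \<omega>))"
      using indep_var_compose[OF indep_leave_one_out[OF i], of "\<lambda>x. x" borel "stein z" borel]
      by (simp add: comp_def L_def)
    from indep_var_integrable[OF this] indep_var_lebesgue_integral[OF this]
    show "expectation (\<lambda>\<omega>. \<eta> i \<omega> * stein z (L i \<omega>)) = 0"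
      "integrable M (\<lambda>\<omega>. \<eta> i \<omega> * stein z (L i \<omega>))"
      using int_stein_L[OF i] integrable_\<eta>[OF i] mean[OF i] by auto
  qed
  have int_prod: "integrable M (\<lambda>\<omega>. \<eta> i \<omega> * stein z (W \<omega>))" if i: "i \<in> I" for i
  proof (rule integrable_bounded[of _ "\<beta> * 5"])
    fix \<omega> assume "\<omega> \<in> space M"
    then show "\<bar>\<eta> i \<omega> * stein z (W \<omega>)\<bar> \<le> \<beta> * 5"
      unfolding abs_mult using bounded[OF i] stein_bound \<beta>_nonneg by (intro mult_mono) auto
  qed (use i in simp)
  have E_of_bool: "expectation (\<lambda>\<omega>. of_bool (\<bar>L i \<omega> - z\<bar> \<le> \<beta>) :: real) \<le> 10 * \<beta>" if i: "i \<in> I" for i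
  proof -
    have "expectation (\<lambda>\<omega>. of_bool (\<bar>L i \<omega> - z\<bar> \<le> \<beta>) :: real)
        \<le> expectation (indicator {\<omega> \<in> space M. \<bar>W \<omega> - z\<bar> \<le> 2 * \<beta>})"
    proof (rule integral_mono[OF int_of_bool[OF i]])
      fix \<omega> assume \<omega>: "\<omega> \<in> space M"
      show "(of_bool (\<bar>L i \<omega> - z\<bar> \<le> \<beta>) :: real) \<le> indicator {\<omega> \<in> space M. \<bar>W \<omega> - z\<bar> \<le> 2 * \<beta>} \<omega>"
        using bounded[OF i \<omega>] \<omega> by (auto simp: indicator_def L_def)
    qed (rule integrable_indicator_event, measurable)
    also have "\<dots> = prob {\<omega> \<in> space M. \<bar>W \<omega> - z\<bar> \<le> 2 * \<beta>}" by simp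
    also have "\<dots> \<le> 2 * (2 * \<beta>) + 6 * \<beta>" using \<beta>_nonneg by (intro window_bound) auto
    finally show ?thesis by simp
  qed
  have E_abs_L: "expectation (\<lambda>\<omega>. \<bar>L i \<omega>\<bar>) \<le> 2" if i: "i \<in> I" for i
  proof -
    have "expectation (\<lambda>\<omega>. \<bar>L i \<omega>\<bar>) \<le> expectation (\<lambda>\<omega>. \<bar>W \<omega>\<bar> + 1)"
    proof (rule integral_mono[OF int_L[OF i]])
      fix \<omega> assume "\<omega> \<in> space M"
      then show "\<bar>L i \<omega>\<bar> \<le> \<bar>W \<omega>\<bar> + 1" using bounded[OF i, of \<omega>] False by (auto simp: L_def)
    qed (use integrable_W in simp)
    also have "\<dots> = expectation (\<lambda>\<omega>. \<bar>W \<omega>\<bar>) + 1" using integrable_W by (simp add: prob_space)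
    finally show ?thesis using expectation_abs_W by simp
  qed
  have E_lin: "expectation (\<lambda>\<omega>. \<beta> * (2 * \<bar>L i \<omega>\<bar> + 5)) \<le> 9 * \<beta>" if i: "i \<in> I" for i
    using int_L[OF i] mult_left_mono[OF E_abs_L[OF i] \<beta>_nonneg] by (simp add: prob_space algebra_simps)
  have int_lin: "integrable M (\<lambda>\<omega>. \<beta> * (2 * \<bar>L i \<omega>\<bar> + 5))" if i: "i \<in> I" for i
    using int_L[OF i] by simp
  have E_h: "expectation (\<lambda>\<omega>. h (L i \<omega>)) \<le> 49 * \<beta>" if i: "i \<in> I" for i
  proof -
    have "expectation (\<lambda>\<omega>. h (L i \<omega>)) = expectation (\<lambda>\<omega>. \<beta> * (2 * \<bar>L i \<omega>\<bar> + 5))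
        + expectation (\<lambda>\<omega>. 4 * of_bool (\<bar>L i \<omega> - z\<bar> \<le> \<beta>))"
      unfolding h_def using int_lin[OF i] int_of_bool[OF i] by (intro Bochner_Integration.integral_add) auto
    also have "\<dots> \<le> 9 * \<beta> + 4 * (10 * \<beta>)"
      using E_lin[OF i] E_of_bool[OF i] by simp
    finally show ?thesis by simp
  qed
  have step1: "\<bar>expectation (\<lambda>\<omega>. \<eta> i \<omega> * stein z (W \<omega>)) - v i * expectation (\<lambda>\<omega>. stein_deriv z (L i \<omega>))\<bar>
      \<le> v i * (49 * \<beta>)" if i: "i \<in> I" for i
  proof -
    let ?R = "\<lambda>\<omega>. \<eta> i \<omega> * stein z (W \<omega>) - \<eta> i \<omega> * stein z (L i \<omega>) - (\<eta> i \<omega>)\<^sup>2 * stein_deriv z (L i \<omega>)"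
    note fac = factor[OF i _ int_deriv_L[OF i]]
    have "expectation ?R = expectation (\<lambda>\<omega>. \<eta> i \<omega> * stein z (W \<omega>)) - v i * expectation (\<lambda>\<omega>. stein_deriv z (L i \<omega>))"
      using int_prod[OF i] prod0[OF i] fac by simp
    moreover have "\<bar>expectation ?R\<bar> \<le> expectation (\<lambda>\<omega>. \<bar>?R \<omega>\<bar>)"
      by (rule integral_abs_bound)
    moreover have "expectation (\<lambda>\<omega>. \<bar>?R \<omega>\<bar>) \<le> expectation (\<lambda>\<omega>. (\<eta> i \<omega>)\<^sup>2 * h (L i \<omega>))"
    proof (rule integral_mono)
      fix \<omega> assume \<omega>: "\<omega> \<in> space M"
      have "\<bar>?R \<omega>\<bar> = \<bar>\<eta> i \<omega>\<bar> * \<bar>stein z (L i \<omega> + \<eta> i \<omega>) - stein z (L i \<omega>) - \<eta> i \<omega> * stein_deriv z (L i \<omega>)\<bar>"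
        by (simp add: W_eq[of \<omega> i] power2_eq_square algebra_simps flip: abs_mult)
      also have "\<dots> \<le> \<bar>\<eta> i \<omega>\<bar> * (\<bar>\<eta> i \<omega>\<bar> * h (L i \<omega>))"
        unfolding h_def by (intro mult_left_mono stein_remainder bounded[OF i \<omega>]) auto
      finally show "\<bar>?R \<omega>\<bar> \<le> (\<eta> i \<omega>)\<^sup>2 * h (L i \<omega>)"
        by (simp add: power2_eq_square flip: mult.assoc abs_mult)
    qed (use int_prod[OF i] prod0[OF i] fac factor(1)[OF i _ int_h[OF i]] in auto)
    moreover have "expectation (\<lambda>\<omega>. (\<eta> i \<omega>)\<^sup>2 * h (L i \<omega>)) \<le> v i * (49 * \<beta>)"
      using mult_left_mono[OF E_h[OF i] v_nonneg[of i]] by (simp add: factor(2)[OF i _ int_h[OF i]])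
    ultimately show ?thesis by linarith
  qed
  have step2: "\<bar>expectation (\<lambda>\<omega>. stein_deriv z (L i \<omega>)) - expectation (\<lambda>\<omega>. stein_deriv z (W \<omega>))\<bar> \<le> 19 * \<beta>"
    if i: "i \<in> I" for i
  proof -
    have "\<bar>expectation (\<lambda>\<omega>. stein_deriv z (L i \<omega>)) - expectation (\<lambda>\<omega>. stein_deriv z (W \<omega>))\<bar>
        = \<bar>expectation (\<lambda>\<omega>. stein_deriv z (L i \<omega>) - stein_deriv z (W \<omega>))\<bar>"
      using int_deriv_L[OF i] int_deriv_W by simp
    also have "\<dots> \<le> expectation (\<lambda>\<omega>. \<bar>stein_deriv z (L i \<omega>) - stein_deriv z (W \<omega>)\<bar>)"
      by (rule integral_abs_bound)
    also have "\<dots> \<le> expectation (\<lambda>\<omega>. \<beta> * (2 * \<bar>L i \<omega>\<bar> + 5) + of_bool (\<bar>L i \<omega> - z\<bar> \<le> \<beta>))"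
    proof (rule integral_mono)
      fix \<omega> assume "\<omega> \<in> space M"
      then show "\<bar>stein_deriv z (L i \<omega>) - stein_deriv z (W \<omega>)\<bar>
          \<le> \<beta> * (2 * \<bar>L i \<omega>\<bar> + 5) + of_bool (\<bar>L i \<omega> - z\<bar> \<le> \<beta>)"
        unfolding W_eq[of \<omega> i] by (subst abs_minus_commute) (intro stein_deriv_increment bounded[OF i])
    qed (use int_deriv_L[OF i] int_deriv_W int_lin[OF i] int_of_bool[OF i] in auto)
    also have "\<dots> = expectation (\<lambda>\<omega>. \<beta> * (2 * \<bar>L i \<omega>\<bar> + 5)) + expectation (\<lambda>\<omega>. of_bool (\<bar>L i \<omega> - z\<bar> \<le> \<beta>) :: real)"
      using int_lin[OF i] int_of_bool[OF i] by (intro Bochner_Integration.integral_add) auto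
    also have "\<dots> \<le> 9 * \<beta> + 10 * \<beta>"
      using E_lin[OF i] E_of_bool[OF i] by (rule add_mono)
    finally show ?thesis by simp
  qed
  have step: "\<bar>expectation (\<lambda>\<omega>. \<eta> i \<omega> * stein z (W \<omega>)) - v i * expectation (\<lambda>\<omega>. stein_deriv z (W \<omega>))\<bar>
      \<le> v i * (68 * \<beta>)" if i: "i \<in> I" for i
  proof -
    have "\<bar>v i * expectation (\<lambda>\<omega>. stein_deriv z (L i \<omega>)) - v i * expectation (\<lambda>\<omega>. stein_deriv z (W \<omega>))\<bar>
        \<le> v i * (19 * \<beta>)"
      using mult_left_mono[OF step2[OF i] v_nonneg[of i]] v_nonneg[of i]
      by (simp add: abs_mult flip: right_diff_distrib)
    with step1[OF i] show ?thesis by (simp add: algebra_simps abs_le_iff)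
  qed
  have "expectation (\<lambda>\<omega>. W \<omega> * stein z (W \<omega>)) - expectation (\<lambda>\<omega>. stein_deriv z (W \<omega>))
      = (\<Sum>i\<in>I. expectation (\<lambda>\<omega>. \<eta> i \<omega> * stein z (W \<omega>)) - v i * expectation (\<lambda>\<omega>. stein_deriv z (W \<omega>)))"
  proof -
    have "expectation (\<lambda>\<omega>. W \<omega> * stein z (W \<omega>)) = expectation (\<lambda>\<omega>. \<Sum>i\<in>I. \<eta> i \<omega> * stein z (W \<omega>))"
      by (subst (1) W_def) (simp add: sum_distrib_right)
    also have "\<dots> = (\<Sum>i\<in>I. expectation (\<lambda>\<omega>. \<eta> i \<omega> * stein z (W \<omega>)))"
      by (intro Bochner_Integration.integral_sum int_prod)
    finally show ?thesis
      using variances by (simp add: sum_subtractf v_def flip: sum_distrib_right)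
  qed
  also have "\<bar>\<dots>\<bar> \<le> (\<Sum>i\<in>I. v i * (68 * \<beta>))"
    by (rule order_trans[OF sum_abs sum_mono[OF step]])
  also have "\<dots> = 68 * \<beta>" using variances by (simp add: v_def flip: sum_distrib_right)
  finally have main: "\<bar>expectation (\<lambda>\<omega>. W \<omega> * stein z (W \<omega>)) - expectation (\<lambda>\<omega>. stein_deriv z (W \<omega>))\<bar> \<le> 68 * \<beta>" .
  have int_WS: "integrable M (\<lambda>\<omega>. W \<omega> * stein z (W \<omega>))"
    by (rule integrable_bounded[of _ 1]) (auto simp: id_times_stein_bound)
  have "expectation (\<lambda>\<omega>. stein_deriv z (W \<omega>))
      = expectation (\<lambda>\<omega>. W \<omega> * stein z (W \<omega>) + indicator {\<omega> \<in> space M. W \<omega> \<le> z} \<omega> - \<Phi> z)"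
    by (intro Bochner_Integration.integral_cong) (auto simp: stein_deriv_def)
  also have "\<dots> = expectation (\<lambda>\<omega>. W \<omega> * stein z (W \<omega>)) + prob {\<omega> \<in> space M. W \<omega> \<le> z} - \<Phi> z"
  proof -
    have "integrable M (indicator {\<omega> \<in> space M. W \<omega> \<le> z} :: 'a \<Rightarrow> real)"
      by (rule integrable_indicator_event) measurable
    then show ?thesis using int_WS by (simp add: prob_space)
  qed
  finally show ?thesis using main by linarith
qed

lemma negated_summands: "bounded_summands M I (\<lambda>i \<omega>. - \<eta> i \<omega>) \<beta>"
proof
  show "indep_vars (\<lambda>_. borel) (\<lambda>i \<omega>. - \<eta> i \<omega>) I"
    using indep_vars_compose[OF indep, of "\<lambda>_ x. - x" "\<lambda>_. borel"] by (simp add: comp_def)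
qed (use finite_I bounded mean variances in auto)

text \<open>The events \<open>W + \<Delta> \<le> z\<close> and \<open>W \<le> z\<close> differ only when \<open>W\<close> lies within \<open>|\<Delta>|\<close> of \<open>z\<close>. The randomized
concentration inequality covers the window below \<open>z\<close>; the one above \<open>z\<close> is the same statement for the
negated summands.\<close>
theorem nonlinear_berry_esseen:
  assumes [measurable]: "\<Delta> \<in> borel_measurable M"
    and ind: "\<And>i h. i \<in> I \<Longrightarrow> h \<in> borel_measurable (borel \<Otimes>\<^sub>M borel) \<Longrightarrow>
      indep_var borel (\<eta> i) borel (\<lambda>\<omega>. h (W \<omega> - \<eta> i \<omega>, \<Delta>' i \<omega>))"
    and bd: "\<And>\<omega>. \<omega> \<in> space M \<Longrightarrow> \<bar>\<Delta> \<omega>\<bar> \<le> B"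
    and bd': "\<And>i \<omega>. i \<in> I \<Longrightarrow> \<omega> \<in> space M \<Longrightarrow> \<bar>\<Delta>' i \<omega>\<bar> \<le> B"
  shows "\<bar>prob {\<omega> \<in> space M. W \<omega> + \<Delta> \<omega> \<le> z} - \<Phi> z\<bar>
    \<le> expectation (\<lambda>\<omega>. \<bar>W \<omega> * \<Delta> \<omega>\<bar>) + (\<Sum>i\<in>I. expectation (\<lambda>\<omega>. \<bar>\<eta> i \<omega> * (\<Delta> \<omega> - \<Delta>' i \<omega>)\<bar>)) + 74 * \<beta>"
    (is "_ \<le> ?e1 + ?e2 + _")
proof -
  interpret neg: bounded_summands M I "\<lambda>i \<omega>. - \<eta> i \<omega>" \<beta> by (rule negated_summands)
  have negW: "neg.W \<omega> = - W \<omega>" for \<omega> by (simp add: neg.W_def W_def sum_negf)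
  have neg_ind: "indep_var borel (\<lambda>\<omega>. - \<eta> i \<omega>) borel (\<lambda>\<omega>. h (neg.W \<omega> - - \<eta> i \<omega>, \<Delta>' i \<omega>))"
    if i: "i \<in> I" and [measurable]: "h \<in> borel_measurable (borel \<Otimes>\<^sub>M borel)" for i and h :: "real \<times> real \<Rightarrow> real"
  proof -
    have "(\<lambda>(w, d). h (- w, d)) \<in> borel_measurable (borel \<Otimes>\<^sub>M borel)" by measurable
    from indep_var_compose[OF ind[OF i this], of "\<lambda>x. - x" borel "\<lambda>x. x" borel]
    show ?thesis by (simp add: comp_def negW add.commute)
  qed
  let ?L = "{\<omega> \<in> space M. z - \<bar>\<Delta> \<omega>\<bar> \<le> W \<omega> \<and> W \<omega> \<le> z}"
  let ?R = "{\<omega> \<in> space M. - z - \<bar>\<Delta> \<omega>\<bar> \<le> neg.W \<omega> \<and> neg.W \<omega> \<le> - z}"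
  let ?T = "{\<omega> \<in> space M. W \<omega> + \<Delta> \<omega> \<le> z}" and ?S = "{\<omega> \<in> space M. W \<omega> \<le> z}"
  have L: "prob ?L \<le> ?e1 + ?e2 + 6 * \<beta>"
    by (rule randomized_concentration[OF assms])
  have R: "prob ?R \<le> ?e1 + ?e2 + 6 * \<beta>"
    using neg.randomized_concentration[of \<Delta> \<Delta>' B "- z"] neg_ind bd bd' by (simp add: negW)
  have "prob ?S \<le> prob (?T \<union> ?L)"
    by (rule finite_measure_mono) auto
  also have "\<dots> \<le> prob ?T + prob ?L" by (rule measure_Un_le) auto
  finally have ST: "prob ?S \<le> prob ?T + prob ?L" .
  have "prob ?T \<le> prob (?S \<union> ?R)"
    by (rule finite_measure_mono) (auto simp: negW)
  also have "\<dots> \<le> prob ?S + prob ?R" by (rule measure_Un_le) (auto simp: negW)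
  finally have TS: "prob ?T \<le> prob ?S + prob ?R" .
  show ?thesis using L R ST TS berry_esseen[of z] by linarith
qed

end

section \<open>The estimator as a U-statistic and its Hoeffding decomposition\<close>

lemma empirical_walsh_cdf_mono:
  assumes "n \<ge> 2" "s \<le> t"
  shows "empirical_walsh_cdf n x s \<le> empirical_walsh_cdf n x t"
  unfolding empirical_walsh_cdf_def using assms
  by (intro divide_right_mono sum_mono) (auto simp: of_bool_def)

text \<open>The infimum is attained: to the right of any \<open>t\<close> the empirical function is constant up to the next
of the finitely many pairwise averages.\<close>
lemma hodges_lehmann_le_iff:
  assumes "n \<ge> 2"
  shows "hodges_lehmann n x \<le> t \<longleftrightarrow> empirical_walsh_cdf n x t \<ge> 1 / 2"
proof -
  let ?P = "{(i, j). i \<in> {1..n} \<and> j \<in> {1..n} \<and> i \<noteq> j}"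
  let ?E = "empirical_walsh_cdf n x"
  define V where "V = (\<lambda>(i, j). (x i + x j) / 2) ` ?P"
  have P_eq: "?P = {1..n} \<times> {1..n} - (\<lambda>i. (i, i)) ` {1..n}" by auto
  have finP: "finite ?P" unfolding P_eq by simp
  have cardP: "real (card ?P) = real n * (real n - 1)"
  proof -
    have "card ((\<lambda>i. (i, i)) ` {1..n}) = n" by (simp add: card_image inj_on_def)
    then have "card ?P = n * n - n" unfolding P_eq by (subst card_Diff_subset) auto
    then show ?thesis using assms by (simp add: of_nat_diff right_diff_distrib)
  qed
  have finV: "finite V" unfolding V_def using finP by simp
  have V_I: "(x i + x j) / 2 \<in> V" if "(i, j) \<in> ?P" for i j
    unfolding V_def using that by (rule rev_image_eqI) simp
  have E_one: "?E u = 1" if "\<And>v. v \<in> V \<Longrightarrow> v \<le> u" for u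
  proof -
    have "(\<Sum>(i, j)\<in>?P. of_bool ((x i + x j) / 2 \<le> u) :: real) = (\<Sum>(i, j)\<in>?P. 1)"
      using that[OF V_I] by (intro sum.cong) (auto simp del: le_divide_eq_numeral1 divide_le_eq_numeral1)
    then show ?thesis using assms cardP by (simp add: empirical_walsh_cdf_def case_prod_unfold)
  qed
  have E_zero: "?E u = 0" if "\<And>v. v \<in> V \<Longrightarrow> u < v" for u
  proof -
    have "(\<Sum>(i, j)\<in>?P. of_bool ((x i + x j) / 2 \<le> u) :: real) = (\<Sum>(i, j)\<in>?P. 0)"
      using that[OF V_I] by (intro sum.cong) (auto simp: not_le simp del: less_divide_eq_numeral1 divide_le_eq_numeral1)
    then show ?thesis by (simp add: empirical_walsh_cdf_def case_prod_unfold)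
  qed
  let ?S = "{u. ?E u \<ge> 1 / 2}"
  obtain hi where "\<And>v. v \<in> V \<Longrightarrow> v \<le> hi" using finV by (meson bdd_above_def bdd_above_finite)
  then have "hi \<in> ?S" using E_one[of hi] by simp
  then have ne: "?S \<noteq> {}" by blast
  obtain lo where lo: "\<And>v. v \<in> V \<Longrightarrow> lo \<le> v" using finV by (meson bdd_below_def bdd_below_finite)
  have bdd: "bdd_below ?S"
  proof (rule bdd_belowI[of _ lo])
    fix u assume "u \<in> ?S"
    show "lo \<le> u"
    proof (rule ccontr)
      assume "\<not> lo \<le> u"
      then have "?E u = 0" using lo by (intro E_zero) force
      with \<open>u \<in> ?S\<close> show False by simp
    qed
  qed
  show ?thesis
  proof
    assume "?E t \<ge> 1 / 2"
    then show "hodges_lehmann n x \<le> t"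
      unfolding hodges_lehmann_def using bdd by (intro cInf_lower) auto
  next
    assume le: "hodges_lehmann n x \<le> t"
    show "?E t \<ge> 1 / 2"
    proof (rule ccontr)
      assume low: "\<not> ?E t \<ge> 1 / 2"
      define m where "m = Min (insert (t + 1) {v \<in> V. t < v})"
      have "t < m" unfolding m_def using finV by (subst Min_gr_iff) auto
      have flat: "?E u = ?E t" if "t \<le> u" "u < m" for u
      proof -
        have "v \<le> u \<longleftrightarrow> v \<le> t" if "v \<in> V" for v
        proof -
          have "m \<le> v" if "t < v" using \<open>v \<in> V\<close> that finV by (auto simp: m_def)
          then show ?thesis using \<open>t \<le> u\<close> \<open>u < m\<close> by force
        qed
        then have "(\<Sum>(i, j)\<in>?P. of_bool ((x i + x j) / 2 \<le> u) :: real) = (\<Sum>(i, j)\<in>?P. of_bool ((x i + x j) / 2 \<le> t))"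
          using V_I by (intro sum.cong) (auto simp del: divide_le_eq_numeral1)
        then show ?thesis by (simp add: empirical_walsh_cdf_def)
      qed
      have "m \<le> Inf ?S"
      proof (rule cInf_greatest[OF ne])
        fix u assume u: "u \<in> ?S"
        show "m \<le> u"
        proof (rule ccontr)
          assume "\<not> m \<le> u"
          then have "?E u \<le> ?E t"
            using flat[of u] empirical_walsh_cdf_mono[OF assms, of u t x] by (cases "t \<le> u") auto
          with u low show False by auto
        qed
      qed
      with le \<open>t < m\<close> show False by (simp add: hodges_lehmann_def)
    qed
  qed
qed

text \<open>Fubini for an independent pair; products of functions of \<open>X\<close> and of \<open>Y\<close> do not suffice below, since
the degenerate kernel couples two observations.\<close>
lemma (in prob_space) expectation_indep_zero:
  fixes \<psi> :: "'b \<times> 'b \<Rightarrow> real"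
  assumes ind: "indep_var S X T Y" and meas: "\<psi> \<in> borel_measurable (S \<Otimes>\<^sub>M T)"
    and bd: "\<And>x y. x \<in> space S \<Longrightarrow> y \<in> space T \<Longrightarrow> \<bar>\<psi> (x, y)\<bar> \<le> B"
    and zero: "\<And>y. y \<in> space T \<Longrightarrow> expectation (\<lambda>\<omega>. \<psi> (X \<omega>, y)) = 0"
  shows "expectation (\<lambda>\<omega>. \<psi> (X \<omega>, Y \<omega>)) = 0"
proof -
  have [measurable]: "X \<in> measurable M S" "Y \<in> measurable M T"
    using ind by (auto simp: indep_var_distribution_eq)
  interpret X: prob_space "distr M S X" by (rule prob_space_distr) simp
  interpret Y: prob_space "distr M T Y" by (rule prob_space_distr) simp
  interpret XY: pair_prob_space "distr M S X" "distr M T Y" ..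
  have "expectation (\<lambda>\<omega>. \<psi> (X \<omega>, Y \<omega>)) = (\<integral>p. \<psi> p \<partial>distr M (S \<Otimes>\<^sub>M T) (\<lambda>\<omega>. (X \<omega>, Y \<omega>)))"
    by (subst integral_distr) (use meas in auto)
  also have "\<dots> = (\<integral>p. \<psi> p \<partial>(distr M S X \<Otimes>\<^sub>M distr M T Y))"
    using ind by (simp add: indep_var_distribution_eq)
  also have "\<dots> = (\<integral>y. \<integral>x. \<psi> (x, y) \<partial>distr M S X \<partial>distr M T Y)"
  proof (rule XY.integral_snd[symmetric, of "\<lambda>x y. \<psi> (x, y)", simplified])
    show "integrable (distr M S X \<Otimes>\<^sub>M distr M T Y) \<psi>"
      by (rule XY.P.integrable_const_bound[of _ B])
        (use meas bd in \<open>auto simp: space_pair_measure intro!: AE_I2\<close>)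
  qed
  also have "\<dots> = (\<integral>y. 0 \<partial>distr M T Y)"
  proof (rule Bochner_Integration.integral_cong[OF refl])
    fix y assume "y \<in> space (distr M T Y)"
    then have y: "y \<in> space T" by simp
    have "(\<integral>x. \<psi> (x, y) \<partial>distr M S X) = expectation (\<lambda>\<omega>. \<psi> (X \<omega>, y))"
      by (rule integral_distr) (use meas y in auto)
    then show "(\<integral>x. \<psi> (x, y) \<partial>distr M S X) = 0" using zero[OF y] by simp
  qed
  finally show ?thesis by simp
qed

text \<open>Separates the terms of a sum over ordered pairs that involve the index \<open>i\<close>.\<close>
lemma double_sum_leave_one_out:
  fixes Q :: "'i \<Rightarrow> 'i \<Rightarrow> real"
  assumes "finite I" "i \<in> I"
  shows "(\<Sum>a\<in>I. \<Sum>b\<in>I-{a}. Q a b)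
    = (\<Sum>a\<in>I-{i}. \<Sum>b\<in>I-{i}-{a}. Q a b) + (\<Sum>b\<in>I-{i}. Q i b) + (\<Sum>a\<in>I-{i}. Q a i)"
proof -
  have "(\<Sum>b\<in>I-{a}. Q a b) = Q a i + (\<Sum>b\<in>I-{i}-{a}. Q a b)" if "a \<in> I - {i}" for a
    using assms that by (subst sum.remove[of _ i]) (auto intro!: sum.cong)
  then show ?thesis
    using assms by (subst sum.remove[of _ i]) (auto simp: sum.distrib)
qed

text \<open>A sample from \<open>D\<close>, the law of \<open>\<xi> = X - \<theta>\<close>; \<open>mean_half\<close> says that the pseudomedian is zero, and \<open>s\<^sup>2\<close> is
the variance of \<open>F(-\<xi>)\<close>.\<close>
locale sample = prob_space M for M :: "'a measure" +
  fixes D :: "real measure" and n :: nat and Y :: "nat \<Rightarrow> 'a \<Rightarrow> real" and B s :: real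
  assumes n_ge_2: "n \<ge> 2"
    and indep_Y: "indep_vars (\<lambda>_. borel) Y {1..n}"
    and distr_Y: "\<And>i. i \<in> {1..n} \<Longrightarrow> distr M borel (Y i) = D"
    and cdf_lipschitz: "\<And>x y. \<bar>cdf D x - cdf D y\<bar> \<le> B * \<bar>x - y\<bar>"
    and s_pos: "s > 0"
    and s_square: "s\<^sup>2 = (\<integral>x. (cdf D (- x) - 1 / 2)\<^sup>2 \<partial>D)"
    and mean_half: "(\<integral>x. cdf D (- x) \<partial>D) = 1 / 2"
begin

abbreviation "F \<equiv> cdf D"

text \<open>\<open>H \<delta>\<close> is the probability of \<open>(\<xi>\<^sub>1 + \<xi>\<^sub>2) / 2 \<le> \<delta>\<close>, that is \<open>U(\<theta> + \<delta>)\<close>; \<open>g\<close> and \<open>q\<close> are the centred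
projection and the degenerate part of the kernel \<open>of_bool (x + y \<le> 2 \<delta>)\<close> in its Hoeffding
decomposition.\<close>
definition H :: "real \<Rightarrow> real" where "H \<delta> = (\<integral>x. F (2 * \<delta> - x) \<partial>D)"

definition g :: "real \<Rightarrow> real \<Rightarrow> real" where "g \<delta> x = F (2 * \<delta> - x) - H \<delta>"

definition q :: "real \<Rightarrow> real \<Rightarrow> real \<Rightarrow> real" where
  "q \<delta> x y = of_bool (x + y \<le> 2 * \<delta>) - F (2 * \<delta> - x) - F (2 * \<delta> - y) + H \<delta>"

lemma rv_Y [measurable]: "i \<in> {1..n} \<Longrightarrow> Y i \<in> borel_measurable M"
  using indep_Y by (auto simp: indep_vars_def)

sublocale D: real_distribution D
proof -
  have "1 \<in> {1..n}" using n_ge_2 by simp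
  then have D: "D = distr M borel (Y 1)" by (rule distr_Y[symmetric])
  show "real_distribution D"
    unfolding D using n_ge_2 by (intro real_distribution_distr) auto
qed

lemma F_measurable [measurable]: "F \<in> borel_measurable borel"
  using D.cdf_nondecreasing by (intro borel_measurable_mono) (simp add: mono_def)

lemma expectation_Y:
  fixes h :: "real \<Rightarrow> real"
  assumes "i \<in> {1..n}" "h \<in> borel_measurable borel"
  shows "expectation (\<lambda>\<omega>. h (Y i \<omega>)) = (\<integral>x. h x \<partial>D)"
  using assms by (subst distr_Y[OF assms(1), symmetric], subst integral_distr) auto

lemma F_bounds: "0 \<le> F x" "F x \<le> 1"
  by (rule D.cdf_nonneg, rule D.cdf_bounded_prob)

lemma F_int: "integrable D (\<lambda>x. F (c - x))"
  by (rule D.integrable_bounded[of _ 1]) (auto simp: F_bounds)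

lemma H_bounds: "0 \<le> H \<delta>" "H \<delta> \<le> 1"
  unfolding H_def using F_bounds
  by (auto intro!: D.expectation_le_bound)

lemma H_zero: "H 0 = 1 / 2"
  using mean_half by (simp add: H_def)

lemma g_zero: "g 0 x = F (- x) - 1 / 2"
  by (simp add: g_def H_zero)

lemma g_measurable [measurable]: "g \<delta> \<in> borel_measurable borel"
  unfolding g_def[abs_def] by measurable

lemma q_measurable [measurable]:
  assumes [measurable]: "u \<in> borel_measurable N" "v \<in> borel_measurable N"
  shows "(\<lambda>x. q \<delta> (u x) (v x)) \<in> borel_measurable N"
  unfolding q_def by measurable

lemma g_bound: "\<bar>g \<delta> x\<bar> \<le> 1"
  using F_bounds[of "2 * \<delta> - x"] H_bounds[of \<delta>] by (auto simp: g_def)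

lemma q_bound: "\<bar>q \<delta> x y\<bar> \<le> 2"
  using F_bounds[of "2 * \<delta> - x"] F_bounds[of "2 * \<delta> - y"] H_bounds[of \<delta>]
  by (auto simp: q_def of_bool_def)

lemma q_sym: "q \<delta> x y = q \<delta> y x"
  by (simp add: q_def add.commute)

lemma kernel_eq: "of_bool (x + y \<le> 2 * \<delta>) = q \<delta> x y + g \<delta> x + g \<delta> y + H \<delta>"
  by (simp add: q_def g_def)

lemma q_degenerate: "(\<integral>x. q \<delta> x y \<partial>D) = 0"
proof -
  have "(\<integral>x. q \<delta> x y \<partial>D) = (\<integral>x. indicator {..2 * \<delta> - y} x - F (2 * \<delta> - x) - F (2 * \<delta> - y) + H \<delta> \<partial>D)"
    by (intro Bochner_Integration.integral_cong) (auto simp: q_def indicator_def of_bool_def)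
  also have "\<dots> = F (2 * \<delta> - y) - H \<delta> - F (2 * \<delta> - y) + H \<delta>"
    using F_int D.prob_space by (simp add: H_def cdf_def less_top[symmetric])
  finally show ?thesis by simp
qed

lemma g_integral: "(\<integral>x. g \<delta> x \<partial>D) = 0"
  unfolding g_def using F_int D.prob_space by (simp add: H_def)

lemma g_diff: "\<bar>g \<delta> x - g 0 x\<bar> \<le> 4 * B * \<bar>\<delta>\<bar>"
proof -
  have F: "\<bar>F (2 * \<delta> - x) - F (2 * 0 - x)\<bar> \<le> 2 * B * \<bar>\<delta>\<bar>" for x
    using cdf_lipschitz[of "2 * \<delta> - x" "2 * 0 - x"] by (simp add: abs_mult)
  have "\<bar>H \<delta> - H 0\<bar> = \<bar>\<integral>x. F (2 * \<delta> - x) - F (2 * 0 - x) \<partial>D\<bar>"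
    unfolding H_def using F_int[of "2 * \<delta>"] F_int[of "2 * 0"] by simp
  also have "\<dots> \<le> (\<integral>x. \<bar>F (2 * \<delta> - x) - F (2 * 0 - x)\<bar> \<partial>D)" by (rule integral_abs_bound)
  also have "\<dots> \<le> 2 * B * \<bar>\<delta>\<bar>"
    by (rule D.expectation_le_bound) (use F in auto)
  finally show ?thesis using F[of x] unfolding g_def by linarith
qed

lemma g_orthogonal:
  assumes ij: "i \<in> {1..n}" "j \<in> {1..n}" "i \<noteq> j"
    and [measurable]: "h \<in> borel_measurable borel" and bd: "\<And>x. \<bar>h x\<bar> \<le> c" and 0: "(\<integral>x. h x \<partial>D) = 0"
  shows "expectation (\<lambda>\<omega>. h (Y i \<omega>) * h (Y j \<omega>)) = (0 :: real)"
proof -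
  have "indep_var borel (Y i) borel (Y j)"
    using indep_var_rest[OF indep_Y, of i "\<lambda>y. y j" borel] ij by auto
  from expectation_mult_indep[OF this, of h h] show ?thesis
    using ij bd by (simp add: integrable_bounded[of _ c] expectation_Y 0)
qed

text \<open>Given all other observations, the conditional mean over \<open>Y\<^sub>a\<close> vanishes by degeneracy. The indices \<open>b\<close>, \<open>k\<close>
and \<open>l\<close> may coincide.\<close>
lemma q_orthogonal:
  assumes a: "a \<in> {1..n}" and rest: "b \<in> {1..n} - {a}" "k \<in> {1..n} - {a}" "l \<in> {1..n} - {a}"
  shows "expectation (\<lambda>\<omega>. q \<delta> (Y a \<omega>) (Y b \<omega>) * q \<delta> (Y k \<omega>) (Y l \<omega>)) = 0"
proof -
  let ?J = "{1..n} - {a}"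
  let ?X = "\<lambda>\<omega>. restrict (\<lambda>i. Y i \<omega>) {a}" and ?Z = "\<lambda>\<omega>. restrict (\<lambda>i. Y i \<omega>) ?J"
  let ?\<psi> = "\<lambda>(x, y). q \<delta> (x a) (y b) * q \<delta> (y k) (y l)"
  have "expectation (\<lambda>\<omega>. ?\<psi> (?X \<omega>, ?Z \<omega>)) = 0"
  proof (rule expectation_indep_zero)
    show "indep_var (PiM {a} (\<lambda>_. borel)) ?X (PiM ?J (\<lambda>_. borel)) ?Z"
      using a by (intro indep_var_restrict[OF indep_Y]) auto
    have [measurable]: "(\<lambda>p. fst p a) \<in> borel_measurable (PiM {a} (\<lambda>_. borel) \<Otimes>\<^sub>M PiM ?J (\<lambda>_. borel))"
      by (rule measurable_compose[OF measurable_fst]) simp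
    have [measurable]: "(\<lambda>p. snd p c) \<in> borel_measurable (PiM {a} (\<lambda>_. borel) \<Otimes>\<^sub>M PiM ?J (\<lambda>_. borel))"
      if "c \<in> ?J" for c
      by (rule measurable_compose[OF measurable_snd]) (use that in simp)
    show "?\<psi> \<in> borel_measurable (PiM {a} (\<lambda>_. borel) \<Otimes>\<^sub>M PiM ?J (\<lambda>_. borel))"
      unfolding case_prod_beta' using rest by measurable
    show "\<bar>?\<psi> (x, y)\<bar> \<le> 2 * 2" for x y
      unfolding prod.case abs_mult by (intro mult_mono q_bound) auto
    fix y
    have "expectation (\<lambda>\<omega>. ?\<psi> (?X \<omega>, y)) = expectation (\<lambda>\<omega>. q \<delta> (Y a \<omega>) (y b)) * q \<delta> (y k) (y l)"
      by simp
    also have "expectation (\<lambda>\<omega>. q \<delta> (Y a \<omega>) (y b)) = (\<integral>x. q \<delta> x (y b) \<partial>D)"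
      by (rule expectation_Y[OF a]) measurable
    finally show "expectation (\<lambda>\<omega>. ?\<psi> (?X \<omega>, y)) = 0" by (simp add: q_degenerate)
  qed
  then show ?thesis using assms by simp
qed

text \<open>Of two distinct unordered pairs, one contains an index missing from the other, so the terms are
orthogonal as soon as \<open>A\<close> never contains a pair together with its reversal.\<close>
lemma q_sum_square:
  assumes A: "A \<subseteq> {1..n} \<times> {1..n}" "\<And>i j. (i, j) \<in> A \<Longrightarrow> (j, i) \<notin> A"
  shows "expectation (\<lambda>\<omega>. (\<Sum>(i, j)\<in>A. q \<delta> (Y i \<omega>) (Y j \<omega>))\<^sup>2) \<le> 4 * real (card A)"
proof -
  have fin: "finite A" using A(1) by (rule finite_subset) simp
  have "expectation (\<lambda>\<omega>. (\<Sum>p\<in>A. q \<delta> (Y (fst p) \<omega>) (Y (snd p) \<omega>))\<^sup>2) \<le> real (card A) * 2\<^sup>2"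
  proof (rule expectation_square_sum_orthogonal_le[OF fin])
    fix p p' assume p: "p \<in> A" "p' \<in> A" "p \<noteq> p'"
    obtain i j k l where ijkl: "p = (i, j)" "p' = (k, l)" by (cases p, cases p')
    have ne: "i \<noteq> j" "k \<noteq> l" using A(2) p ijkl by auto
    have I: "i \<in> {1..n}" "j \<in> {1..n}" "k \<in> {1..n}" "l \<in> {1..n}" using A(1) p ijkl by auto
    have "i \<notin> {k, l} \<or> j \<notin> {k, l}" using A(2) p ijkl ne by auto
    then show "expectation (\<lambda>\<omega>. q \<delta> (Y (fst p) \<omega>) (Y (snd p) \<omega>) * q \<delta> (Y (fst p') \<omega>) (Y (snd p') \<omega>)) = 0"
    proof
      assume "i \<notin> {k, l}"
      then show ?thesis using q_orthogonal[of i j k l \<delta>] I ne ijkl by simp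
    next
      assume "j \<notin> {k, l}"
      then show ?thesis using q_orthogonal[of j i k l \<delta>] I ne ijkl by (simp add: q_sym[of \<delta> "Y i _"])
    qed
  qed (use A in \<open>auto simp: q_bound\<close>)
  then show ?thesis by (simp add: case_prod_unfold mult.commute)
qed

end

section \<open>Normal approximation at a fixed point\<close>

context sample begin

text \<open>The sign makes a large value of the estimator correspond to a large sum.\<close>
definition \<eta> :: "nat \<Rightarrow> 'a \<Rightarrow> real" where
  "\<eta> i \<omega> = - g 0 (Y i \<omega>) / (s * sqrt n)"

lemma \<eta>_square:
  assumes i: "i \<in> {1..n}"
  shows "expectation (\<lambda>\<omega>. (\<eta> i \<omega>)\<^sup>2) = 1 / n"
proof -
  have "expectation (\<lambda>\<omega>. (\<eta> i \<omega>)\<^sup>2) = (\<integral>x. (g 0 x)\<^sup>2 / (s\<^sup>2 * n) \<partial>D)"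
    using expectation_Y[OF i, of "\<lambda>x. (g 0 x)\<^sup>2 / (s\<^sup>2 * n)"]
    by (simp add: \<eta>_def power_divide power_mult_distrib)
  also have "\<dots> = 1 / n" using s_pos by (simp add: g_zero flip: s_square)
  finally show ?thesis .
qed

lemma summands: "bounded_summands M {1..n} \<eta> (1 / (s * sqrt n))"
proof
  show "indep_vars (\<lambda>_. borel) \<eta> {1..n}"
    using indep_vars_compose[OF indep_Y, of "\<lambda>_ x. - g 0 x / (s * sqrt n)" "\<lambda>_. borel"]
    by (simp add: comp_def \<eta>_def[abs_def])
  fix i \<omega>
  assume i: "i \<in> {1..n}"
  show "\<bar>\<eta> i \<omega>\<bar> \<le> 1 / (s * sqrt n)"
    unfolding \<eta>_def using g_bound[of 0 "Y i \<omega>"] s_pos by (simp add: abs_mult divide_right_mono)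
  show "expectation (\<eta> i) = 0"
    using expectation_Y[OF i, of "\<lambda>x. - g 0 x / (s * sqrt n)"] g_integral[of 0] by (simp add: \<eta>_def[abs_def])
next
  show "(\<Sum>i\<in>{1..n}. expectation (\<lambda>\<omega>. (\<eta> i \<omega>)\<^sup>2)) = 1" using n_ge_2 by (simp add: \<eta>_square)
qed simp

sublocale lin: bounded_summands M "{1..n}" \<eta> "1 / (s * sqrt n)"
  by (rule summands)

lemma hoeffding_decomposition:
  "empirical_walsh_cdf n (\<lambda>i. Y i \<omega>) \<delta> = H \<delta> + 2 / n * (\<Sum>i\<in>{1..n}. g \<delta> (Y i \<omega>))
    + (\<Sum>i\<in>{1..n}. \<Sum>j\<in>{1..n}-{i}. q \<delta> (Y i \<omega>) (Y j \<omega>)) / (real n * (real n - 1))"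
proof -
  let ?I = "{1..n}" and ?m = "real n - 1"
  let ?g = "\<lambda>i. g \<delta> (Y i \<omega>)" and ?q = "\<lambda>i j. q \<delta> (Y i \<omega>) (Y j \<omega>)"
  have P_eq: "{(i, j). i \<in> ?I \<and> j \<in> ?I \<and> i \<noteq> j} = Sigma ?I (\<lambda>i. ?I - {i})" by auto
  have card: "real (card (?I - {i})) = ?m" if "i \<in> ?I" for i
    using that n_ge_2 by (simp add: of_nat_diff)
  have sum_I: "(\<Sum>j\<in>?I-{i}. ?g j) = (\<Sum>j\<in>?I. ?g j) - ?g i" if "i \<in> ?I" for i
    using that by (simp add: sum_diff1)
  have "(\<Sum>(i, j)\<in>{(i, j). i \<in> ?I \<and> j \<in> ?I \<and> i \<noteq> j}. of_bool ((Y i \<omega> + Y j \<omega>) / 2 \<le> \<delta>) :: real)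
      = (\<Sum>i\<in>?I. \<Sum>j\<in>?I-{i}. of_bool ((Y i \<omega> + Y j \<omega>) / 2 \<le> \<delta>))"
    unfolding P_eq by (rule sum.Sigma[symmetric]) auto
  also have "\<dots> = (\<Sum>i\<in>?I. \<Sum>j\<in>?I-{i}. ?q i j + ?g i + ?g j + H \<delta>)"
    by (intro sum.cong refl) (simp add: kernel_eq[symmetric] mult.commute)
  also have "\<dots> = (\<Sum>i\<in>?I. (\<Sum>j\<in>?I-{i}. ?q i j) + ?m * ?g i + ((\<Sum>j\<in>?I. ?g j) - ?g i) + ?m * H \<delta>)"
    by (intro sum.cong refl) (simp only: sum.distrib sum_constant card sum_I)
  also have "\<dots> = (\<Sum>i\<in>?I. \<Sum>j\<in>?I-{i}. ?q i j) + 2 * ?m * (\<Sum>i\<in>?I. ?g i) + real n * ?m * H \<delta>"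
    by (simp add: sum.distrib sum_subtractf algebra_simps flip: sum_distrib_left)
  finally have eq: "(\<Sum>(i, j)\<in>{(i, j). i \<in> ?I \<and> j \<in> ?I \<and> i \<noteq> j}. of_bool ((Y i \<omega> + Y j \<omega>) / 2 \<le> \<delta>) :: real)
      = (\<Sum>i\<in>?I. \<Sum>j\<in>?I-{i}. ?q i j) + 2 * ?m * (\<Sum>i\<in>?I. ?g i) + real n * ?m * H \<delta>" .
  have "real n \<noteq> 0" "?m \<noteq> 0" using n_ge_2 by auto
  moreover have "(Q + 2 * m * G + N * m * h) / (N * m) = h + 2 / N * G + Q / (N * m)"
    if "N \<noteq> 0" "m \<noteq> 0" for Q m G N h :: real
    using that by (simp add: field_simps)
  ultimately show ?thesis unfolding empirical_walsh_cdf_def eq by blast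
qed

text \<open>The pairs \<open>i < j\<close> and the pairs \<open>j < i\<close> are treated separately, as a pair and its reversal are not
orthogonal.\<close>
lemma q_double_sum_square:
  "expectation (\<lambda>\<omega>. (\<Sum>i\<in>{1..n}. \<Sum>j\<in>{1..n}-{i}. q \<delta> (Y i \<omega>) (Y j \<omega>))\<^sup>2) \<le> 8 * (real n * (real n - 1))"
proof -
  let ?I = "{1..n}"
  let ?P = "Sigma ?I (\<lambda>i. ?I - {i})"
  let ?A = "{(i, j) \<in> ?I \<times> ?I. i < j}" and ?B = "{(i, j) \<in> ?I \<times> ?I. j < i}"
  let ?S = "\<lambda>A \<omega>. \<Sum>(i, j)\<in>A. q \<delta> (Y i \<omega>) (Y j \<omega>)"
  have fin: "finite ?A" "finite ?B" by (rule finite_subset[of _ "?I \<times> ?I"]; auto)+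
  have P_eq: "?P = ?A \<union> ?B" "?A \<inter> ?B = {}" by auto
  have split: "(\<Sum>i\<in>?I. \<Sum>j\<in>?I-{i}. q \<delta> (Y i \<omega>) (Y j \<omega>)) = ?S ?A \<omega> + ?S ?B \<omega>" for \<omega>
  proof -
    have "(\<Sum>i\<in>?I. \<Sum>j\<in>?I-{i}. q \<delta> (Y i \<omega>) (Y j \<omega>)) = ?S ?P \<omega>" by (rule sum.Sigma) auto
    then show ?thesis unfolding P_eq(1) by (simp only: sum.union_disjoint[OF fin P_eq(2)])
  qed
  have "card ?P = n * (n - 1)" by simp
  then have "card ?A + card ?B = n * (n - 1)"
    using card_Un_disjoint[OF fin P_eq(2)] unfolding P_eq(1) by simp
  then have "real (card ?A + card ?B) = real (n * (n - 1))" by (simp only:)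
  then have cards: "real (card ?A) + real (card ?B) = real n * (real n - 1)"
    using n_ge_2 unfolding of_nat_add of_nat_mult by (subst (asm) of_nat_diff) auto
  have [measurable]: "?S A \<in> borel_measurable M" if "A \<subseteq> ?I \<times> ?I" for A
    unfolding case_prod_unfold using that by (intro borel_measurable_sum q_measurable rv_Y) auto
  have bd: "\<bar>?S A \<omega>\<bar> \<le> real (card A) * 2" for A \<omega>
    by (rule order_trans[OF sum_abs], rule order_trans[OF sum_bounded_above[of _ _ 2]]) (auto simp: q_bound)
  have int: "integrable M (\<lambda>\<omega>. (?S A \<omega>)\<^sup>2)" if "A \<subseteq> ?I \<times> ?I" for A
  proof (rule square_integrable_bounded[OF _ bd])
    show "?S A \<in> borel_measurable M" using that by measurable
  qed
  have AB: "?A \<subseteq> ?I \<times> ?I" "?B \<subseteq> ?I \<times> ?I" by auto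
  have "expectation (\<lambda>\<omega>. (?S ?A \<omega> + ?S ?B \<omega>)\<^sup>2) \<le> expectation (\<lambda>\<omega>. 2 * (?S ?A \<omega>)\<^sup>2 + 2 * (?S ?B \<omega>)\<^sup>2)"
  proof (rule integral_mono')
    have "(x + y)\<^sup>2 \<le> 2 * x\<^sup>2 + 2 * y\<^sup>2" for x y :: real
      using zero_le_power2[of "x - y"] by (simp add: power2_sum power2_diff)
    then show "(?S ?A \<omega> + ?S ?B \<omega>)\<^sup>2 \<le> 2 * (?S ?A \<omega>)\<^sup>2 + 2 * (?S ?B \<omega>)\<^sup>2" for \<omega> .
  qed (use int[OF AB(1)] int[OF AB(2)] in auto)
  also have "\<dots> = 2 * expectation (\<lambda>\<omega>. (?S ?A \<omega>)\<^sup>2) + 2 * expectation (\<lambda>\<omega>. (?S ?B \<omega>)\<^sup>2)"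
    using int[OF AB(1)] int[OF AB(2)] by simp
  also have "\<dots> \<le> 2 * (4 * real (card ?A)) + 2 * (4 * real (card ?B))"
    by (intro add_mono mult_left_mono q_sum_square AB) auto
  also have "\<dots> = 8 * (real n * (real n - 1))" using cards by simp
  finally show ?thesis unfolding split .
qed

lemma q_row_square:
  assumes "i \<in> {1..n}"
  shows "expectation (\<lambda>\<omega>. (\<Sum>j\<in>{1..n}-{i}. q \<delta> (Y i \<omega>) (Y j \<omega>))\<^sup>2) \<le> 4 * (real n - 1)"
proof -
  let ?A = "Pair i ` ({1..n} - {i})"
  have "card ?A = n - 1" using assms by (simp add: card_image inj_on_def)
  moreover have "expectation (\<lambda>\<omega>. (\<Sum>(k, j)\<in>?A. q \<delta> (Y k \<omega>) (Y j \<omega>))\<^sup>2) \<le> 4 * real (card ?A)"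
    using assms by (intro q_sum_square) auto
  moreover have "(\<Sum>(k, j)\<in>?A. q \<delta> (Y k \<omega>) (Y j \<omega>)) = (\<Sum>j\<in>{1..n}-{i}. q \<delta> (Y i \<omega>) (Y j \<omega>))" for \<omega>
    by (subst sum.reindex) (auto simp: inj_on_def)
  ultimately show ?thesis using n_ge_2 by (simp add: of_nat_diff)
qed

lemma g_diff_sum_square:
  "expectation (\<lambda>\<omega>. (\<Sum>i\<in>{1..n}. g \<delta> (Y i \<omega>) - g 0 (Y i \<omega>))\<^sup>2) \<le> n * (4 * B * \<bar>\<delta>\<bar>)\<^sup>2"
proof -
  have int: "integrable D (g \<epsilon>)" for \<epsilon>
    by (rule D.integrable_bounded[of _ 1]) (auto simp: g_bound)
  have "(\<integral>x. g \<delta> x - g 0 x \<partial>D) = 0"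
    using int[of \<delta>] int[of 0] g_integral[of \<delta>] g_integral[of 0] by simp
  from g_orthogonal[OF _ _ _ _ g_diff this]
  have "expectation (\<lambda>\<omega>. (\<Sum>i\<in>{1..n}. g \<delta> (Y i \<omega>) - g 0 (Y i \<omega>))\<^sup>2) \<le> real (card {1..n}) * (4 * B * \<bar>\<delta>\<bar>)\<^sup>2"
    by (intro expectation_square_sum_orthogonal_le) (auto intro: g_diff)
  then show ?thesis by simp
qed

text \<open>The nonlinear Berry--Esseen bound with \<open>T = z - \<surd>n (U\<^sub>n(\<theta> + \<delta>) - 1/2) / (2 s) = W + \<Delta>\<close>; here \<open>T \<le> z\<close> is the
event in question. In \<open>\<Delta> = c - E - \<kappa> Q\<close> the constant \<open>c\<close> is the Taylor remainder, \<open>E\<close> the effect of moving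
the linear term from \<open>0\<close> to \<open>\<delta>\<close>, and \<open>\<kappa> Q\<close> the degenerate part. Dropping the terms that involve
observation \<open>i\<close> gives \<open>\<Delta>'\<^sub>i\<close>. The \<open>L\<^sup>2\<close> norm of \<open>\<Delta>\<close> is at most \<open>K (1 + z\<^sup>2) / \<surd>n\<close> and that of \<open>\<Delta> - \<Delta>'\<^sub>i\<close> at most
\<open>K (1 + z\<^sup>2) / n\<close>; with \<open>n\<close> summands of norm \<open>1/\<surd>n\<close>, Cauchy--Schwarz bounds both error terms
by \<open>K (1 + z\<^sup>2) / \<surd>n\<close>.\<close>
lemma normal_approximation:
  fixes z \<sigma> L A K :: real
  defines "\<sigma> \<equiv> 2 * s / L" and "\<delta> \<equiv> z * \<sigma> / sqrt n"
    and "K \<equiv> sqrt (3 * (A\<^sup>2 * \<sigma> ^ 4 + 16 * B\<^sup>2 * \<sigma>\<^sup>2 + 8)) / s"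
  assumes "L > 0" "A \<ge> 0"
    and taylor: "\<bar>H \<delta> - 1 / 2 - L * \<delta>\<bar> \<le> A * \<delta>\<^sup>2"
  shows "\<bar>prob {\<omega> \<in> space M. empirical_walsh_cdf n (\<lambda>i. Y i \<omega>) \<delta> \<ge> 1 / 2} - \<Phi> z\<bar>
    \<le> (2 * K + 74 / s) * (1 + z\<^sup>2) / sqrt n"
proof -
  let ?I = "{1..n}"
  define N where "N = sqrt (real n)"
  define m where "m = real n - 1"
  define r where "r = 1 + z\<^sup>2"
  have N: "N > 0" "N\<^sup>2 = real n" "N * N = real n" using n_ge_2 by (auto simp: N_def)
  have m: "m \<ge> 1" "real n \<le> 2 * m" "real n > 0" using n_ge_2 by (auto simp: m_def)
  have r: "r \<ge> 1" "z\<^sup>2 \<le> r" by (auto simp: r_def)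
  have r2: "1 \<le> r\<^sup>2" "z\<^sup>2 \<le> r\<^sup>2"
    using r power_increasing[of 1 2 r] by auto
  have B_nonneg: "B \<ge> 0" using cdf_lipschitz[of 1 0] by simp
  have K_sq: "K\<^sup>2 = 3 * (A\<^sup>2 * \<sigma> ^ 4 + 16 * B\<^sup>2 * \<sigma>\<^sup>2 + 8) / s\<^sup>2"
    by (simp add: K_def power_divide)
  have K_pos: "K > 0"
    unfolding K_def using s_pos by (intro divide_pos_pos real_sqrt_gt_zero mult_pos_pos add_nonneg_pos) auto
  have \<delta>_sq: "\<delta>\<^sup>2 = z\<^sup>2 * \<sigma>\<^sup>2 / n" by (simp add: \<delta>_def power_divide power_mult_distrib)
  define c where "c = z - N * (H \<delta> - 1 / 2) / (2 * s)"
  define e where "e x = (g \<delta> x - g 0 x) / (s * N)" for x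
  define \<kappa> where "\<kappa> = 1 / (2 * s * N * m)"
  define Q where "Q \<omega> = (\<Sum>i\<in>?I. \<Sum>j\<in>?I-{i}. q \<delta> (Y i \<omega>) (Y j \<omega>))" for \<omega>
  define R where "R i \<omega> = (\<Sum>j\<in>?I-{i}. q \<delta> (Y i \<omega>) (Y j \<omega>))" for i \<omega>
  define E where "E \<omega> = (\<Sum>i\<in>?I. e (Y i \<omega>))" for \<omega>
  define \<Delta> where "\<Delta> \<omega> = c - E \<omega> - \<kappa> * Q \<omega>" for \<omega>
  define rest where "rest i y = c - (\<Sum>j\<in>?I-{i}. e (y j))
      - \<kappa> * (\<Sum>j\<in>?I-{i}. \<Sum>k\<in>?I-{i}-{j}. q \<delta> (y j) (y k))" for i and y :: "nat \<Rightarrow> real"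
  define \<Delta>' where "\<Delta>' i \<omega> = rest i (\<lambda>j. Y j \<omega>)" for i \<omega>
  have [measurable]: "e \<in> borel_measurable borel" unfolding e_def[abs_def] by measurable
  have [measurable]: "E \<in> borel_measurable M" unfolding E_def[abs_def] by measurable
  have [measurable]: "Q \<in> borel_measurable M"
    unfolding Q_def[abs_def] by (intro borel_measurable_sum q_measurable rv_Y) auto
  have R_meas [measurable]: "R i \<in> borel_measurable M" if "i \<in> ?I" for i
    unfolding R_def[abs_def] using that by (intro borel_measurable_sum q_measurable rv_Y) auto
  have [measurable]: "\<Delta> \<in> borel_measurable M" unfolding \<Delta>_def[abs_def] by measurable
  have e_bd: "\<bar>e x\<bar> \<le> 4 * B * \<bar>\<delta>\<bar> / (s * N)" for x
    unfolding e_def using g_diff[of \<delta> x] s_pos N by (simp add: abs_divide divide_right_mono)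
  have sum_bd: "\<bar>\<Sum>j\<in>S. x j\<bar> \<le> real n * b" if "S \<subseteq> ?I" "\<And>j. \<bar>x j\<bar> \<le> b"
    for S b and x :: "nat \<Rightarrow> real"
  proof -
    have "\<bar>\<Sum>j\<in>S. x j\<bar> \<le> real (card S) * b"
      using that(2) by (intro order_trans[OF sum_abs] sum_bounded_above)
    also have "\<dots> \<le> real n * b"
      using card_mono[of ?I S] that(1) order_trans[OF abs_ge_zero that(2)] by (intro mult_right_mono) auto
    finally show ?thesis .
  qed
  \<comment> \<open>The bound \<open>b\<close> only serves integrability; the rate comes from the second moments.\<close>
  define be where "be = 4 * B * \<bar>\<delta>\<bar> / (s * N)"
  define b where "b = \<bar>c\<bar> + n * be + \<bar>\<kappa>\<bar> * (real n * (real n * 2))"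
  have comb: "\<bar>c - x - \<kappa> * y\<bar> \<le> b" if "\<bar>x\<bar> \<le> n * be" "\<bar>y\<bar> \<le> real n * (real n * 2)" for x y :: real
  proof -
    have "\<bar>c - x - \<kappa> * y\<bar> \<le> \<bar>c\<bar> + \<bar>x\<bar> + \<bar>\<kappa> * y\<bar>" by linarith
    also have "\<bar>\<kappa> * y\<bar> \<le> \<bar>\<kappa>\<bar> * (real n * (real n * 2))"
      unfolding abs_mult using that(2) by (rule mult_left_mono) simp
    finally show ?thesis using that(1) by (simp add: b_def)
  qed
  have E_bd: "\<bar>E \<omega>\<bar> \<le> n * be" for \<omega>
    unfolding E_def be_def by (intro sum_bd e_bd) simp
  have Q_bd: "\<bar>Q \<omega>\<bar> \<le> real n * (real n * 2)" for \<omega>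
    unfolding Q_def by (intro sum_bd q_bound) auto
  have R_bd: "\<bar>R i \<omega>\<bar> \<le> real n * 2" for i \<omega>
    unfolding R_def by (intro sum_bd q_bound) auto
  have \<Delta>_bd: "\<bar>\<Delta> \<omega>\<bar> \<le> b" for \<omega>
    unfolding \<Delta>_def by (intro comb E_bd Q_bd)
  have \<Delta>'_bd: "\<bar>\<Delta>' i \<omega>\<bar> \<le> b" for i \<omega>
  proof -
    have "\<bar>\<Sum>j\<in>?I-{i}. e (Y j \<omega>)\<bar> \<le> n * be"
      unfolding be_def by (intro sum_bd e_bd) auto
    moreover have "\<bar>\<Sum>j\<in>?I-{i}. \<Sum>k\<in>?I-{i}-{j}. q \<delta> (Y j \<omega>) (Y k \<omega>)\<bar> \<le> real n * (real n * 2)"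
      by (intro sum_bd q_bound) auto
    ultimately show ?thesis unfolding \<Delta>'_def rest_def by (rule comb)
  qed
  note sqi = square_integrable_bounded
  have E_sq: "expectation (\<lambda>\<omega>. (E \<omega>)\<^sup>2) \<le> 16 * B\<^sup>2 * \<sigma>\<^sup>2 * z\<^sup>2 / (s\<^sup>2 * n)"
  proof -
    have "E \<omega> = (\<Sum>i\<in>?I. g \<delta> (Y i \<omega>) - g 0 (Y i \<omega>)) / (s * N)" for \<omega>
      by (simp add: E_def e_def sum_divide_distrib)
    then have "expectation (\<lambda>\<omega>. (E \<omega>)\<^sup>2)
        = expectation (\<lambda>\<omega>. (\<Sum>i\<in>?I. g \<delta> (Y i \<omega>) - g 0 (Y i \<omega>))\<^sup>2) / (s * N)\<^sup>2"
      by (simp add: power_divide)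
    also have "\<dots> \<le> n * (4 * B * \<bar>\<delta>\<bar>)\<^sup>2 / (s * N)\<^sup>2"
      by (intro divide_right_mono g_diff_sum_square) simp
    also have "\<dots> = 16 * B\<^sup>2 * \<sigma>\<^sup>2 * z\<^sup>2 / (s\<^sup>2 * n)"
      using m(3) s_pos by (simp add: power_mult_distrib N \<delta>_sq)
    finally show ?thesis .
  qed
  have \<kappa>_sq: "\<kappa>\<^sup>2 = 1 / (4 * s\<^sup>2 * n * m\<^sup>2)"
    by (simp add: \<kappa>_def power_divide power_mult_distrib N)
  have Q_sq: "\<kappa>\<^sup>2 * expectation (\<lambda>\<omega>. (Q \<omega>)\<^sup>2) \<le> 8 / (s\<^sup>2 * n)"
  proof -
    have "\<kappa>\<^sup>2 * expectation (\<lambda>\<omega>. (Q \<omega>)\<^sup>2) \<le> \<kappa>\<^sup>2 * (8 * (n * m))"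
      unfolding Q_def m_def by (intro mult_left_mono q_double_sum_square) simp
    also have "\<dots> = 2 / (s\<^sup>2 * m)"
      unfolding \<kappa>_sq using m s_pos by (simp add: power2_eq_square)
    also have "\<dots> \<le> 8 / (s\<^sup>2 * n)"
      using m s_pos by (simp add: field_simps)
    finally show ?thesis .
  qed
  have c_sq: "c\<^sup>2 \<le> A\<^sup>2 * \<sigma> ^ 4 * r\<^sup>2 / (s\<^sup>2 * n)"
  proof -
    \<comment> \<open>The choice of \<open>\<sigma>\<close> makes the linear part of \<open>H\<close> cancel \<open>z\<close>.\<close>
    have "N * (L * \<delta>) / (2 * s) = z"
      using \<open>L > 0\<close> s_pos N by (simp add: \<delta>_def \<sigma>_def flip: N_def)
    then have "c = - (N / (2 * s)) * (H \<delta> - 1 / 2 - L * \<delta>)"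
      unfolding c_def by (simp add: right_diff_distrib diff_divide_distrib)
    then have "\<bar>c\<bar> = N / (2 * s) * \<bar>H \<delta> - 1 / 2 - L * \<delta>\<bar>"
      using N s_pos by (simp add: abs_mult)
    also have "\<dots> \<le> N / (2 * s) * (A * \<delta>\<^sup>2)"
      using taylor N s_pos by (intro mult_left_mono) auto
    also have "\<dots> = A * \<sigma>\<^sup>2 * z\<^sup>2 / (2 * s * N)"
      using N(1) s_pos unfolding \<delta>_sq N(2)[symmetric] by (simp add: power2_eq_square ac_simps)
    also have "\<dots> \<le> A * \<sigma>\<^sup>2 * r / (s * N)"
      using N s_pos \<open>A \<ge> 0\<close> r by (intro frac_le mult_left_mono) auto
    finally have "c\<^sup>2 \<le> (A * \<sigma>\<^sup>2 * r / (s * N))\<^sup>2"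
      by (rule power2_le_iff_abs_le[THEN iffD2, rotated]) (use N s_pos \<open>A \<ge> 0\<close> r in auto)
    then show ?thesis by (simp add: power_divide power_mult_distrib N flip: power_mult)
  qed
  have \<Delta>_sq: "expectation (\<lambda>\<omega>. (\<Delta> \<omega>)\<^sup>2) \<le> (K * r / N)\<^sup>2"
  proof -
    have int: "integrable M (\<lambda>\<omega>. (E \<omega>)\<^sup>2)" "integrable M (\<lambda>\<omega>. (Q \<omega>)\<^sup>2)"
      by (rule sqi[OF _ E_bd] sqi[OF _ Q_bd]; measurable)+
    have "expectation (\<lambda>\<omega>. (\<Delta> \<omega>)\<^sup>2) \<le> expectation (\<lambda>\<omega>. 3 * c\<^sup>2 + 3 * (E \<omega>)\<^sup>2 + 3 * (\<kappa>\<^sup>2 * (Q \<omega>)\<^sup>2))"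
    proof (rule integral_mono')
      fix \<omega>
      have "0 \<le> (c + E \<omega>)\<^sup>2 + (c + \<kappa> * Q \<omega>)\<^sup>2 + (E \<omega> - \<kappa> * Q \<omega>)\<^sup>2" by simp
      then show "(\<Delta> \<omega>)\<^sup>2 \<le> 3 * c\<^sup>2 + 3 * (E \<omega>)\<^sup>2 + 3 * (\<kappa>\<^sup>2 * (Q \<omega>)\<^sup>2)"
        unfolding \<Delta>_def by (simp add: power2_eq_square algebra_simps)
    qed (use int in auto)
    also have "\<dots> = 3 * c\<^sup>2 + 3 * expectation (\<lambda>\<omega>. (E \<omega>)\<^sup>2) + 3 * (\<kappa>\<^sup>2 * expectation (\<lambda>\<omega>. (Q \<omega>)\<^sup>2))"
      using int by (simp add: prob_space)
    also have "\<dots> \<le> 3 * (A\<^sup>2 * \<sigma> ^ 4 * r\<^sup>2 / (s\<^sup>2 * n)) + 3 * (16 * B\<^sup>2 * \<sigma>\<^sup>2 * r\<^sup>2 / (s\<^sup>2 * n)) + 3 * (8 * r\<^sup>2 / (s\<^sup>2 * n))"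
    proof (intro add_mono mult_left_mono c_sq order_trans[OF E_sq] order_trans[OF Q_sq])
      show "16 * B\<^sup>2 * \<sigma>\<^sup>2 * z\<^sup>2 / (s\<^sup>2 * n) \<le> 16 * B\<^sup>2 * \<sigma>\<^sup>2 * r\<^sup>2 / (s\<^sup>2 * n)"
        using r2 by (intro divide_right_mono mult_left_mono) auto
      show "8 / (s\<^sup>2 * n) \<le> 8 * r\<^sup>2 / (s\<^sup>2 * n)"
        using r2 by (intro divide_right_mono) auto
    qed auto
    also have "\<dots> = K\<^sup>2 * r\<^sup>2 / n"
      unfolding K_sq by (simp add: algebra_simps add_divide_distrib)
    finally show ?thesis by (simp add: power_divide power_mult_distrib N)
  qed
  have diff: "\<Delta> \<omega> - \<Delta>' i \<omega> = - e (Y i \<omega>) - 2 * \<kappa> * R i \<omega>" if "i \<in> ?I" for i \<omega>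
  proof -
    have "E \<omega> = e (Y i \<omega>) + (\<Sum>j\<in>?I-{i}. e (Y j \<omega>))"
      unfolding E_def using that by (intro sum.remove) auto
    moreover have "Q \<omega> = (\<Sum>j\<in>?I-{i}. \<Sum>k\<in>?I-{i}-{j}. q \<delta> (Y j \<omega>) (Y k \<omega>)) + R i \<omega> + R i \<omega>"
      unfolding Q_def R_def using that
      by (subst double_sum_leave_one_out[of _ i]) (auto simp: q_sym[of \<delta> _ "Y i \<omega>"])
    ultimately show ?thesis
      unfolding \<Delta>_def \<Delta>'_def rest_def by (simp add: algebra_simps)
  qed
  have diff_sq: "expectation (\<lambda>\<omega>. (\<Delta> \<omega> - \<Delta>' i \<omega>)\<^sup>2) \<le> (K * r / n)\<^sup>2" if i: "i \<in> ?I" for i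
  proof -
    have int: "integrable M (\<lambda>\<omega>. (R i \<omega>)\<^sup>2)"
      by (rule sqi[OF R_meas[OF i] R_bd])
    have "expectation (\<lambda>\<omega>. (\<Delta> \<omega> - \<Delta>' i \<omega>)\<^sup>2) \<le> expectation (\<lambda>\<omega>. 2 * be\<^sup>2 + 8 * (\<kappa>\<^sup>2 * (R i \<omega>)\<^sup>2))"
    proof (rule integral_mono')
      fix \<omega>
      have "(e (Y i \<omega>))\<^sup>2 \<le> be\<^sup>2"
        unfolding be_def by (rule power2_le_iff_abs_le[THEN iffD2]) (use e_bd order_trans[OF abs_ge_zero e_bd] in auto)
      moreover have "0 \<le> (e (Y i \<omega>) - 2 * \<kappa> * R i \<omega>)\<^sup>2" by simp
      ultimately show "(\<Delta> \<omega> - \<Delta>' i \<omega>)\<^sup>2 \<le> 2 * be\<^sup>2 + 8 * (\<kappa>\<^sup>2 * (R i \<omega>)\<^sup>2)"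
        unfolding diff[OF i] by (simp add: power2_eq_square algebra_simps)
    qed (use int in auto)
    also have "\<dots> = 2 * be\<^sup>2 + 8 * (\<kappa>\<^sup>2 * expectation (\<lambda>\<omega>. (R i \<omega>)\<^sup>2))"
      using int by (simp add: prob_space)
    also have "\<dots> \<le> 2 * be\<^sup>2 + 8 * (\<kappa>\<^sup>2 * (4 * m))"
      unfolding R_def m_def by (intro add_left_mono mult_left_mono q_row_square i) auto
    also have "2 * be\<^sup>2 = 32 * B\<^sup>2 * \<sigma>\<^sup>2 * z\<^sup>2 / (s\<^sup>2 * n\<^sup>2)"
      unfolding be_def by (simp add: power_divide power_mult_distrib N \<delta>_sq power2_eq_square[of "real n"] ac_simps)
    also have "8 * (\<kappa>\<^sup>2 * (4 * m)) = 8 / (s\<^sup>2 * n * m)"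
      unfolding \<kappa>_sq using m s_pos by (simp add: power2_eq_square)
    also have "8 / (s\<^sup>2 * n * m) \<le> 16 / (s\<^sup>2 * n\<^sup>2)"
      using m s_pos by (simp add: field_simps power2_eq_square)
    also have "32 * B\<^sup>2 * \<sigma>\<^sup>2 * z\<^sup>2 / (s\<^sup>2 * n\<^sup>2) + 16 / (s\<^sup>2 * n\<^sup>2)
        \<le> 48 * B\<^sup>2 * \<sigma>\<^sup>2 * r\<^sup>2 / (s\<^sup>2 * n\<^sup>2) + 24 * r\<^sup>2 / (s\<^sup>2 * n\<^sup>2)"
      using r2 by (intro add_mono divide_right_mono mult_mono) auto
    also have "\<dots> \<le> K\<^sup>2 * r\<^sup>2 / n\<^sup>2"
    proof -
      have "(48 * B\<^sup>2 * \<sigma>\<^sup>2 + 24) / s\<^sup>2 \<le> K\<^sup>2"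
        unfolding K_sq by (intro divide_right_mono) auto
      then have "(48 * B\<^sup>2 * \<sigma>\<^sup>2 + 24) / s\<^sup>2 * (r\<^sup>2 / n\<^sup>2) \<le> K\<^sup>2 * (r\<^sup>2 / n\<^sup>2)"
        by (rule mult_right_mono) simp
      then show ?thesis by (simp add: algebra_simps add_divide_distrib)
    qed
    finally show ?thesis by (simp add: power_divide power_mult_distrib)
  qed
  have \<Delta>'_meas [measurable]: "\<Delta>' i \<in> borel_measurable M" if i: "i \<in> ?I" for i
  proof -
    have "\<Delta>' i \<omega> = \<Delta> \<omega> + e (Y i \<omega>) + 2 * \<kappa> * R i \<omega>" for \<omega> using diff[OF i, of \<omega>] by simp
    then have "\<Delta>' i = (\<lambda>\<omega>. \<Delta> \<omega> + e (Y i \<omega>) + 2 * \<kappa> * R i \<omega>)" by blast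
    then show ?thesis using i by simp
  qed
  have ind: "indep_var borel (\<eta> i) borel (\<lambda>\<omega>. h (lin.W \<omega> - \<eta> i \<omega>, \<Delta>' i \<omega>))"
    if i: "i \<in> ?I" and [measurable]: "h \<in> borel_measurable (borel \<Otimes>\<^sub>M borel)" for i and h :: "real \<times> real \<Rightarrow> real"
  proof -
    let ?J = "?I - {i}"
    define w where "w x = - g 0 x / (s * sqrt n)" for x
    have [measurable]: "w \<in> borel_measurable borel" unfolding w_def[abs_def] by measurable
    define G where "G y = h (\<Sum>j\<in>?J. w (y j), rest i y)" for y
    have comp: "(\<lambda>y. y j) \<in> borel_measurable (PiM ?J (\<lambda>_. borel))" if "j \<in> ?J" for j
      using that by (rule measurable_component_singleton)
    have comp_e: "(\<lambda>y. e (y j)) \<in> borel_measurable (PiM ?J (\<lambda>_. borel))" if "j \<in> ?J" for j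
      by (rule measurable_compose[OF comp[OF that]]) measurable
    have [measurable]: "rest i \<in> borel_measurable (PiM ?J (\<lambda>_. borel))"
      unfolding rest_def[abs_def]
      by (intro borel_measurable_diff borel_measurable_const borel_measurable_times borel_measurable_sum
          q_measurable comp comp_e) auto
    have "G \<in> borel_measurable (PiM ?J (\<lambda>_. borel))"
      unfolding G_def[abs_def] by measurable
    from indep_var_rest[OF indep_Y i this]
    have "indep_var borel (Y i) borel (\<lambda>\<omega>. G (restrict (\<lambda>j. Y j \<omega>) ?J))" .
    moreover have "G (restrict (\<lambda>j. Y j \<omega>) ?J) = h (lin.W \<omega> - \<eta> i \<omega>, \<Delta>' i \<omega>)" for \<omega>
    proof -
      have "lin.W \<omega> - \<eta> i \<omega> = (\<Sum>j\<in>?J. w (Y j \<omega>))"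
        using i unfolding lin.W_def by (simp add: sum_diff1 \<eta>_def w_def)
      moreover have "rest i (restrict (\<lambda>j. Y j \<omega>) ?J) = \<Delta>' i \<omega>"
        unfolding \<Delta>'_def rest_def by simp
      ultimately show ?thesis by (simp add: G_def)
    qed
    ultimately have "indep_var borel (Y i) borel (\<lambda>\<omega>. h (lin.W \<omega> - \<eta> i \<omega>, \<Delta>' i \<omega>))" by simp
    then have "indep_var borel (w \<circ> Y i) borel ((\<lambda>x. x) \<circ> (\<lambda>\<omega>. h (lin.W \<omega> - \<eta> i \<omega>, \<Delta>' i \<omega>)))"
      by (rule indep_var_compose) measurable
    moreover have "w \<circ> Y i = \<eta> i" by (simp add: fun_eq_iff w_def \<eta>_def)
    ultimately show ?thesis by (simp only: comp_def)
  qed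
  have event: "lin.W \<omega> + \<Delta> \<omega> \<le> z \<longleftrightarrow> empirical_walsh_cdf n (\<lambda>i. Y i \<omega>) \<delta> \<ge> 1 / 2" for \<omega>
  proof -
    let ?G = "\<Sum>i\<in>?I. g \<delta> (Y i \<omega>)" and ?U = "empirical_walsh_cdf n (\<lambda>i. Y i \<omega>) \<delta>"
    have "lin.W \<omega> - E \<omega> = (\<Sum>i\<in>?I. \<eta> i \<omega> - e (Y i \<omega>))"
      unfolding lin.W_def E_def by (simp only: sum_subtractf)
    also have "\<dots> = (\<Sum>i\<in>?I. - (g \<delta> (Y i \<omega>) / (s * N)))"
      by (intro sum.cong) (simp_all add: \<eta>_def e_def N_def diff_divide_distrib)
    also have "\<dots> = - (?G / (s * N))"
      by (simp only: sum_negf sum_divide_distrib)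
    finally have "lin.W \<omega> - E \<omega> = - (?G / (s * N))" .
    then have "lin.W \<omega> + \<Delta> \<omega> = c - ?G / (s * N) - \<kappa> * Q \<omega>" by (simp add: \<Delta>_def)
    also have "\<dots> = z - N / (2 * s) * (?U - 1 / 2)"
    proof -
      have U: "?U = H \<delta> + 2 / (N * N) * ?G + Q \<omega> / (N * N * m)"
        unfolding hoeffding_decomposition Q_def m_def N(3) by simp
      show ?thesis unfolding U c_def \<kappa>_def using N(1) m(1) s_pos by (simp add: field_simps)
    qed
    finally have "lin.W \<omega> + \<Delta> \<omega> = z - N / (2 * s) * (?U - 1 / 2)" .
    moreover have "N / (2 * s) > 0" using N s_pos by simp
    from mult_le_cancel_left_pos[OF this, of 0 "?U - 1 / 2"]
    have "0 \<le> N / (2 * s) * (?U - 1 / 2) \<longleftrightarrow> 1 / 2 \<le> ?U" by (simp only: mult_zero_right le_diff_eq add_0)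
    ultimately show ?thesis by linarith
  qed
  have "\<bar>prob {\<omega> \<in> space M. lin.W \<omega> + \<Delta> \<omega> \<le> z} - \<Phi> z\<bar>
      \<le> expectation (\<lambda>\<omega>. \<bar>lin.W \<omega> * \<Delta> \<omega>\<bar>)
        + (\<Sum>i\<in>?I. expectation (\<lambda>\<omega>. \<bar>\<eta> i \<omega> * (\<Delta> \<omega> - \<Delta>' i \<omega>)\<bar>)) + 74 * (1 / (s * sqrt n))"
    by (rule lin.nonlinear_berry_esseen[OF _ ind \<Delta>_bd \<Delta>'_bd]) measurable
  also have "\<dots> \<le> 1 * (K * r / N) + (\<Sum>i\<in>?I. 1 / N * (K * r / n)) + 74 * (r / (s * N))"
  proof (intro add_mono sum_mono mult_left_mono)
    show "expectation (\<lambda>\<omega>. \<bar>lin.W \<omega> * \<Delta> \<omega>\<bar>) \<le> 1 * (K * r / N)"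
      by (rule expectation_abs_mult_le[OF lin.rv_W _ lin.integrable_W_square sqi[OF _ \<Delta>_bd]])
        (use \<Delta>_sq lin.expectation_W_square K_pos r N in auto)
    fix i assume i: "i \<in> ?I"
    have int: "integrable M (\<lambda>\<omega>. (\<Delta> \<omega> - \<Delta>' i \<omega>)\<^sup>2)"
    proof (rule sqi)
      show "\<bar>\<Delta> \<omega> - \<Delta>' i \<omega>\<bar> \<le> 2 * b" for \<omega> using \<Delta>_bd[of \<omega>] \<Delta>'_bd[of i \<omega>] by linarith
    qed (use i in measurable)
    show "expectation (\<lambda>\<omega>. \<bar>\<eta> i \<omega> * (\<Delta> \<omega> - \<Delta>' i \<omega>)\<bar>) \<le> 1 / N * (K * r / n)"
    proof (rule expectation_abs_mult_le[OF _ _ lin.integrable_\<eta>_square[OF i] int _ diff_sq[OF i]])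
      show "expectation (\<lambda>\<omega>. (\<eta> i \<omega>)\<^sup>2) \<le> (1 / N)\<^sup>2" by (simp add: \<eta>_square[OF i] power_divide N)
      show "1 / N > 0" "K * r / n > 0" using N K_pos r m by auto
    qed (use i in measurable)
  next
    show "1 / (s * sqrt n) \<le> r / (s * N)"
      unfolding N_def[symmetric] using r N s_pos by (intro divide_right_mono) auto
  qed simp
  also have "\<dots> = (2 * K + 74 / s) * r / N"
    using m(3) N(1) s_pos by (simp add: field_simps)
  finally show ?thesis unfolding event N_def r_def .
qed

end

section \<open>Regularity of the law and the uniform bound\<close>

lemma cdf_density_lipschitz:
  fixes f :: "real \<Rightarrow> real"
  assumes D: "real_distribution D" "D = density lborel (\<lambda>t. ennreal (f t))"
    and [measurable]: "(\<lambda>t. ennreal (f t)) \<in> borel_measurable lborel"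
    and f: "\<And>t. f t \<le> B" and "B \<ge> 0"
  shows "\<bar>cdf D x - cdf D y\<bar> \<le> B * \<bar>x - y\<bar>"
proof -
  interpret D: real_distribution D by fact
  have le: "cdf D v - cdf D u \<le> B * (v - u)" if "u < v" for u v
  proof -
    have "emeasure D {u<..v} = (\<integral>\<^sup>+t. ennreal (f t) * indicator {u<..v} t \<partial>lborel)"
      unfolding D(2) by (subst emeasure_density) auto
    also have "\<dots> \<le> (\<integral>\<^sup>+t. ennreal B * indicator {u<..v} t \<partial>lborel)"
      by (intro nn_integral_mono mult_right_mono ennreal_leI f) auto
    also have "\<dots> = ennreal (B * (v - u))"
      using that \<open>B \<ge> 0\<close> by (simp add: nn_integral_cmult_indicator ennreal_mult)
    finally have "measure D {u<..v} \<le> B * (v - u)"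
      using that \<open>B \<ge> 0\<close> by (simp add: measure_def enn2real_leI)
    then show ?thesis using D.cdf_diff_eq[OF that] by simp
  qed
  show ?thesis
    using le[of x y] le[of y x] D.cdf_nondecreasing[of x y] D.cdf_nondecreasing[of y x]
    by (cases x y rule: linorder_cases) auto
qed

lemma (in prob_space) ex_of_AE_positive_prob:
  assumes "AE x in M. P x" "A \<in> events" "prob A > 0"
  shows "\<exists>x\<in>A. P x"
proof (rule ccontr)
  assume "\<not> (\<exists>x\<in>A. P x)"
  then have "AE x in M. x \<notin> A" using assms(1) by (auto elim: eventually_mono)
  then have "prob A = 0" using assms(2) by (simp add: prob_eq_0)
  with assms(3) show False by simp
qed

text \<open>Suppose \<open>F(-x) = 1/2\<close> for almost all \<open>x\<close>. If \<open>F(a) = 1/2\<close>, both sides of \<open>a\<close> carry mass, so there are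
points \<open>x \<le> a < y\<close> with \<open>F(-x) = F(-y) = 1/2\<close>, and \<open>F(-a) = 1/2\<close> by monotonicity. Hence \<open>F(x) = 1/2\<close> for
almost all \<open>x\<close>, which is absurd: the points \<open>x \<le> u\<close> with \<open>F(u) = 1/4\<close> carry mass \<open>1/4\<close>.\<close>
lemma (in real_distribution) variance_cdf_reflection_pos:
  assumes cont: "\<And>x. isCont (cdf M) x"
  shows "(\<integral>x. (cdf M (- x) - 1 / 2)\<^sup>2 \<partial>M) > 0"
proof (rule ccontr)
  let ?F = "cdf M"
  have [measurable]: "?F \<in> borel_measurable borel"
    using cdf_nondecreasing by (intro borel_measurable_mono) (simp add: mono_def)
  have F: "0 \<le> ?F x" "?F x \<le> 1" for x by (rule cdf_nonneg, rule cdf_bounded_prob)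
  have int: "integrable M (\<lambda>x. (?F (- x) - 1 / 2)\<^sup>2)"
  proof (rule square_integrable_bounded[of _ 1])
    show "\<bar>?F (- x) - 1 / 2\<bar> \<le> 1" for x using F[of "- x"] by (simp add: abs_le_iff)
  qed simp
  assume "\<not> ?thesis"
  moreover have "0 \<le> (\<integral>x. (?F (- x) - 1 / 2)\<^sup>2 \<partial>M)" by simp
  ultimately have "(\<integral>x. (?F (- x) - 1 / 2)\<^sup>2 \<partial>M) = 0" by linarith
  then have AE: "AE x in M. ?F (- x) = 1 / 2"
    using integral_nonneg_eq_0_iff_AE[OF int] by simp
  have refl: "?F (- a) = 1 / 2" if "?F a = 1 / 2" for a
  proof -
    have "prob {..a} = 1 / 2" using that by (simp add: cdf_def)
    then obtain x where x: "x \<le> a" "?F (- x) = 1 / 2"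
      using ex_of_AE_positive_prob[OF AE, of "{..a}"] by auto
    have "prob {a<..} = 1 - prob {..a}"
      using prob_compl[of "{..a}"] by (simp add: Compl_eq_Diff_UNIV[symmetric])
    then obtain y where y: "a < y" "?F (- y) = 1 / 2"
      using ex_of_AE_positive_prob[OF AE, of "{a<..}"] \<open>prob {..a} = 1 / 2\<close> by auto
    show ?thesis
      using cdf_nondecreasing[of "- y" "- a"] cdf_nondecreasing[of "- a" "- x"] x y by auto
  qed
  obtain u where u: "?F u = 1 / 4"
  proof -
    have "\<forall>\<^sub>F x in at_bot. ?F x < 1 / 4" using cdf_lim_at_bot by (rule order_tendstoD) simp
    then obtain a where a: "?F a < 1 / 4" by (metis eventually_at_bot_linorder order_refl)
    have "\<forall>\<^sub>F x in at_top. 1 / 4 < ?F x" using cdf_lim_at_top_prob by (rule order_tendstoD) simp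
    then obtain b where b: "1 / 4 < ?F b" by (metis eventually_at_top_linorder order_refl)
    have "a \<le> b" using cdf_nondecreasing[of b a] a b by linarith
    then show ?thesis using IVT[of ?F a "1 / 4" b] a b cont that by (meson less_imp_le)
  qed
  have "prob {..u} > 0" using u by (simp add: cdf_def)
  then obtain x where x: "x \<le> u" "?F (- x) = 1 / 2"
    using ex_of_AE_positive_prob[OF AE, of "{..u}"] by auto
  then have "?F x = 1 / 2" using refl[of "- x"] by simp
  then show False using cdf_nondecreasing[OF x(1)] u by simp
qed

text \<open>Identifies \<open>U\<close> with the function \<open>H\<close> of the Hoeffding decomposition.\<close>
lemma (in prob_space) sum_cdf_eq_convolution:
  assumes ind: "indep_var borel X borel Y" and D: "distr M borel X = D" "distr M borel Y = D"
  shows "prob {\<omega> \<in> space M. X \<omega> + Y \<omega> \<le> c} = (\<integral>x. cdf D (c - x) \<partial>D)"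
proof -
  have [measurable]: "X \<in> borel_measurable M" "Y \<in> borel_measurable M"
    using indep_var_rv1[OF ind] indep_var_rv2[OF ind] by auto
  interpret D: real_distribution D unfolding D(1)[symmetric] by (rule real_distribution_distr) simp
  have [measurable]: "cdf D \<in> borel_measurable borel"
    using D.cdf_nondecreasing by (intro borel_measurable_mono) (simp add: mono_def)
  let ?A = "{\<omega> \<in> space M. X \<omega> + Y \<omega> \<le> c}"
  let ?\<psi> = "\<lambda>p. of_bool (fst p + snd p \<le> c) - cdf D (c - snd p) :: real"
  have F: "0 \<le> cdf D x" "cdf D x \<le> 1" for x by (rule D.cdf_nonneg, rule D.cdf_bounded_prob)
  have "expectation (\<lambda>\<omega>. ?\<psi> (X \<omega>, Y \<omega>)) = 0"
  proof (rule expectation_indep_zero[OF ind, of _ 1])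
    show "\<bar>?\<psi> (x, y)\<bar> \<le> 1" for x y using F[of "c - y"] by (auto simp: of_bool_def)
    fix y :: real
    have "expectation (\<lambda>\<omega>. ?\<psi> (X \<omega>, y)) = expectation (\<lambda>\<omega>. indicator {\<omega> \<in> space M. X \<omega> \<le> c - y} \<omega> - cdf D (c - y))"
      by (intro Bochner_Integration.integral_cong) (auto simp: indicator_def algebra_simps)
    also have "\<dots> = prob {\<omega> \<in> space M. X \<omega> \<le> c - y} - cdf D (c - y)"
      using integrable_indicator_event[of "{\<omega> \<in> space M. X \<omega> \<le> c - y}"] by (simp add: prob_space)
    also have "prob {\<omega> \<in> space M. X \<omega> \<le> c - y} = cdf D (c - y)"
      unfolding D(1)[symmetric] cdf_def by (subst measure_distr) (auto intro!: arg_cong[where f = prob])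
    finally show "expectation (\<lambda>\<omega>. ?\<psi> (X \<omega>, y)) = 0" by simp
  qed measurable
  moreover have "expectation (\<lambda>\<omega>. ?\<psi> (X \<omega>, Y \<omega>)) = expectation (\<lambda>\<omega>. indicator ?A \<omega> - cdf D (c - Y \<omega>))"
    by (intro Bochner_Integration.integral_cong) (auto simp: indicator_def)
  moreover have "\<dots> = prob ?A - expectation (\<lambda>\<omega>. cdf D (c - Y \<omega>))"
    using integrable_indicator_event[of ?A] integrable_bounded[of "\<lambda>\<omega>. cdf D (c - Y \<omega>)" 1] F by simp
  moreover have "expectation (\<lambda>\<omega>. cdf D (c - Y \<omega>)) = (\<integral>x. cdf D (c - x) \<partial>D)"
    by (subst (2) D(2)[symmetric], subst integral_distr) auto
  ultimately show ?thesis by simp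
qed

text \<open>Near \<open>\<theta>\<close> this is Taylor's theorem. As \<open>G\<close> takes values in \<open>[0, 1]\<close>, the expansion at distance \<open>c\<close> also
bounds \<open>G'(\<theta>)\<close>, and for \<open>|\<delta>| > c\<close> every term on the left is dominated by a multiple of \<open>\<delta>\<^sup>2\<close>. A bound
valid for all \<open>\<delta>\<close> spares a separate treatment of small \<open>n\<close>.\<close>
lemma taylor_quadratic_bound:
  fixes G :: "real \<Rightarrow> real"
  assumes "c > 0" "\<kappa> > 0" and nn: "deriv G \<theta> \<ge> 0" and G: "\<And>t. 0 \<le> G t" "\<And>t. G t \<le> 1"
    and near: "abs_deriv2_le_near G \<theta> c \<kappa>"
  shows "\<bar>G (\<theta> + \<delta>) - G \<theta> - deriv G \<theta> * \<delta>\<bar> \<le> (\<kappa> + 1 / c\<^sup>2 + (1 / c + \<kappa> * c) / c) * \<delta>\<^sup>2"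
proof -
  let ?L = "deriv G \<theta>"
  have d1: "(G has_real_derivative deriv G t) (at t)" and d2: "(deriv G has_real_derivative deriv (deriv G) t) (at t)"
    and b2: "\<bar>deriv (deriv G) t\<bar> \<le> \<kappa>" if "\<bar>t - \<theta>\<bar> \<le> c" for t
  proof -
    from near that have *: "\<forall>\<^sub>F u in nhds t. G differentiable (at u)" "deriv G differentiable (at t)"
      "\<bar>deriv (deriv G) t\<bar> \<le> \<kappa>"
      unfolding abs_deriv2_le_near_def by (auto dest!: spec[of _ "t - \<theta>"])
    then show "(G has_real_derivative deriv G t) (at t)" "(deriv G has_real_derivative deriv (deriv G) t) (at t)"
      "\<bar>deriv (deriv G) t\<bar> \<le> \<kappa>"
      by (auto dest: eventually_nhds_x_imp_x simp: DERIV_deriv_iff_real_differentiable)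
  qed
  have near_bound: "\<bar>G (\<theta> + \<delta>) - G \<theta> - ?L * \<delta>\<bar> \<le> \<kappa> * \<delta>\<^sup>2" if "\<bar>\<delta>\<bar> \<le> c" for \<delta>
  proof (cases "\<delta> = 0")
    case False
    define diff where "diff m = (if m = 0 then G else if m = 1 then deriv G else deriv (deriv G))" for m :: nat
    have "\<exists>t. (if \<theta> + \<delta> < \<theta> then \<theta> + \<delta> < t \<and> t < \<theta> else \<theta> < t \<and> t < \<theta> + \<delta>) \<and>
        G (\<theta> + \<delta>) = (\<Sum>m<2. diff m \<theta> / fact m * (\<theta> + \<delta> - \<theta>) ^ m) + diff 2 t / fact 2 * (\<theta> + \<delta> - \<theta>) ^ 2"
    proof (rule Taylor[of 2 diff G "\<theta> - c" "\<theta> + c" \<theta> "\<theta> + \<delta>"])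
      show "\<forall>m t. m < 2 \<and> \<theta> - c \<le> t \<and> t \<le> \<theta> + c \<longrightarrow> (diff m has_real_derivative diff (Suc m) t) (at t)"
        using d1 d2 by (auto simp: diff_def less_2_cases_iff abs_le_iff)
    qed (use that False \<open>c > 0\<close> in \<open>auto simp: diff_def\<close>)
    then obtain t where t: "if \<theta> + \<delta> < \<theta> then \<theta> + \<delta> < t \<and> t < \<theta> else \<theta> < t \<and> t < \<theta> + \<delta>"
      "G (\<theta> + \<delta>) = G \<theta> + ?L * \<delta> + deriv (deriv G) t / 2 * \<delta>\<^sup>2"
      by (auto simp: diff_def numeral_2_eq_2)
    have "\<bar>t - \<theta>\<bar> \<le> c" using t(1) that by (auto split: if_splits)
    then have "\<bar>deriv (deriv G) t / 2\<bar> * \<delta>\<^sup>2 \<le> \<kappa> * \<delta>\<^sup>2"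
      using b2[of t] by (intro mult_right_mono) auto
    then show ?thesis using t(2) by (simp add: abs_mult)
  qed simp
  have L_le: "?L \<le> 1 / c + \<kappa> * c"
  proof -
    have "?L * c \<le> 1 + \<kappa> * c\<^sup>2"
      using near_bound[of c] G(2)[of "\<theta> + c"] G(1)[of \<theta>] \<open>c > 0\<close> by (simp add: abs_le_iff)
    then show ?thesis using \<open>c > 0\<close> by (simp add: field_simps power2_eq_square)
  qed
  show ?thesis
  proof (cases "\<bar>\<delta>\<bar> \<le> c")
    case True
    have "\<kappa> * \<delta>\<^sup>2 \<le> (\<kappa> + 1 / c\<^sup>2 + (1 / c + \<kappa> * c) / c) * \<delta>\<^sup>2"
      using \<open>c > 0\<close> \<open>\<kappa> > 0\<close> by (intro mult_right_mono) auto
    then show ?thesis using near_bound[OF True] by linarith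
  next
    case False
    then have q: "1 \<le> \<bar>\<delta>\<bar> / c" using \<open>c > 0\<close> by (simp add: field_simps)
    have "\<bar>G (\<theta> + \<delta>) - G \<theta> - ?L * \<delta>\<bar> \<le> 1 + ?L * \<bar>\<delta>\<bar>"
    proof -
      have "\<bar>?L * \<delta>\<bar> = ?L * \<bar>\<delta>\<bar>" using nn by (simp add: abs_mult)
      then show ?thesis using G[of "\<theta> + \<delta>"] G[of \<theta>] by linarith
    qed
    also have "\<dots> \<le> (\<bar>\<delta>\<bar> / c)\<^sup>2 + (1 / c + \<kappa> * c) * \<bar>\<delta>\<bar> * (\<bar>\<delta>\<bar> / c)"
    proof (intro add_mono)
      show "1 \<le> (\<bar>\<delta>\<bar> / c)\<^sup>2" using q by (rule one_le_power)
      have "?L * \<bar>\<delta>\<bar> * 1 \<le> (1 / c + \<kappa> * c) * \<bar>\<delta>\<bar> * (\<bar>\<delta>\<bar> / c)"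
        using q L_le nn by (intro mult_mono) auto
      then show "?L * \<bar>\<delta>\<bar> \<le> (1 / c + \<kappa> * c) * \<bar>\<delta>\<bar> * (\<bar>\<delta>\<bar> / c)" by simp
    qed
    also have "\<dots> = (1 / c\<^sup>2 + (1 / c + \<kappa> * c) / c) * \<delta>\<^sup>2"
      by (simp add: power_divide distrib_right power2_eq_square)
    also have "\<dots> \<le> (\<kappa> + 1 / c\<^sup>2 + (1 / c + \<kappa> * c) / c) * \<delta>\<^sup>2"
      using \<open>\<kappa> > 0\<close> by (intro mult_right_mono) auto
    finally show ?thesis .
  qed
qed

lemma empirical_walsh_cdf_shift:
  "empirical_walsh_cdf n (\<lambda>i. \<theta> + x i) (\<theta> + \<delta>) = empirical_walsh_cdf n x \<delta>"
proof -
  have "(\<theta> + a + (\<theta> + b)) / 2 \<le> \<theta> + \<delta> \<longleftrightarrow> (a + b) / 2 \<le> \<delta>" for a b by (simp add: field_simps)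
  then show ?thesis unfolding empirical_walsh_cdf_def by simp
qed

text \<open>The pointwise bound is used up to \<open>z0 = \<surd>(ln n)\<close>, where \<open>1 + z0\<^sup>2 \<le> 3 ln n\<close>. Beyond \<open>z0\<close> monotonicity
compares with the value at \<open>z0\<close>, and \<open>1 - \<Phi>(z0) \<le> 5 \<phi>(z0) \<le> 5 / \<surd>n\<close>.\<close>
lemma kolmogorov_distance_from_window:
  fixes p :: "real \<Rightarrow> real" and n :: nat
  assumes n: "n \<ge> 2" and C: "C \<ge> 0" and mono: "mono p" and p: "\<And>z. 0 \<le> p z" "\<And>z. p z \<le> 1"
    and window: "\<And>z. \<bar>p z - \<Phi> z\<bar> \<le> C * (1 + z\<^sup>2) / sqrt n"
  shows "\<bar>p z - \<Phi> z\<bar> \<le> (3 * C + 10) * ln n / sqrt n"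
proof -
  define z0 where "z0 = sqrt (ln n)"
  have ln2: "ln (real n) \<ge> 1 / 2"
  proof -
    have "1 / 2 \<le> ln (2 :: real)" using ln_le_minus_one[of "1 / 2 :: real"] by (simp add: ln_div)
    also have "\<dots> \<le> ln n" using n by simp
    finally show ?thesis .
  qed
  have sq: "z0\<^sup>2 = ln n" using ln2 by (simp add: z0_def)
  have z0: "z0 \<ge> 0" using ln2 by (simp add: z0_def)
  have sqrt_n: "sqrt n > 0" using n by simp
  let ?e = "3 * C * ln n / sqrt n" and ?t = "5 / sqrt n"
  have inner: "\<bar>p z - \<Phi> z\<bar> \<le> ?e" if "\<bar>z\<bar> \<le> z0" for z
  proof -
    have "z\<^sup>2 \<le> ln n" unfolding sq[symmetric] using that by (simp add: abs_le_square_iff[symmetric])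
    then have "C * (1 + z\<^sup>2) \<le> C * (3 * ln n)" using C ln2 by (intro mult_left_mono) auto
    then have "C * (1 + z\<^sup>2) / sqrt n \<le> C * (3 * ln n) / sqrt n" using sqrt_n by (intro divide_right_mono) auto
    also have "C * (3 * ln n) / sqrt n = ?e" by simp
    finally show ?thesis using window[of z] by linarith
  qed
  have tail: "1 - \<Phi> z0 \<le> ?t"
  proof -
    have "\<phi> z0 \<le> exp (- z0\<^sup>2 / 2)"
    proof -
      have "1 \<le> sqrt (2 * pi)" using pi_gt3 by simp
      then have "exp (- z0\<^sup>2 / 2) / sqrt (2 * pi) \<le> exp (- z0\<^sup>2 / 2) / 1" by (intro divide_left_mono) auto
      then show ?thesis unfolding std_normal_density_def by simp
    qed
    also have "exp (- z0\<^sup>2 / 2) = 1 / sqrt n"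
    proof -
      have "exp (- z0\<^sup>2 / 2) = exp (- ln (sqrt n))" using n by (simp add: sq ln_sqrt)
      then show ?thesis using n by (simp add: exp_minus inverse_eq_divide)
    qed
    finally show ?thesis using std_normal_tail_le_density[OF z0] by simp
  qed
  have t_le: "?e + ?t \<le> (3 * C + 10) * ln n / sqrt n"
  proof -
    have "5 / sqrt n \<le> 10 * ln n / sqrt n" using ln2 sqrt_n by (intro divide_right_mono) auto
    then show ?thesis by (simp add: distrib_right add_divide_distrib)
  qed
  have e_nonneg: "?e \<ge> 0" using C ln2 by simp
  have t_nonneg: "?t \<ge> 0" by simp
  note facts = p[of z] std_normal.cdf_nonneg[of z] std_normal.cdf_bounded_prob[of z] e_nonneg t_nonneg
  have "\<bar>p z - \<Phi> z\<bar> \<le> ?e + ?t"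
  proof (cases "\<bar>z\<bar> \<le> z0")
    case True then show ?thesis using inner[OF True] t_nonneg by linarith
  next
    case False
    show ?thesis
    proof (cases "z > z0")
      case True
      have "p z0 \<le> p z" "\<Phi> z0 \<le> \<Phi> z" using True mono std_normal.cdf_nondecreasing by (auto simp: mono_def)
      then show ?thesis using inner[of z0] tail facts z0 by (auto simp: abs_le_iff)
    next
      case F: False
      then have "z \<le> - z0" using False by auto
      then have "p z \<le> p (- z0)" "\<Phi> z \<le> \<Phi> (- z0)" using mono std_normal.cdf_nondecreasing by (auto simp: mono_def)
      then show ?thesis using inner[of "- z0"] tail facts z0 std_normal_cdf_minus[of z0] by (auto simp: abs_le_iff)
    qed
  qed
  then show ?thesis using t_le by linarith
qed

lemma (in sample) hodges_lehmann_berry_esseen: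
  fixes L A K \<sigma> \<theta> z :: real
  defines "\<sigma> \<equiv> 2 * s / L" and "K \<equiv> sqrt (3 * (A\<^sup>2 * \<sigma> ^ 4 + 16 * B\<^sup>2 * \<sigma>\<^sup>2 + 8)) / s"
  assumes L: "L > 0" and A: "A \<ge> 0"
    and taylor: "\<And>\<delta>. \<bar>H \<delta> - 1 / 2 - L * \<delta>\<bar> \<le> A * \<delta>\<^sup>2"
  shows "\<bar>prob {\<omega> \<in> space M. sqrt n * (hodges_lehmann n (\<lambda>i. \<theta> + Y i \<omega>) - \<theta>) / \<sigma> \<le> z} - \<Phi> z\<bar>
    \<le> (3 * (2 * K + 74 / s) + 10) * ln n / sqrt n"
proof -
  let ?U = "\<lambda>z \<omega>. empirical_walsh_cdf n (\<lambda>i. Y i \<omega>) (z * \<sigma> / sqrt n)"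
  define p where "p z = prob {\<omega> \<in> space M. ?U z \<omega> \<ge> 1 / 2}" for z
  have \<sigma>: "\<sigma> > 0" using L s_pos by (simp add: \<sigma>_def)
  have N: "sqrt n > 0" using n_ge_2 by simp
  have event: "sqrt n * (hodges_lehmann n (\<lambda>i. \<theta> + Y i \<omega>) - \<theta>) / \<sigma> \<le> z \<longleftrightarrow> ?U z \<omega> \<ge> 1 / 2" for z \<omega>
  proof -
    have "sqrt n * (hodges_lehmann n (\<lambda>i. \<theta> + Y i \<omega>) - \<theta>) / \<sigma> \<le> z
        \<longleftrightarrow> hodges_lehmann n (\<lambda>i. \<theta> + Y i \<omega>) \<le> \<theta> + z * \<sigma> / sqrt n"
      using \<sigma> N by (simp add: field_simps)
    then show ?thesis by (simp only: hodges_lehmann_le_iff[OF n_ge_2] empirical_walsh_cdf_shift)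
  qed
  have [measurable]: "(\<lambda>\<omega>. empirical_walsh_cdf n (\<lambda>i. Y i \<omega>) t) \<in> borel_measurable M" for t
    unfolding hoeffding_decomposition
    by (intro borel_measurable_add borel_measurable_divide borel_measurable_times borel_measurable_const
        borel_measurable_sum q_measurable measurable_compose[OF rv_Y g_measurable] rv_Y) auto
  have mono: "mono p"
  proof (rule monoI)
    fix u v :: real assume "u \<le> v"
    then have "u * \<sigma> / sqrt n \<le> v * \<sigma> / sqrt n" using \<sigma> N by (intro divide_right_mono mult_right_mono) auto
    then show "p u \<le> p v"
      unfolding p_def using empirical_walsh_cdf_mono[OF n_ge_2]
      by (intro finite_measure_mono) (auto intro: order_trans)
  qed
  have K: "K \<ge> 0" unfolding K_def using s_pos by (intro divide_nonneg_pos real_sqrt_ge_zero) auto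
  have "\<bar>p z - \<Phi> z\<bar> \<le> (3 * (2 * K + 74 / s) + 10) * ln n / sqrt n"
  proof (rule kolmogorov_distance_from_window[OF n_ge_2 _ mono])
    show "0 \<le> 2 * K + 74 / s" using K s_pos by simp
    show "\<bar>p z - \<Phi> z\<bar> \<le> (2 * K + 74 / s) * (1 + z\<^sup>2) / sqrt n" for z
      unfolding p_def K_def \<sigma>_def by (rule normal_approximation[OF L A taylor])
  qed (auto simp: p_def)
  then show ?thesis unfolding event p_def .
qed

theorem theorem2p2:
  fixes f :: "real \<Rightarrow> real" and \<theta> c\<^sub>0 \<kappa>\<^sub>0 c\<^sub>1 \<kappa>\<^sub>1 :: real
  assumes "c\<^sub>0 > 0" "\<kappa>\<^sub>0 > 0" "c\<^sub>1 > 0" "\<kappa>\<^sub>1 > 0"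
    and "\<And>t. f t \<ge> 0"
    and "bdd_above (range (\<lambda>t. \<bar>f t\<bar>))"
  shows "\<exists>C>0. \<forall>n\<ge>2. \<forall>(M :: 'a measure) (\<xi> :: nat \<Rightarrow> 'a \<Rightarrow> real).
           prob_space M \<longrightarrow>
           prob_space.indep_vars M (\<lambda>_. borel) \<xi> {1..n} \<longrightarrow>
           (\<forall>i\<in>{1..n}. distributed M lborel (\<xi> i) (\<lambda>t. ennreal (f t))) \<longrightarrow>
           is_pseudomedian M \<xi> 0 \<longrightarrow>
           deriv_ge_near (walsh_cdf M (observation \<theta> \<xi>)) \<theta> c\<^sub>0 \<kappa>\<^sub>0 \<longrightarrow>
           abs_deriv2_le_near (walsh_cdf M (observation \<theta> \<xi>)) \<theta> c\<^sub>1 \<kappa>\<^sub>1 \<longrightarrow>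
           (SUP z. \<bar>measure M {\<omega> \<in> space M.
                        sqrt (real n) * (hodges_lehmann n (\<lambda>i. observation \<theta> \<xi> i \<omega>) - \<theta>)
                          / hodges_lehmann_sd M \<theta> \<xi> \<le> z}
                    - cdf std_normal_distribution z\<bar>)
             \<le> C * ln (real n) / sqrt (real n)"
proof -
  \<comment> \<open>All constants are defined from the density before a sample is chosen.\<close>
  obtain B where B: "\<And>t. \<bar>f t\<bar> \<le> B" using assms(6) by (auto simp: bdd_above_def)
  have B_nonneg: "B \<ge> 0" using B[of 0] by linarith
  define D where "D = density lborel (\<lambda>t. ennreal (f t))"
  define s where "s = sqrt (\<integral>x. (cdf D (- x) - 1 / 2)\<^sup>2 \<partial>D)"
  define G where "G t = (\<integral>x. cdf D (2 * (t - \<theta>) - x) \<partial>D)" for t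
  define L where "L = deriv G \<theta>"
  define \<sigma> where "\<sigma> = 2 * s / L"
  define A where "A = \<kappa>\<^sub>1 + 1 / c\<^sub>1\<^sup>2 + (1 / c\<^sub>1 + \<kappa>\<^sub>1 * c\<^sub>1) / c\<^sub>1"
  define K where "K = sqrt (3 * (A\<^sup>2 * \<sigma> ^ 4 + 16 * B\<^sup>2 * \<sigma>\<^sup>2 + 8)) / s"
  define C where "C = 3 * (2 * K + 74 / s) + 10"
  have "s \<ge> 0" by (simp add: s_def)
  then have "K \<ge> 0" unfolding K_def by (intro divide_nonneg_nonneg real_sqrt_ge_zero) auto
  then have C_pos: "C > 0" using \<open>s \<ge> 0\<close> by (auto simp: C_def intro!: add_nonneg_pos)
  have A_nonneg: "A \<ge> 0" using assms(3,4) by (simp add: A_def)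
  show ?thesis
  proof (intro exI[of _ C] conjI C_pos allI impI)
    fix n :: nat and M :: "'a measure" and \<xi> :: "nat \<Rightarrow> 'a \<Rightarrow> real"
    assume n: "n \<ge> 2" and M: "prob_space M" and ind: "prob_space.indep_vars M (\<lambda>_. borel) \<xi> {1..n}"
      and dens: "\<forall>i\<in>{1..n}. distributed M lborel (\<xi> i) (\<lambda>t. ennreal (f t))"
      and med: "is_pseudomedian M \<xi> 0"
      and der1: "deriv_ge_near (walsh_cdf M (observation \<theta> \<xi>)) \<theta> c\<^sub>0 \<kappa>\<^sub>0"
      and der2: "abs_deriv2_le_near (walsh_cdf M (observation \<theta> \<xi>)) \<theta> c\<^sub>1 \<kappa>\<^sub>1"
    interpret M: prob_space M by fact
    have distr: "distr M borel (\<xi> i) = D" and rv [measurable]: "\<xi> i \<in> borel_measurable M" if "i \<in> {1..n}" for i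
    proof -
      have d: "distributed M lborel (\<xi> i) (\<lambda>t. ennreal (f t))" using dens that by auto
      have "distr M borel (\<xi> i) = distr M lborel (\<xi> i)" by (rule distr_cong) auto
      then show "distr M borel (\<xi> i) = D" using d by (simp add: D_def distributed_def)
      show "\<xi> i \<in> borel_measurable M" using d by (simp add: distributed_def)
    qed
    have in_n: "1 \<in> {1..n}" "2 \<in> {1..n}" using n by auto
    note [measurable] = rv[OF in_n(1)] rv[OF in_n(2)]
    have D: "real_distribution D"
      unfolding distr[OF in_n(1), symmetric] by (rule M.real_distribution_distr) (rule rv[OF in_n(1)])
    interpret D: real_distribution D by (rule D)
    have f_meas: "(\<lambda>t. ennreal (f t)) \<in> borel_measurable lborel"
      using bspec[OF dens in_n(1)] by (simp add: distributed_def)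
    have lip: "\<bar>cdf D x - cdf D y\<bar> \<le> B * \<bar>x - y\<bar>" for x y
      by (rule cdf_density_lipschitz[OF D D_def f_meas _ B_nonneg]) (rule order_trans[OF abs_ge_self B])
    have cont: "isCont (cdf D) x" for x
    proof -
      have "((\<lambda>y. B * \<bar>y - x\<bar>) \<longlongrightarrow> B * \<bar>x - x\<bar>) (at x)" by (intro tendsto_intros)
      then have lim: "((\<lambda>y. B * \<bar>y - x\<bar>) \<longlongrightarrow> 0) (at x)" by simp
      have "((\<lambda>y. cdf D y - cdf D x) \<longlongrightarrow> 0) (at x)"
        by (rule Lim_null_comparison[OF always_eventually lim]) (simp only: real_norm_def lip simp_thms)
      then show ?thesis unfolding isCont_def by (simp add: LIM_zero_iff)
    qed
    have "M.indep_var borel (\<xi> 1) borel (\<xi> 2)"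
      using M.indep_var_rest[OF ind in_n(1), of "\<lambda>y. y 2" borel] in_n by simp
    note conv = M.sum_cdf_eq_convolution[OF this distr[OF in_n(1)] distr[OF in_n(2)]]
    have U_eq: "walsh_cdf M (observation \<theta> \<xi>) = G"
    proof
      fix t
      have "walsh_cdf M (observation \<theta> \<xi>) t = M.prob {\<omega> \<in> space M. \<xi> 1 \<omega> + \<xi> 2 \<omega> \<le> 2 * (t - \<theta>)}"
        unfolding walsh_cdf_def observation_def by (intro arg_cong[where f = M.prob]) (auto simp: field_simps)
      then show "walsh_cdf M (observation \<theta> \<xi>) t = G t" unfolding conv G_def .
    qed
    have mean_half: "(\<integral>x. cdf D (- x) \<partial>D) = 1 / 2"
    proof (rule antisym)
      have ge: "M.prob {\<omega> \<in> space M. \<xi> 1 \<omega> + \<xi> 2 \<omega> \<le> 0} \<ge> 1 / 2"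
        and le: "M.prob {\<omega> \<in> space M. \<xi> 1 \<omega> + \<xi> 2 \<omega> \<ge> 0} \<ge> 1 / 2"
        using med unfolding is_pseudomedian_def is_median_def by auto
      show "1 / 2 \<le> (\<integral>x. cdf D (- x) \<partial>D)" using ge conv[of 0] by simp
      have int: "integrable D (\<lambda>x. cdf D (c - x))" for c
      proof (rule D.integrable_bounded[of _ 1])
        have [measurable]: "cdf D \<in> borel_measurable borel"
          using D.cdf_nondecreasing by (intro borel_measurable_mono) (simp add: mono_def)
        show "(\<lambda>x. cdf D (c - x)) \<in> borel_measurable D" by measurable
      qed (use D.cdf_nonneg D.cdf_bounded_prob in auto)
      \<comment> \<open>The median only bounds the probability of a strictly negative sum; shifting by \<open>\<epsilon>\<close> and the
        Lipschitz bound for \<open>F\<close> reach the sum being at most zero.\<close>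
      show "(\<integral>x. cdf D (- x) \<partial>D) \<le> 1 / 2"
      proof (rule field_le_epsilon)
        fix e :: real assume e: "e > 0"
        define \<epsilon> where "\<epsilon> = e / (B + 1)"
        have \<epsilon>: "\<epsilon> > 0" "B * \<epsilon> \<le> e" using e B_nonneg by (auto simp: \<epsilon>_def field_simps)
        have nonneg: "{\<omega> \<in> space M. \<xi> 1 \<omega> + \<xi> 2 \<omega> \<ge> 0} \<in> M.events" by measurable
        have "M.prob {\<omega> \<in> space M. \<xi> 1 \<omega> + \<xi> 2 \<omega> \<le> - \<epsilon>}
            \<le> M.prob (space M - {\<omega> \<in> space M. \<xi> 1 \<omega> + \<xi> 2 \<omega> \<ge> 0})"
          using \<epsilon> by (intro M.finite_measure_mono sets.compl_sets nonneg) auto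
        also have "\<dots> = 1 - M.prob {\<omega> \<in> space M. \<xi> 1 \<omega> + \<xi> 2 \<omega> \<ge> 0}"
          by (rule M.prob_compl[OF nonneg])
        finally have half: "(\<integral>x. cdf D (- \<epsilon> - x) \<partial>D) \<le> 1 / 2" using le conv[of "- \<epsilon>"] by simp
        have "(\<integral>x. cdf D (0 - x) \<partial>D) \<le> (\<integral>x. cdf D (- \<epsilon> - x) + e \<partial>D)"
        proof (rule integral_mono[OF int])
          fix x
          show "cdf D (0 - x) \<le> cdf D (- \<epsilon> - x) + e"
            using lip[of "0 - x" "- \<epsilon> - x"] \<epsilon> by (simp add: abs_le_iff)
        qed (use int in simp)
        also have "\<dots> = (\<integral>x. cdf D (- \<epsilon> - x) \<partial>D) + e" using int D.prob_space by simp
        finally show "(\<integral>x. cdf D (- x) \<partial>D) \<le> 1 / 2 + e" using half by simp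
      qed
    qed
    have s_sq: "s\<^sup>2 = (\<integral>x. (cdf D (- x) - 1 / 2)\<^sup>2 \<partial>D)" and s_pos: "s > 0"
      using D.variance_cdf_reflection_pos[OF cont] by (auto simp: s_def)
    interpret sample M D n \<xi> B s
    proof
      show "2 \<le> n" by (rule n)
      show "M.indep_vars (\<lambda>_. borel) \<xi> {1..n}" by (rule ind)
    qed (use distr lip s_pos s_sq mean_half in auto)
    have "L \<ge> \<kappa>\<^sub>0"
      using der1 assms(1) unfolding U_eq deriv_ge_near_def L_def by (auto dest: spec[of _ 0])
    then have L: "L > 0" using assms(2) by simp
    have taylor: "\<bar>H \<delta> - 1 / 2 - L * \<delta>\<bar> \<le> A * \<delta>\<^sup>2" for \<delta>
    proof -
      have G01: "0 \<le> G t" "G t \<le> 1" for t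
        unfolding U_eq[symmetric] walsh_cdf_def by auto
      have "\<bar>G (\<theta> + \<delta>) - G \<theta> - deriv G \<theta> * \<delta>\<bar> \<le> A * \<delta>\<^sup>2"
        unfolding A_def using L
        by (intro taylor_quadratic_bound assms(3,4) G01 der2[unfolded U_eq]) (simp add: L_def)
      moreover have "G (\<theta> + \<delta>) = H \<delta>" "G \<theta> = 1 / 2"
        using mean_half by (simp_all add: G_def H_def)
      ultimately show ?thesis by (simp add: L_def)
    qed
    have sd: "hodges_lehmann_sd M \<theta> \<xi> = \<sigma>"
    proof -
      have mean: "M.expectation (\<lambda>\<omega>. cdf D (- \<xi> 1 \<omega>)) = 1 / 2"
        using expectation_Y[OF in_n(1), of "\<lambda>x. cdf D (- x)"] mean_half by simp
      have var: "M.expectation (\<lambda>\<omega>. (cdf D (- \<xi> 1 \<omega>) - 1 / 2)\<^sup>2) = s\<^sup>2"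
        using expectation_Y[OF in_n(1), of "\<lambda>x. (cdf D (- x) - 1 / 2)\<^sup>2"] s_sq by simp
      have "hodges_lehmann_sd M \<theta> \<xi> = sqrt (4 * s\<^sup>2 / L\<^sup>2)"
        unfolding hodges_lehmann_sd_def distr[OF in_n(1)] U_eq L_def mean var ..
      also have "\<dots> = 2 * s / L"
        using s_pos L by (simp add: real_sqrt_divide real_sqrt_mult)
      finally show ?thesis by (simp add: \<sigma>_def)
    qed
    show "(SUP z. \<bar>measure M {\<omega> \<in> space M.
                        sqrt (real n) * (hodges_lehmann n (\<lambda>i. observation \<theta> \<xi> i \<omega>) - \<theta>)
                          / hodges_lehmann_sd M \<theta> \<xi> \<le> z}
                    - cdf std_normal_distribution z\<bar>)
             \<le> C * ln (real n) / sqrt (real n)"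
      unfolding sd observation_def C_def K_def \<sigma>_def
      by (rule cSUP_least) (simp, rule hodges_lehmann_berry_esseen[OF L A_nonneg taylor])
  qed
qed

end
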